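(* Let $(G,\rho,X)$ satisfy the standing hypotheses, let $\pi$ be an SAF representation of $G(\mathbb{R})$ with central character, and let $\psi$ be a nontrivial additive character of $\mathbb{R}$. For any $a\in\mathbb{R}^\times$, let $\psi_a$ be the additive character $x\mapsto\psi(ax)$. Then (i) $\check\gamma(\pi,\lambda;\psi_{-1})\,\gamma(\pi,\lambda;\psi)=A(\psi)\cdot\mathrm{id}_{\mathcal{N}_\pi(\check{X}^+)}$ as meromorphic families in $\lambda\in\Lambda_{\mathbb{C}}$; (ii) $\gamma(\pi,\lambda;\psi_a)=|a|^{-d(\lambda)-\frac12\dim X}\,\gamma(\pi,\lambda;\psi)\circ m_a$ for all $a\in\mathbb{R}^\times$, as meromorphic families in $\lambda$.
   Context: Setting. $G$ is a connected reductive group over $\mathbb{R}$, $X\neq\{0\}$ a finite-dimensional $\mathbb{R}$-vector space, $\rho:G\to\mathrm{GL}(X)$ a homomorphism of algebraic groups; $\mathrm{GL}(X)$, hence $G$, acts on the right of $X$. Standing hypotheses: (1) there is a Zariski-open dense $G$-orbit $X^+\subset X$; (2) $\partial X:=X\smallsetminus X^+$ is a hypersurface; (3) $X^+$ is spherical, i.e. $X^+_{\mathbb{C}}$ has an open orbit under a Borel subgroup of $G_{\mathbb{C}}$. Relative invariants. A relative invariant is a nonzero $f\in\mathbb{R}(X)$ with $f(xg)=\omega(g)f(x)$ for some algebraic character $\omega:G\to\mathbb{G}_m$ over $\mathbb{R}$, its eigencharacter. $\mathbf{X}^*_\rho(G)$ is the group of eigencharacters of relative invariants. The basic relative invariants $f_1,\dots,f_r\in\mathbb{R}[X]$,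 with eigencharacters $\omega_1,\dots,\omega_r$, are the irreducible polynomials defining the irreducible components of $\partial X$ (fixed); $\mathbf{X}^*_\rho(G)=\bigoplus_i\mathbb{Z}\omega_i$. $\Lambda_{\mathbb{C}}:=\mathbf{X}^*_\rho(G)\otimes_{\mathbb{Z}}\mathbb{C}$. For $\lambda=\sum_i\omega_i\otimes\lambda_i\in\Lambda_{\mathbb{C}}$, $|f|^\lambda:=\prod_i|f_i|^{\lambda_i}$. Half-densities. The product of two half-densities is a density, which can be integrated. $C^\infty(X^+)$ is the Fréchet space of (complex-valued) $C^\infty$ half-densities on $X^+(\mathbb{R})$. For $0\neq\Omega\in\bigwedge^{\max}\check{X}$ (a translation-invariant volume form on $X$), $\mathcal{S}(X):=\mathcal{S}_0(X)|\Omega|^{1/2}$, with $\mathcal{S}_0(X)$ the space of scalar Schwartz functions on $X(\mathbb{R})$. $G(\mathbb{R})$ acts on the left of these spaces by pull-back along $x\mapsto xg$. Zeta integrals. An SAF (Casselman–Wallach) representation is a smooth admissible Fréchet representation of moderate growth, with underlying space $V_\pi$. $\mathcal{N}_\pi(X^+):=\mathrm{Hom}_{G(\mathbb{R})}(\pi,C^\infty(X^+))$ (continuous equivariant maps), finite-dimensional. $Z_\lambda(\eta,v,\xi):=\int_{X^+(\mathbb{R})}\eta(v)|f|^\lambda\xi$ for $\eta\in\mathcal{N}_\pi(X^+)$, $v\in V_\pi$, $\xi\in\mathcal{S}(X)$, convergent for $\mathrm{Re}(\lambda_i)\gg0$ for all $i$, with meromorphic continuation to $\Lambda_{\mathbb{C}}$.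 Dual side. $\check{X}$ is the dual space with contragredient right $G$-action $\check\rho$. $(G,\check\rho,\check{X})$ satisfies the same hypotheses, with open orbit $\check{X}^+$, and $\mathbf{X}^*_{\check\rho}(G)=\mathbf{X}^*_\rho(G)$. Fix basic relative invariants $\check{f}_1,\dots,\check{f}_r\in\mathbb{R}[\check{X}]$ with eigencharacters $\check\omega_1,\dots,\check\omega_r$; for $\lambda=\sum_i\check\omega_i\otimes\lambda_i\in\Lambda_{\mathbb{C}}$ put $|\check{f}|^\lambda:=\prod_i|\check{f}_i|^{\lambda_i}$ and $d(\lambda):=\sum_i\lambda_i\deg\check{f}_i$. $\check{Z}_\lambda(\check\eta,v,\check\xi):=\int_{\check{X}^+(\mathbb{R})}\check\eta(v)|\check{f}|^\lambda\check\xi$, continued meromorphically. Fourier transform. Given $\Omega$ take $\Psi\in\bigwedge^{\max}X$ with $\langle\Omega,\Psi\rangle=1$. Put $(\mathcal{F}_{\psi,|\Omega|}\xi_0)(\check{x})=\int_{X(\mathbb{R})}\xi_0(x)\psi(\langle\check{x},x\rangle)|\Omega|$ and $\mathcal{F}_\psi(\xi_0|\Omega|^{1/2}):=\mathcal{F}_{\psi,|\Omega|}(\xi_0)|\Psi|^{1/2}$; $\mathcal{F}_\psi:\mathcal{S}(X)\to\mathcal{S}(\check{X})$ is independent of $\Omega$. Let $|\Psi|'$ be the Haar measure on $\check{X}(\mathbb{R})$ with $\int_{\check{X}}|\mathcal{F}_{\psi,|\Omega|}\xi_0|^2\,|\Psi|'=\int_X|\xi_0|^2\,|\Omega|$ for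 all $\xi_0$; then $A(\psi):=|\Psi|/|\Psi|'\in\mathbb{R}_{>0}$, which depends only on $\psi$ and $X$. $\gamma$-factors. $\gamma(\pi,\lambda;\psi):\mathcal{N}_\pi(\check{X}^+)\to\mathcal{N}_\pi(X^+)$ is the unique meromorphic family of linear maps with $\check{Z}_\lambda(\check\eta,v,\mathcal{F}_\psi\xi)=Z_\lambda(\gamma(\pi,\lambda;\psi)(\check\eta),v,\xi)$ for all $\check\eta,v$ and $\xi\in\mathcal{S}(X)$ (it exists). $\check\gamma(\pi,\lambda;\psi):\mathcal{N}_\pi(X^+)\to\mathcal{N}_\pi(\check{X}^+)$ is the $\gamma$-factor defined relative to $(G,\check\rho,\check{X})$ and $\psi$ (the dual of $\check{X}$ being identified with $X$). $m_a:C^\infty(\check{X}^+)\to C^\infty(\check{X}^+)$ is the pull-back of half-densities along $y\mapsto a^{-1}y$, which is $G(\mathbb{R})$-equivariant; it acts on $\mathcal{N}_\pi(\check{X}^+)$ by $\check\eta\mapsto m_a\circ\check\eta$. *)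

theory Defs
  imports
    "HOL-Analysis.Analysis"
    "HOL-Library.Poly_Mapping"
    "HOL-Computational_Algebra.Factorial_Ring"
    "HOL-Algebra.Solvable_Groups"
begin

section \<open>Polynomials and Zariski topologies\<close>

type_synonym ('x, 'k) mpoly = "('x \<Rightarrow>\<^sub>0 nat) \<Rightarrow>\<^sub>0 'k"

definition mpoly_eval :: "('x::finite, 'k::comm_semiring_1) mpoly \<Rightarrow> ('x \<Rightarrow> 'k) \<Rightarrow> 'k" where
  "mpoly_eval p x =
     (\<Sum>m\<in>Poly_Mapping.keys p. Poly_Mapping.lookup p m * (\<Prod>i\<in>UNIV. x i ^ Poly_Mapping.lookup m i))"

definition total_degree :: "('x::finite, 'k::zero) mpoly \<Rightarrow> nat" where
  "total_degree p = (if p = 0 then 0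
     else Max ((\<lambda>m. \<Sum>i\<in>UNIV. Poly_Mapping.lookup m i) ` Poly_Mapping.keys p))"

definition complexify :: "('x, real) mpoly \<Rightarrow> ('x, complex) mpoly" where
  "complexify p = Poly_Mapping.map complex_of_real p"

definition entries :: "'k ^ 'b ^ 'a \<Rightarrow> 'a \<times> 'b \<Rightarrow> 'k" where
  "entries A = (\<lambda>(i, j). A $ i $ j)"

definition zero_locus :: "('n::finite, real) mpoly \<Rightarrow> (complex ^ 'n) set" where
  "zero_locus p = {x. mpoly_eval (complexify p) (vec_nth x) = 0}"

text \<open>
  An affine variety over \<open>\<real>\<close> is represented by its set of complex points. Its Zariski topology as an
  \<open>\<real>\<close>-variety is the one whose closed sets are the zero loci of sets of real polynomials
  (\<open>zariski_R\<close>); the topology of its complexification is \<open>zariski_C\<close>. The argument \<open>coord\<close> gives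
  the affine coordinates of a point.
\<close>

definition zariski_C :: "('p \<Rightarrow> 'x::finite \<Rightarrow> complex) \<Rightarrow> 'p topology" where
  "zariski_C coord = topology_generated_by
     {U. \<exists>q :: ('x, complex) mpoly. U = {x. mpoly_eval q (coord x) \<noteq> 0}}"

definition zariski_R :: "('p \<Rightarrow> 'x::finite \<Rightarrow> complex) \<Rightarrow> 'p topology" where
  "zariski_R coord = topology_generated_by
     {U. \<exists>q :: ('x, real) mpoly. U = {x. mpoly_eval (complexify q) (coord x) \<noteq> 0}}"

definition irreducible_in :: "'p topology \<Rightarrow> 'p set \<Rightarrow> bool" where
  "irreducible_in T S \<longleftrightarrow> S \<noteq> {} \<and> S \<subseteq> topspace T \<and>
     (\<forall>C D. closedin T C \<and> closedin T D \<and> S \<subseteq> C \<union> D \<longrightarrow> S \<subseteq> C \<or> S \<subseteq> D)"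

definition irreducible_components :: "'p topology \<Rightarrow> 'p set \<Rightarrow> 'p set set" where
  "irreducible_components T S = {C. C \<subseteq> S \<and> irreducible_in T C \<and>
     (\<forall>D. C \<subseteq> D \<and> D \<subseteq> S \<and> irreducible_in T D \<longrightarrow> D = C)}"

definition complex_vec :: "real ^ 'n \<Rightarrow> complex ^ 'n" where
  "complex_vec x = (\<chi> i. complex_of_real (x $ i))"

definition complex_mat :: "real ^ 'b ^ 'a \<Rightarrow> complex ^ 'b ^ 'a" where
  "complex_mat A = (\<chi> i j. complex_of_real (A $ i $ j))"

definition real_mat :: "complex ^ 'b ^ 'a \<Rightarrow> real ^ 'b ^ 'a" where
  "real_mat A = (\<chi> i j. Re (A $ i $ j))"

definition real_points :: "(complex ^ 'n) set \<Rightarrow> (real ^ 'n) set" where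
  "real_points S = {x. complex_vec x \<in> S}"

definition real_group :: "(complex ^ 'm ^ 'm) set \<Rightarrow> (real ^ 'm ^ 'm) set" where
  "real_group G = {g. complex_mat g \<in> G}"


section \<open>Linear algebraic groups\<close>

definition GL :: "('k::field ^ 'm ^ 'm) monoid" where
  "GL = \<lparr>carrier = {A. invertible A}, monoid.mult = (**), one = mat 1\<rparr>"

definition subgrp :: "('k::field ^ 'm ^ 'm) set \<Rightarrow> ('k ^ 'm ^ 'm) monoid" where
  "subgrp H = GL\<lparr>carrier := H\<rparr>"

definition algebraic_subgroup_C :: "(complex ^ 'm ^ 'm) set \<Rightarrow> bool" where
  "algebraic_subgroup_C H \<longleftrightarrow> subgroup H GL \<and>
     closedin (subtopology (zariski_C entries) (carrier GL)) H"

definition algebraic_subgroup_R :: "(complex ^ 'm ^ 'm) set \<Rightarrow> bool" where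
  "algebraic_subgroup_R H \<longleftrightarrow> subgroup H GL \<and>
     closedin (subtopology (zariski_R entries) (carrier GL)) H"

definition unipotent_set :: "(complex ^ 'm ^ 'm) set \<Rightarrow> bool" where
  "unipotent_set H \<longleftrightarrow> (\<forall>g\<in>H. \<exists>k. ((\<lambda>B. (g - mat 1) ** B) ^^ k) (mat 1) = 0)"

definition connected_reductive_group_R :: "(complex ^ 'm ^ 'm) set \<Rightarrow> bool" where
  "connected_reductive_group_R G \<longleftrightarrow>
     algebraic_subgroup_R G \<and> connectedin (zariski_C entries) G \<and>
     (\<forall>H. algebraic_subgroup_C H \<and> H \<lhd> subgrp G \<and> connectedin (zariski_C entries) H \<and>
          unipotent_set H \<longrightarrow> H = {mat 1})"

definition connected_solvable_subgroup ::
    "(complex ^ 'm ^ 'm) set \<Rightarrow> (complex ^ 'm ^ 'm) set \<Rightarrow> bool" where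
  "connected_solvable_subgroup G B \<longleftrightarrow> B \<subseteq> G \<and> algebraic_subgroup_C B \<and>
     connectedin (zariski_C entries) B \<and> solvable (subgrp B)"

definition borel_subgroup :: "(complex ^ 'm ^ 'm) set \<Rightarrow> (complex ^ 'm ^ 'm) set \<Rightarrow> bool" where
  "borel_subgroup G B \<longleftrightarrow> connected_solvable_subgroup G B \<and>
     (\<forall>B'. B \<subseteq> B' \<and> connected_solvable_subgroup G B' \<longrightarrow> B' = B)"

definition regular_function_R ::
    "(complex ^ 'm ^ 'm) set \<Rightarrow> (complex ^ 'm ^ 'm \<Rightarrow> complex) \<Rightarrow> bool" where
  "regular_function_R G u \<longleftrightarrow> (\<exists>(q :: ('m \<times> 'm, real) mpoly) k.
     \<forall>g\<in>G. u g = mpoly_eval (complexify q) (entries g) / det g ^ k)"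

text \<open>
  Elements of \<open>X\<close> are row vectors, so that \<open>GL(X)\<close> acts on the right by \<open>x v* A\<close>. The group of
  complex points of \<open>GL(X)\<close> is \<open>GL\<close>.
\<close>

definition algebraic_hom_R ::
    "(complex ^ 'm ^ 'm) set \<Rightarrow> (complex ^ 'm ^ 'm \<Rightarrow> complex ^ 'n ^ 'n) \<Rightarrow> bool" where
  "algebraic_hom_R G \<rho> \<longleftrightarrow> \<rho> \<in> hom (subgrp G) GL \<and>
     (\<forall>i j. regular_function_R G (\<lambda>g. \<rho> g $ i $ j))"

text \<open>
  The dual space is given the dual coordinates, so the pairing is \<open>y \<bullet> x\<close>, and the contragredient
  right action is characterised by \<open>(y g) \<bullet> (x g) = y \<bullet> x\<close>.
\<close>

definition contragredient ::
    "(complex ^ 'm ^ 'm \<Rightarrow> complex ^ 'n ^ 'n) \<Rightarrow> complex ^ 'm ^ 'm \<Rightarrow> complex ^ 'n ^ 'n" where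
  "contragredient \<rho> g = transpose (matrix_inv (\<rho> g))"

type_synonym 'm charac = "complex ^ 'm ^ 'm \<Rightarrow> complex"

definition algebraic_character_R :: "(complex ^ 'm ^ 'm) set \<Rightarrow> 'm charac \<Rightarrow> bool" where
  "algebraic_character_R G \<theta> \<longleftrightarrow> \<theta> \<in> extensional G \<and> regular_function_R G \<theta> \<and>
     (\<forall>g\<in>G. \<theta> g \<noteq> 0) \<and> (\<forall>g\<in>G. \<forall>h\<in>G. \<theta> (g ** h) = \<theta> g * \<theta> h)"


section \<open>Prehomogeneous spaces and relative invariants\<close>

definition open_dense_orbit ::
    "(complex ^ 'm ^ 'm) set \<Rightarrow> (complex ^ 'm ^ 'm \<Rightarrow> complex ^ 'n ^ 'n) \<Rightarrow> (complex ^ 'n) set \<Rightarrow> bool" where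
  "open_dense_orbit G \<rho> Xp \<longleftrightarrow> (\<exists>x. Xp = (\<lambda>g. x v* \<rho> g) ` G) \<and>
     openin (zariski_R vec_nth) Xp \<and> zariski_R vec_nth closure_of Xp = UNIV"

definition hypersurface :: "(complex ^ 'n) set \<Rightarrow> bool" where
  "hypersurface S \<longleftrightarrow> (\<exists>q. total_degree q > 0 \<and> S = zero_locus q)"

definition spherical_orbit ::
    "(complex ^ 'm ^ 'm) set \<Rightarrow> (complex ^ 'm ^ 'm \<Rightarrow> complex ^ 'n ^ 'n) \<Rightarrow> (complex ^ 'n) set \<Rightarrow> bool" where
  "spherical_orbit G \<rho> Xp \<longleftrightarrow> (\<exists>B. borel_subgroup G B \<and>
     (\<exists>x\<in>Xp. openin (subtopology (zariski_C vec_nth) Xp) ((\<lambda>g. x v* \<rho> g) ` B)))"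

definition standing_hypotheses ::
    "(complex ^ 'm ^ 'm) set \<Rightarrow> (complex ^ 'm ^ 'm \<Rightarrow> complex ^ 'n ^ 'n) \<Rightarrow> (complex ^ 'n) set \<Rightarrow> bool" where
  "standing_hypotheses G \<rho> Xp \<longleftrightarrow> connected_reductive_group_R G \<and> algebraic_hom_R G \<rho> \<and>
     open_dense_orbit G \<rho> Xp \<and> hypersurface (- Xp) \<and> spherical_orbit G \<rho> Xp"

definition basic_relative_invariants ::
    "(complex ^ 'n) set \<Rightarrow> ('r \<Rightarrow> ('n, real) mpoly) \<Rightarrow> bool" where
  "basic_relative_invariants Xp f \<longleftrightarrow> (\<forall>i. irreducible (f i)) \<and>
     bij_betw (\<lambda>i. zero_locus (f i)) UNIV (irreducible_components (zariski_R vec_nth) (- Xp))"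

text \<open>
  \<open>p / q\<close> is a relative invariant with eigencharacter \<open>\<theta>\<close>: the identity
  \<open>(p / q)(x g) = \<theta>(g) (p / q)(x)\<close> of rational functions is cleared of denominators.
\<close>

definition relative_invariant ::
    "(complex ^ 'm ^ 'm) set \<Rightarrow> (complex ^ 'm ^ 'm \<Rightarrow> complex ^ 'n ^ 'n) \<Rightarrow>
     ('n, real) mpoly \<Rightarrow> ('n, real) mpoly \<Rightarrow> 'm charac \<Rightarrow> bool" where
  "relative_invariant G \<rho> p q \<theta> \<longleftrightarrow> p \<noteq> 0 \<and> q \<noteq> 0 \<and> algebraic_character_R G \<theta> \<and>
     (\<forall>g\<in>G. \<forall>x.
        mpoly_eval (complexify p) (vec_nth (x v* \<rho> g)) * mpoly_eval (complexify q) (vec_nth x) =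
        \<theta> g * mpoly_eval (complexify p) (vec_nth x) * mpoly_eval (complexify q) (vec_nth (x v* \<rho> g)))"

definition eigencharacters ::
    "(complex ^ 'm ^ 'm) set \<Rightarrow> (complex ^ 'm ^ 'm \<Rightarrow> complex ^ 'n ^ 'n) \<Rightarrow> 'm charac set" where
  "eigencharacters G \<rho> = {\<theta>. \<exists>p q. relative_invariant G \<rho> p q \<theta>}"

definition Z_basis ::
    "(complex ^ 'm ^ 'm) set \<Rightarrow> 'm charac set \<Rightarrow> ('r::finite \<Rightarrow> 'm charac) \<Rightarrow> bool" where
  "Z_basis G X \<omega> \<longleftrightarrow>
     bij_betw (\<lambda>n :: 'r \<Rightarrow> int. restrict (\<lambda>g. \<Prod>i\<in>UNIV. \<omega> i g powi n i) G) UNIV X"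

text \<open>
  For a group \<open>X\<close> of characters, \<open>X \<otimes>\<^sub>\<int> \<complex>\<close> is the quotient of the \<open>\<complex>\<close>-vector space of finitely
  supported functions on \<open>X\<close> by the span of the elements \<open>[\<theta> \<theta>'] - [\<theta>] - [\<theta>']\<close>. Its elements are
  the cosets \<open>tensor_coset G X u\<close>.
\<close>

inductive_set tensor_relations ::
    "(complex ^ 'm ^ 'm) set \<Rightarrow> 'm charac set \<Rightarrow> ('m charac \<Rightarrow> complex) set"
  for G :: "(complex ^ 'm ^ 'm) set" and X :: "'m charac set" where
  zero: "(\<lambda>_. 0) \<in> tensor_relations G X"
| add: "\<lbrakk>u \<in> tensor_relations G X; \<theta> \<in> X; \<theta>' \<in> X\<rbrakk> \<Longrightarrow>
    (\<lambda>\<zeta>. u \<zeta> + c * (indicator {restrict (\<lambda>g. \<theta> g * \<theta>' g) G} \<zeta> - indicator {\<theta>} \<zeta> - indicator {\<theta>'} \<zeta>))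
      \<in> tensor_relations G X"

type_synonym 'm tensor = "('m charac \<Rightarrow> complex) set"

definition tensor_coset ::
    "(complex ^ 'm ^ 'm) set \<Rightarrow> 'm charac set \<Rightarrow> ('m charac \<Rightarrow> complex) \<Rightarrow> 'm tensor" where
  "tensor_coset G X u = {v. finite {\<theta>. v \<theta> \<noteq> 0} \<and> {\<theta>. v \<theta> \<noteq> 0} \<subseteq> X \<and>
     (\<lambda>\<theta>. v \<theta> - u \<theta>) \<in> tensor_relations G X}"

text \<open>
  \<open>tensor_sum G X \<omega> s\<close> is the element \<open>\<Sum>\<^sub>i \<omega>\<^sub>i \<otimes> s\<^sub>i\<close>. When \<open>\<omega>\<close> is a basis of \<open>X\<close>, it is a linear
  isomorphism from \<open>\<complex>\<^sup>r\<close> onto \<open>X \<otimes> \<complex>\<close>, that is, a global chart.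
\<close>

definition tensor_sum ::
    "(complex ^ 'm ^ 'm) set \<Rightarrow> 'm charac set \<Rightarrow> ('r::finite \<Rightarrow> 'm charac) \<Rightarrow> complex ^ 'r \<Rightarrow> 'm tensor" where
  "tensor_sum G X \<omega> s = tensor_coset G X (\<lambda>\<theta>. \<Sum>i\<in>UNIV. s $ i * indicator {\<omega> i} \<theta>)"

definition degree_form ::
    "(complex ^ 'r \<Rightarrow> 'm tensor) \<Rightarrow> ('r::finite \<Rightarrow> ('n::finite, real) mpoly) \<Rightarrow> 'm tensor \<Rightarrow> complex" where
  "degree_form L f l =
     (THE d. \<exists>s. l = L s \<and> d = (\<Sum>i\<in>UNIV. s $ i * of_nat (total_degree (f i))))"


section \<open>Meromorphic functions on \<open>\<complex>\<^sup>r\<close>\<close>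

definition holomorphic_vec :: "(complex ^ 'r) set \<Rightarrow> (complex ^ 'r \<Rightarrow> complex) \<Rightarrow> bool" where
  "holomorphic_vec U F \<longleftrightarrow> (\<forall>z\<in>U. \<exists>D. (F has_derivative D) (at z) \<and> (\<forall>c w. D (c *s w) = c * D w))"

text \<open>
  A meromorphic function is represented by a total function; its values on the zero locus of a local
  denominator carry no information. Accordingly, identities between meromorphic functions are
  identities that hold outside such loci.
\<close>

definition meromorphic_vec :: "(complex ^ 'r \<Rightarrow> complex) \<Rightarrow> bool" where
  "meromorphic_vec F \<longleftrightarrow> (\<forall>z. \<exists>e>0. \<exists>p q. holomorphic_vec (ball z e) p \<and> holomorphic_vec (ball z e) q \<and>
     (\<exists>w\<in>ball z e. q w \<noteq> 0) \<and> (\<forall>w\<in>ball z e. q w \<noteq> 0 \<longrightarrow> F w = p w / q w))"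

definition generically :: "(complex ^ 'r \<Rightarrow> bool) \<Rightarrow> bool" where
  "generically P \<longleftrightarrow> (\<forall>z. \<exists>e>0. \<exists>q. holomorphic_vec (ball z e) q \<and>
     (\<exists>w\<in>ball z e. q w \<noteq> 0) \<and> (\<forall>w\<in>ball z e. q w \<noteq> 0 \<longrightarrow> P w))"


section \<open>Frechet spaces and smooth maps\<close>

text \<open>
  A Frechet space is given by the scalar multiplication \<open>sc\<close> and a sequence \<open>p\<close> of seminorms defining
  the topology.
\<close>

definition frechet_space :: "(complex \<Rightarrow> 'v::ab_group_add \<Rightarrow> 'v) \<Rightarrow> (nat \<Rightarrow> 'v \<Rightarrow> real) \<Rightarrow> bool" where
  "frechet_space sc p \<longleftrightarrow> vector_space sc \<and>
     (\<forall>k u v. p k (u + v) \<le> p k u + p k v) \<and> (\<forall>k c v. p k (sc c v) = cmod c * p k v) \<and>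
     (\<forall>v. (\<forall>k. p k v = 0) \<longrightarrow> v = 0) \<and>
     (\<forall>s :: nat \<Rightarrow> 'v. (\<forall>k. \<forall>e>0. \<exists>M. \<forall>i\<ge>M. \<forall>j\<ge>M. p k (s i - s j) < e) \<longrightarrow>
        (\<exists>l. \<forall>k. (\<lambda>i. p k (s i - l)) \<longlonglongrightarrow> 0))"

text \<open>
  \<open>D es\<close> is the iterated directional derivative of \<open>F\<close> along the list \<open>es\<close>; all of these have to
  exist and to be continuous.
\<close>

definition smooth_map ::
    "(complex \<Rightarrow> 'v::ab_group_add \<Rightarrow> 'v) \<Rightarrow> (nat \<Rightarrow> 'v \<Rightarrow> real) \<Rightarrow> 'e::euclidean_space set \<Rightarrow> ('e \<Rightarrow> 'v) \<Rightarrow> bool" where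
  "smooth_map sc p U F \<longleftrightarrow> (\<exists>D. D [] = F \<and>
     (\<forall>es. set es \<subseteq> Basis \<longrightarrow> (\<forall>x\<in>U. \<forall>k.
        ((\<lambda>y. p k (D es y - D es x)) \<longlongrightarrow> 0) (at x) \<and>
        (\<forall>b\<in>Basis. ((\<lambda>t::real.
            p k (sc (of_real (1 / t)) (D es (x + t *\<^sub>R b) - D es x) - D (b # es) x)) \<longlongrightarrow> 0) (at 0)))))"

abbreviation smooth_function :: "'e::euclidean_space set \<Rightarrow> ('e \<Rightarrow> complex) \<Rightarrow> bool" where
  "smooth_function \<equiv> smooth_map (*) (\<lambda>_. cmod)"

primrec partial_derivs :: "'e::euclidean_space list \<Rightarrow> ('e \<Rightarrow> complex) \<Rightarrow> 'e \<Rightarrow> complex" where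
  "partial_derivs [] F = F"
| "partial_derivs (b # es) F =
     (\<lambda>x. vector_derivative (\<lambda>t. partial_derivs es F (x + t *\<^sub>R b)) (at 0))"

definition schwartz_function :: "('e::euclidean_space \<Rightarrow> complex) \<Rightarrow> bool" where
  "schwartz_function F \<longleftrightarrow> smooth_function UNIV F \<and>
     (\<forall>es k. set es \<subseteq> Basis \<longrightarrow> bounded (range (\<lambda>x. of_real ((1 + norm x) ^ k) * partial_derivs es F x)))"


section \<open>SAF representations\<close>

definition continuous_representation ::
    "(real ^ 'm ^ 'm) set \<Rightarrow> (complex \<Rightarrow> 'v::ab_group_add \<Rightarrow> 'v) \<Rightarrow> (nat \<Rightarrow> 'v \<Rightarrow> real) \<Rightarrow>
     (real ^ 'm ^ 'm \<Rightarrow> 'v \<Rightarrow> 'v) \<Rightarrow> bool" where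
  "continuous_representation H sc p \<pi> \<longleftrightarrow>
     (\<forall>g\<in>H. \<forall>c u v. \<pi> g (sc c u + v) = sc c (\<pi> g u) + \<pi> g v) \<and>
     (\<forall>v. \<pi> (mat 1) v = v) \<and> (\<forall>g\<in>H. \<forall>h\<in>H. \<forall>v. \<pi> (g ** h) v = \<pi> g (\<pi> h v)) \<and>
     (\<forall>g\<in>H. \<forall>v k. \<forall>e>0. \<exists>d>0. \<exists>l. \<forall>h\<in>H. \<forall>u.
        dist h g < d \<and> (\<forall>j\<le>l. p j (u - v) < d) \<longrightarrow> p k (\<pi> h u - \<pi> g v) < e)"

text \<open>
  A map on the closed submanifold \<open>H\<close> is smooth if it extends locally to a smooth map on an open set
  of matrices.
\<close>

definition smooth_representation ::
    "(real ^ 'm ^ 'm) set \<Rightarrow> (complex \<Rightarrow> 'v::ab_group_add \<Rightarrow> 'v) \<Rightarrow> (nat \<Rightarrow> 'v \<Rightarrow> real) \<Rightarrow>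
     (real ^ 'm ^ 'm \<Rightarrow> 'v \<Rightarrow> 'v) \<Rightarrow> bool" where
  "smooth_representation H sc p \<pi> \<longleftrightarrow> (\<forall>v. \<forall>g\<in>H. \<exists>U F. open U \<and> g \<in> U \<and> smooth_map sc p U F \<and>
     (\<forall>h\<in>U \<inter> H. F h = \<pi> h v))"

definition moderate_growth ::
    "(real ^ 'm ^ 'm) set \<Rightarrow> (nat \<Rightarrow> 'v \<Rightarrow> real) \<Rightarrow> (real ^ 'm ^ 'm \<Rightarrow> 'v \<Rightarrow> 'v) \<Rightarrow> bool" where
  "moderate_growth H p \<pi> \<longleftrightarrow> (\<forall>k. \<exists>l C M. \<forall>g\<in>H. \<forall>v.
     p k (\<pi> g v) \<le> C * max (norm g) (norm (matrix_inv g)) ^ M * (\<Sum>j\<le>l. p j v))"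

definition finite_dimensional :: "(complex \<Rightarrow> 'v::ab_group_add \<Rightarrow> 'v) \<Rightarrow> 'v set \<Rightarrow> bool" where
  "finite_dimensional sc W \<longleftrightarrow> (\<exists>B. finite B \<and> W \<subseteq> module.span sc B)"

definition invariant_subspace ::
    "'g set \<Rightarrow> (complex \<Rightarrow> 'v::ab_group_add \<Rightarrow> 'v) \<Rightarrow> ('g \<Rightarrow> 'v \<Rightarrow> 'v) \<Rightarrow> 'v set \<Rightarrow> bool" where
  "invariant_subspace K sc \<pi> W \<longleftrightarrow> module.subspace sc W \<and> (\<forall>k\<in>K. \<pi> k ` W \<subseteq> W)"

definition irreducible_subspace ::
    "'g set \<Rightarrow> (complex \<Rightarrow> 'v::ab_group_add \<Rightarrow> 'v) \<Rightarrow> ('g \<Rightarrow> 'v \<Rightarrow> 'v) \<Rightarrow> 'v set \<Rightarrow> bool" where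
  "irreducible_subspace K sc \<pi> W \<longleftrightarrow> invariant_subspace K sc \<pi> W \<and> W \<noteq> {0} \<and>
     (\<forall>W'\<subseteq>W. invariant_subspace K sc \<pi> W' \<longrightarrow> W' = {0} \<or> W' = W)"

definition isomorphic_subspaces ::
    "'g set \<Rightarrow> (complex \<Rightarrow> 'v::ab_group_add \<Rightarrow> 'v) \<Rightarrow> ('g \<Rightarrow> 'v \<Rightarrow> 'v) \<Rightarrow> 'v set \<Rightarrow> 'v set \<Rightarrow> bool" where
  "isomorphic_subspaces K sc \<pi> W W' \<longleftrightarrow> (\<exists>T. bij_betw T W W' \<and>
     (\<forall>c. \<forall>u\<in>W. \<forall>w\<in>W. T (sc c u + w) = sc c (T u) + T w) \<and>
     (\<forall>k\<in>K. \<forall>w\<in>W. T (\<pi> k w) = \<pi> k (T w)))"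

definition maximal_compact_subgroup :: "(real ^ 'm ^ 'm) set \<Rightarrow> (real ^ 'm ^ 'm) set \<Rightarrow> bool" where
  "maximal_compact_subgroup H K \<longleftrightarrow> K \<subseteq> H \<and> subgroup K GL \<and> compact K \<and>
     (\<forall>K'. K \<subseteq> K' \<and> K' \<subseteq> H \<and> subgroup K' GL \<and> compact K' \<longrightarrow> K' = K)"

text \<open>Admissibility: all isotypic components under a maximal compact subgroup are finite-dimensional.\<close>

definition admissible ::
    "(real ^ 'm ^ 'm) set \<Rightarrow> (complex \<Rightarrow> 'v::ab_group_add \<Rightarrow> 'v) \<Rightarrow> (real ^ 'm ^ 'm \<Rightarrow> 'v \<Rightarrow> 'v) \<Rightarrow> bool" where
  "admissible H sc \<pi> \<longleftrightarrow> (\<forall>K. maximal_compact_subgroup H K \<longrightarrow>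
     (\<forall>W. finite_dimensional sc W \<and> irreducible_subspace K sc \<pi> W \<longrightarrow>
        finite_dimensional sc (module.span sc
          (\<Union>{W'. invariant_subspace K sc \<pi> W' \<and> isomorphic_subspaces K sc \<pi> W W'}))))"

definition SAF_representation ::
    "(real ^ 'm ^ 'm) set \<Rightarrow> (complex \<Rightarrow> 'v::ab_group_add \<Rightarrow> 'v) \<Rightarrow> (nat \<Rightarrow> 'v \<Rightarrow> real) \<Rightarrow>
     (real ^ 'm ^ 'm \<Rightarrow> 'v \<Rightarrow> 'v) \<Rightarrow> bool" where
  "SAF_representation H sc p \<pi> \<longleftrightarrow> frechet_space sc p \<and> continuous_representation H sc p \<pi> \<and>
     smooth_representation H sc p \<pi> \<and> admissible H sc \<pi> \<and> moderate_growth H p \<pi>"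

definition has_central_character ::
    "(real ^ 'm ^ 'm) set \<Rightarrow> (complex \<Rightarrow> 'v \<Rightarrow> 'v) \<Rightarrow> (real ^ 'm ^ 'm \<Rightarrow> 'v \<Rightarrow> 'v) \<Rightarrow> bool" where
  "has_central_character H sc \<pi> \<longleftrightarrow>
     (\<forall>z\<in>H. (\<forall>g\<in>H. z ** g = g ** z) \<longrightarrow> (\<exists>c. \<forall>v. \<pi> z v = sc c v))"


section \<open>Densities\<close>

text \<open>
  A (complex) \<open>\<alpha>\<close>-density on an open subset of \<open>\<real>\<^sup>n\<close> assigns to a point and a frame at that point a
  number, and scales by \<open>\<bar>det A\<bar>\<^sup>\<alpha>\<close> under the change of frame \<open>A\<close>. A frame is a matrix \<open>M\<close>, whose rows
  are the tangent vectors. As \<open>0 powr \<alpha> = 0\<close>, densities vanish on degenerate \<open>M\<close>. A density on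
  \<open>U\<close> is extended by zero outside \<open>U\<close>.
\<close>

type_synonym 'n dens = "real ^ 'n \<Rightarrow> real ^ 'n ^ 'n \<Rightarrow> complex"

definition density_on :: "real \<Rightarrow> (real ^ 'n) set \<Rightarrow> 'n dens \<Rightarrow> bool" where
  "density_on \<alpha> U \<phi> \<longleftrightarrow> (\<forall>x A M. \<phi> x (A ** M) = of_real (\<bar>det A\<bar> powr \<alpha>) * \<phi> x M) \<and>
     (\<forall>x M. x \<notin> U \<longrightarrow> \<phi> x M = 0)"

definition smooth_half_densities :: "(real ^ 'n) set \<Rightarrow> 'n dens set" where
  "smooth_half_densities U =
     {\<phi>. density_on (1 / 2) U \<phi> \<and> (\<forall>M. smooth_function U (\<lambda>x. \<phi> x M))}"

definition pull_back :: "(real ^ 'n \<Rightarrow> real ^ 'n) \<Rightarrow> 'n dens \<Rightarrow> 'n dens" where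
  "pull_back T \<phi> = (\<lambda>x M. \<phi> (T x) (\<chi> i. frechet_derivative T (at x) (M $ i)))"

text \<open>A density \<open>\<delta>\<close> equals \<open>\<delta> x (mat 1)\<close> times the standard Lebesgue density.\<close>

definition density_integrable :: "(real ^ 'n) set \<Rightarrow> 'n dens \<Rightarrow> bool" where
  "density_integrable U \<delta> \<longleftrightarrow> set_integrable lborel U (\<lambda>x. \<delta> x (mat 1))"

definition density_integral :: "(real ^ 'n) set \<Rightarrow> 'n dens \<Rightarrow> complex" where
  "density_integral U \<delta> = set_lebesgue_integral lborel U (\<lambda>x. \<delta> x (mat 1))"

text \<open>
  \<open>half_density u\<close> is \<open>u \<bar>\<Omega>\<bar>\<^sup>1\<^sup>/\<^sup>2\<close>, with \<open>\<Omega>\<close> the standard volume form (the determinant of a frame).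
\<close>

definition half_density :: "(real ^ 'n \<Rightarrow> complex) \<Rightarrow> 'n dens" where
  "half_density u = (\<lambda>x M. u x * of_real (\<bar>det M\<bar> powr (1 / 2)))"

definition schwartz_half_densities :: "'n::finite dens set" where
  "schwartz_half_densities = half_density ` Collect schwartz_function"


section \<open>Fourier transform\<close>

definition nontrivial_additive_character :: "(real \<Rightarrow> complex) \<Rightarrow> bool" where
  "nontrivial_additive_character \<psi> \<longleftrightarrow> continuous_on UNIV \<psi> \<and> (\<forall>x. cmod (\<psi> x) = 1) \<and>
     (\<forall>x y. \<psi> (x + y) = \<psi> x * \<psi> y) \<and> (\<exists>x. \<psi> x \<noteq> 1)"

definition dilate :: "(real \<Rightarrow> complex) \<Rightarrow> real \<Rightarrow> real \<Rightarrow> complex" where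
  "dilate \<psi> a = (\<lambda>x. \<psi> (a * x))"

definition fourier_scalar ::
    "(real \<Rightarrow> complex) \<Rightarrow> (real ^ 'n \<Rightarrow> complex) \<Rightarrow> real ^ 'n \<Rightarrow> complex" where
  "fourier_scalar \<psi> u y = (\<integral>x. u x * \<psi> (y \<bullet> x) \<partial>lborel)"

text \<open>
  The transform of half-densities does not depend on \<open>\<Omega>\<close>. It is computed with the standard volume
  form, whose dual \<open>\<Psi>\<close> is the standard volume form in the dual coordinates; so
  \<open>\<bar>\<Omega>\<bar>\<close> and \<open>\<bar>\<Psi>\<bar>\<close> are both \<open>lborel\<close>.
\<close>

definition fourier :: "(real \<Rightarrow> complex) \<Rightarrow> 'n::finite dens \<Rightarrow> 'n dens" where
  "fourier \<psi> \<xi> = half_density (fourier_scalar \<psi> (\<lambda>x. \<xi> x (mat 1)))"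

definition haar_measure :: "(real ^ 'n) measure \<Rightarrow> bool" where
  "haar_measure \<mu> \<longleftrightarrow> sets \<mu> = sets borel \<and> (\<forall>a. distr \<mu> borel ((+) a) = \<mu>) \<and>
     (\<forall>K. compact K \<longrightarrow> emeasure \<mu> K < \<infinity>) \<and> emeasure \<mu> UNIV \<noteq> 0"

text \<open>\<open>\<mu>\<close> is the measure \<open>\<bar>\<Psi>\<bar>'\<close>.\<close>

definition dual_haar_measure :: "(real \<Rightarrow> complex) \<Rightarrow> (real ^ 'n) measure \<Rightarrow> bool" where
  "dual_haar_measure \<psi> \<mu> \<longleftrightarrow> haar_measure \<mu> \<and> (\<forall>u. schwartz_function u \<longrightarrow>
     (\<integral>\<^sup>+y. ennreal ((cmod (fourier_scalar \<psi> u y))\<^sup>2) \<partial>\<mu>) = (\<integral>\<^sup>+x. ennreal ((cmod (u x))\<^sup>2) \<partial>lborel))"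

definition fourier_constant :: "'n::finite itself \<Rightarrow> (real \<Rightarrow> complex) \<Rightarrow> real" where
  "fourier_constant _ \<psi> = (THE A. A > 0 \<and>
     (\<exists>\<mu> :: (real ^ 'n) measure. dual_haar_measure \<psi> \<mu> \<and> lborel = scale_measure (ennreal A) \<mu>))"


section \<open>Zeta integrals and gamma factors\<close>

type_synonym ('v, 'n) eta = "'v \<Rightarrow> 'n dens"

text \<open>
  Continuity of \<open>\<eta>\<close> is expressed by seminorms: the topology on half-densities is that of locally
  uniform convergence of all derivatives of the coefficient.
\<close>

definition hom_space ::
    "(complex ^ 'm ^ 'm) set \<Rightarrow> (complex ^ 'm ^ 'm \<Rightarrow> complex ^ 'n ^ 'n) \<Rightarrow> (complex ^ 'n) set \<Rightarrow>
     (complex \<Rightarrow> 'v::ab_group_add \<Rightarrow> 'v) \<Rightarrow> (nat \<Rightarrow> 'v \<Rightarrow> real) \<Rightarrow> (real ^ 'm ^ 'm \<Rightarrow> 'v \<Rightarrow> 'v) \<Rightarrow>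
     ('v, 'n) eta set" where
  "hom_space G \<rho> Xp sc p \<pi> = {\<eta>.
     (\<forall>v. \<eta> v \<in> smooth_half_densities (real_points Xp)) \<and>
     (\<forall>c u v. \<eta> (sc c u + v) = (\<lambda>x M. c * \<eta> u x M + \<eta> v x M)) \<and>
     (\<forall>K es. compact K \<and> K \<subseteq> real_points Xp \<and> set es \<subseteq> Basis \<longrightarrow>
        (\<exists>l C. \<forall>v. \<forall>x\<in>K. cmod (partial_derivs es (\<lambda>y. \<eta> v y (mat 1)) x) \<le> C * (\<Sum>j\<le>l. p j v))) \<and>
     (\<forall>g\<in>real_group G. \<forall>v. \<eta> (\<pi> g v) = pull_back (\<lambda>x. x v* real_mat (\<rho> (complex_mat g))) (\<eta> v))}"

definition zeta_integrand ::
    "('r::finite \<Rightarrow> ('n::finite, real) mpoly) \<Rightarrow> complex ^ 'r \<Rightarrow> ('v, 'n) eta \<Rightarrow> 'v \<Rightarrow> 'n dens \<Rightarrow> 'n dens" where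
  "zeta_integrand f s \<eta> v \<xi> = (\<lambda>x M. \<eta> v x M *
     (\<Prod>i\<in>UNIV. of_real (cmod (mpoly_eval (complexify (f i)) (vec_nth (complex_vec x)))) powr (s $ i)) *
     \<xi> x M)"

text \<open>
  \<open>Z\<close> is the meromorphic continuation of the zeta integrals, in the chart \<open>L\<close> of the parameter space
  given by the eigencharacters of \<open>f\<close>. The values at poles are only required to be chosen linearly
  in \<open>\<eta>\<close>, so that \<open>\<eta>\<close> may itself depend on the parameter.
\<close>

definition zeta_continuation ::
    "(complex ^ 'r \<Rightarrow> 'm tensor) \<Rightarrow> ('r::finite \<Rightarrow> ('n::finite, real) mpoly) \<Rightarrow> (complex ^ 'n) set \<Rightarrow>
     ('v, 'n) eta set \<Rightarrow> ('m tensor \<Rightarrow> ('v, 'n) eta \<Rightarrow> 'v \<Rightarrow> 'n dens \<Rightarrow> complex) \<Rightarrow> bool" where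
  "zeta_continuation L f Xp N Z \<longleftrightarrow> (\<forall>v. \<forall>\<xi>\<in>schwartz_half_densities.
     (\<forall>s c. \<forall>\<eta>\<in>N. \<forall>\<eta>'\<in>N.
        Z (L s) (\<lambda>u x M. c * \<eta> u x M + \<eta>' u x M) v \<xi> = c * Z (L s) \<eta> v \<xi> + Z (L s) \<eta>' v \<xi>) \<and>
     (\<forall>\<eta>\<in>N. meromorphic_vec (\<lambda>s. Z (L s) \<eta> v \<xi>) \<and>
        (\<exists>\<kappa>. \<forall>s. (\<forall>i. Re (s $ i) > \<kappa>) \<longrightarrow>
           density_integrable (real_points Xp) (zeta_integrand f s \<eta> v \<xi>) \<and>
           Z (L s) \<eta> v \<xi> = density_integral (real_points Xp) (zeta_integrand f s \<eta> v \<xi>))))"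

text \<open>
  The target of a meromorphic family is a finite-dimensional space, so meromorphy means that the
  coefficients in a finite set of vectors are meromorphic.
\<close>

definition meromorphic_family ::
    "(complex ^ 'r \<Rightarrow> 'm tensor) \<Rightarrow> ('v, 'n) eta set \<Rightarrow> ('v, 'n) eta set \<Rightarrow>
     ('m tensor \<Rightarrow> ('v, 'n) eta \<Rightarrow> ('v, 'n) eta) \<Rightarrow> bool" where
  "meromorphic_family L N N' \<Gamma> \<longleftrightarrow>
     (\<forall>s. \<Gamma> (L s) \<in> N \<rightarrow> N') \<and>
     (\<forall>s c. \<forall>\<eta>\<in>N. \<forall>\<zeta>\<in>N. \<Gamma> (L s) (\<lambda>v x M. c * \<eta> v x M + \<zeta> v x M) =
        (\<lambda>v x M. c * \<Gamma> (L s) \<eta> v x M + \<Gamma> (L s) \<zeta> v x M)) \<and>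
     (\<forall>\<eta>\<in>N. \<exists>B c. finite B \<and> B \<subseteq> N' \<and> (\<forall>b\<in>B. meromorphic_vec (c b)) \<and>
        (\<forall>s. \<Gamma> (L s) \<eta> = (\<lambda>v x M. \<Sum>b\<in>B. c b s * b v x M)))"

text \<open>
  \<open>\<Gamma>\<close> is the gamma factor from \<open>Ndual\<close> to \<open>N\<close> with respect to \<open>\<psi>\<close>; \<open>Z\<close> and \<open>Zdual\<close> are the zeta
  integrals on the two sides.
\<close>

definition gamma_factor ::
    "(complex ^ 'r \<Rightarrow> 'm tensor) \<Rightarrow> ('v, 'n::finite) eta set \<Rightarrow> ('v, 'n) eta set \<Rightarrow>
     ('m tensor \<Rightarrow> ('v, 'n) eta \<Rightarrow> 'v \<Rightarrow> 'n dens \<Rightarrow> complex) \<Rightarrow>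
     ('m tensor \<Rightarrow> ('v, 'n) eta \<Rightarrow> 'v \<Rightarrow> 'n dens \<Rightarrow> complex) \<Rightarrow>
     (real \<Rightarrow> complex) \<Rightarrow> ('m tensor \<Rightarrow> ('v, 'n) eta \<Rightarrow> ('v, 'n) eta) \<Rightarrow> bool" where
  "gamma_factor L N Ndual Z Zdual \<psi> \<Gamma> \<longleftrightarrow> meromorphic_family L Ndual N \<Gamma> \<and>
     (\<forall>\<eta>\<in>Ndual. \<forall>v. \<forall>\<xi>\<in>schwartz_half_densities.
        generically (\<lambda>s. Zdual (L s) \<eta> v (fourier \<psi> \<xi>) = Z (L s) (\<Gamma> (L s) \<eta>) v \<xi>))"

definition dilation :: "real \<Rightarrow> 'n::finite dens \<Rightarrow> 'n dens" where
  "dilation a = pull_back (\<lambda>y. inverse a *\<^sub>R y)"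

end

theory Submission
  imports Defs "HOL-Complex_Analysis.Complex_Analysis" "HOL-Probability.Sinc_Integral"
begin

text \<open>
  For (i), the two functional equations give
  \<open>Z'(\<gamma>' \<gamma> \<eta>, v, \<xi>) = Z(\<gamma> \<eta>, v, F\<^sub>- \<xi>) = Z'(\<eta>, v, F F\<^sub>- \<xi>)\<close> with \<open>F\<close>, \<open>F\<^sub>-\<close> the transforms for
  \<open>\<psi>\<close> and its inverse. Fourier inversion says that \<open>F F\<^sub>-\<close> is a scalar, which the Plancherel formula
  identifies with \<open>A(\<psi>)\<close>. For (ii), the transform for \<open>\<psi>\<^sub>a\<close> is \<open>F\<close> dilated by \<open>a\<close>; a change of variables in
  the convergent integral moves the dilation to \<open>\<eta>\<close>, and the factor \<open>\<bar>a\<bar>\<close> to the power \<open>- d(\<lambda>)\<close> appears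
  because the basic relative invariants are homogeneous. The resulting identities between zeta
  integrals pass to the intertwining maps because test functions supported in small cubes of the open
  orbit separate these maps.
\<close>


section \<open>Meromorphic functions of several variables\<close>

text \<open>A functional equation for given \<open>v\<close> and \<open>\<xi>\<close> holds only off
  a thin set that may depend on both, and this shapes the proof. First, the gamma factor moves
  \<open>\<eta>\<close> with the parameter, while the other functional equation concerns a fixed
  \<open>\<eta>\<close>; so every parameter-dependent vector is written as a finite combination with
  meromorphic coefficients, and linearity in \<open>\<eta>\<close> reduces it to finitely many fixed
  vectors. Second, infinitely many thin sets cannot be united; the separation argument therefore
  produces one thin set that depends on the coefficients alone, because against a compactly
  supported test function the zeta integral is entire and the identity extends by continuity. The
  two gamma factors also live in different charts of the same parameter space, which differ by an
  invertible linear map read off from the two bases of characters. No Gaussian integral is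
  evaluated: the inversion constant is introduced by choice, and only its positivity and its role in
  the Plancherel formula are used.\<close>

lemma linear_vector_smult: "linear (\<lambda>t::complex. t *s (w :: complex ^ 'r))"
  by (rule linearI) (auto simp: vec_eq_iff algebra_simps)

text \<open>A complex linear derivative restricted to a complex line is multiplication by
  \<open>D w\<close>. This is the bridge to one-variable function theory, from which the identity
  theorem is imported.\<close>

lemma holomorphic_vec_line:
  fixes F :: "complex ^ 'r \<Rightarrow> complex"
  assumes "holomorphic_vec U F"
  shows "(\<lambda>t. F (z + t *s w)) holomorphic_on {t. z + t *s w \<in> U}"
  unfolding holomorphic_on_def
proof (intro ballI)
  fix t assume t: "t \<in> {t. z + t *s w \<in> U}"
  then obtain D where D: "(F has_derivative D) (at (z + t *s w))" "\<And>c w. D (c *s w) = c * D w"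
    using assms unfolding holomorphic_vec_def by blast
  have "((\<lambda>t. z + t *s w) has_derivative (\<lambda>t. t *s w)) (at t)"
    using linear_vector_smult[of w]
    by (auto intro!: derivative_eq_intros linear_imp_has_derivative)
  from has_derivative_compose[OF this D(1)]
  have "((\<lambda>t. F (z + t *s w)) has_derivative (\<lambda>h. D w * h)) (at t)"
    by (simp add: D(2) mult.commute)
  then have "((\<lambda>t. F (z + t *s w)) has_field_derivative D w) (at t)"
    by (simp add: has_field_derivative_def)
  then show "(\<lambda>t. F (z + t *s w)) field_differentiable at t within {t. z + t *s w \<in> U}"
    using field_differentiable_at_within field_differentiable_def by blast
qed

lemma holomorphic_vec_continuous_on: "holomorphic_vec U F \<Longrightarrow> continuous_on U F"
  unfolding holomorphic_vec_def
  by (meson continuous_at_imp_continuous_on has_derivative_continuous)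

lemma holomorphic_vec_subset: "holomorphic_vec U F \<Longrightarrow> V \<subseteq> U \<Longrightarrow> holomorphic_vec V F"
  unfolding holomorphic_vec_def by blast

lemma holomorphic_vec_const: "holomorphic_vec U (\<lambda>_. c)"
  unfolding holomorphic_vec_def by (auto intro!: exI[of _ "\<lambda>_. 0"])

lemma holomorphic_vec_add:
  assumes "holomorphic_vec U F" "holomorphic_vec U H"
  shows "holomorphic_vec U (\<lambda>z. F z + H z)"
  unfolding holomorphic_vec_def
proof
  fix z assume "z \<in> U"
  then obtain D E where "(F has_derivative D) (at z)" "\<And>c w. D (c *s w) = c * D w"
      "(H has_derivative E) (at z)" "\<And>c w. E (c *s w) = c * E w"
    using assms unfolding holomorphic_vec_def by metis
  then show "\<exists>D. ((\<lambda>z. F z + H z) has_derivative D) (at z) \<and> (\<forall>c w. D (c *s w) = c * D w)"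
    by (intro exI[of _ "\<lambda>w. D w + E w"]) (auto intro!: derivative_eq_intros simp: algebra_simps)
qed

lemma holomorphic_vec_mult:
  assumes "holomorphic_vec U F" "holomorphic_vec U H"
  shows "holomorphic_vec U (\<lambda>z. F z * H z)"
  unfolding holomorphic_vec_def
proof
  fix z assume "z \<in> U"
  then obtain D E where "(F has_derivative D) (at z)" "\<And>c w. D (c *s w) = c * D w"
      "(H has_derivative E) (at z)" "\<And>c w. E (c *s w) = c * E w"
    using assms unfolding holomorphic_vec_def by metis
  then show "\<exists>D. ((\<lambda>z. F z * H z) has_derivative D) (at z) \<and> (\<forall>c w. D (c *s w) = c * D w)"
    by (intro exI[of _ "\<lambda>w. F z * E w + D w * H z"]) (auto intro!: derivative_eq_intros simp: algebra_simps)
qed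

text \<open>\<open>linear\<close> is linearity over the reals on the type
  \<open>complex ^ 'r\<close>, so homogeneity over the complex numbers has to be added.\<close>

definition complex_linear :: "(complex ^ 'r \<Rightarrow> complex ^ 'k) \<Rightarrow> bool" where
  "complex_linear T \<longleftrightarrow> linear T \<and> (\<forall>c w. T (c *s w) = c *s T w)"

lemma holomorphic_vec_compose_linear:
  fixes F :: "complex ^ 'k \<Rightarrow> complex" and T :: "complex ^ 'r \<Rightarrow> complex ^ 'k"
  assumes "holomorphic_vec U F" "complex_linear T" "T ` V \<subseteq> U"
  shows "holomorphic_vec V (\<lambda>z. F (T z))"
  unfolding holomorphic_vec_def
proof
  fix z assume "z \<in> V"
  then obtain D where D: "(F has_derivative D) (at (T z))" "\<And>c w. D (c *s w) = c * D w"
    using assms unfolding holomorphic_vec_def by blast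
  have "(T has_derivative T) (at z)"
    using assms(2) linear_imp_has_derivative unfolding complex_linear_def by blast
  from has_derivative_compose[OF this D(1)] D(2) assms(2)
  show "\<exists>D. ((\<lambda>z. F (T z)) has_derivative D) (at z) \<and> (\<forall>c w. D (c *s w) = c * D w)"
    unfolding complex_linear_def by (intro exI[of _ "\<lambda>w. D (T w)"]) simp
qed

text \<open>Any \<open>w\<close> is joined to a point \<open>v\<close> of \<open>V\<close> by a
  complex line. The parameters for which the line stays in the convex set \<open>U\<close> form a
  convex, hence connected, set in the plane, and the one-variable identity theorem applies
  there.\<close>

lemma holomorphic_vec_eq_zero:
  fixes F :: "complex ^ 'r \<Rightarrow> complex"
  assumes F: "holomorphic_vec U F" and U: "open U" "convex U"
    and V: "open V" "V \<noteq> {}" "V \<subseteq> U" and 0: "\<And>z. z \<in> V \<Longrightarrow> F z = 0" and w: "w \<in> U"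
  shows "F w = 0"
proof -
  obtain v where v: "v \<in> V" using V by blast
  define l where "l = (\<lambda>t::complex. v + t *s (w - v))"
  have contl: "continuous_on UNIV l"
    unfolding l_def using linear_vector_smult[of "w - v"]
    by (intro continuous_intros linear_continuous_on) (simp add: linear_conv_bounded_linear)
  have opn: "open (l -` W)" if "open W" for W
    using open_vimage[OF that contl] .
  have "convex (l -` U)"
  proof (rule convexI)
    fix x y :: complex and a b :: real
    assume *: "x \<in> l -` U" "y \<in> l -` U" "0 \<le> a" "0 \<le> b" "a + b = 1"
    have "l (a *\<^sub>R x + b *\<^sub>R y) = (a + b) *\<^sub>R v + (a *\<^sub>R x + b *\<^sub>R y) *s (w - v)"
      using * by (simp add: l_def)
    also have "\<dots> = a *\<^sub>R l x + b *\<^sub>R l y"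
      by (simp add: l_def vec_eq_iff scaleR_conv_of_real[where 'a = complex] algebra_simps)
    finally show "a *\<^sub>R x + b *\<^sub>R y \<in> l -` U"
      using * U(2) by (simp add: convex_def)
  qed
  moreover have "(\<lambda>t. F (l t)) holomorphic_on (l -` U)"
    using holomorphic_vec_line[OF F, of v "w - v"] by (simp add: l_def vimage_def)
  moreover have "l 0 = v" "l 1 = w" by (simp_all add: l_def)
  ultimately show ?thesis
    using analytic_continuation_open[of "l -` V" "l -` U" "\<lambda>t. F (l t)" "\<lambda>_. 0" 1]
      opn V U v w 0 convex_connected[of "l -` U"] by auto
qed

lemma holomorphic_vec_nonzero_on_subset:
  fixes q :: "complex ^ 'r \<Rightarrow> complex"
  assumes "holomorphic_vec (ball z e) q" "\<exists>w\<in>ball z e. q w \<noteq> 0"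
    "open V" "V \<noteq> {}" "V \<subseteq> ball z e"
  shows "\<exists>w\<in>V. q w \<noteq> 0"
  using holomorphic_vec_eq_zero[OF assms(1) open_ball convex_ball assms(3-5)] assms(2) by blast

lemma holomorphic_vec_open_nonzero:
  fixes q :: "complex ^ 'r \<Rightarrow> complex"
  assumes "holomorphic_vec U q" "open U"
  shows "open {w\<in>U. q w \<noteq> 0}"
proof -
  have "open (U \<inter> q -` (- {0}))"
    using continuous_open_preimage[OF holomorphic_vec_continuous_on[OF assms(1)] assms(2), of "- {0}"] by auto
  moreover have "U \<inter> q -` (- {0}) = {w\<in>U. q w \<noteq> 0}" by auto
  ultimately show ?thesis by simp
qed

text \<open>Holomorphic functions on a ball form an integral domain: \<open>q\<close> cannot vanish
  on the nonempty open set where \<open>p\<close> does not.\<close>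

lemma holomorphic_vec_mult_nonzero:
  fixes p q :: "complex ^ 'r \<Rightarrow> complex"
  assumes "holomorphic_vec (ball z e) p" "\<exists>w\<in>ball z e. p w \<noteq> 0"
    and "holomorphic_vec (ball z e) q" "\<exists>w\<in>ball z e. q w \<noteq> 0"
  shows "\<exists>w\<in>ball z e. p w * q w \<noteq> 0"
proof -
  have "open {w\<in>ball z e. p w \<noteq> 0}" using holomorphic_vec_open_nonzero assms(1) by blast
  then have "\<exists>w\<in>{w\<in>ball z e. p w \<noteq> 0}. q w \<noteq> 0"
    using assms by (intro holomorphic_vec_nonzero_on_subset[OF assms(3,4)]) auto
  then show ?thesis by auto
qed

text \<open>The local denominator common to \<open>generically\<close> and
  \<open>meromorphic_vec\<close>; isolating it lets both predicates share the lemmas on shrinking,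
  multiplying and pulling back.\<close>

definition thin_datum :: "complex ^ 'r \<Rightarrow> real \<Rightarrow> (complex ^ 'r \<Rightarrow> complex) \<Rightarrow> bool" where
  "thin_datum z e q \<longleftrightarrow> e > 0 \<and> holomorphic_vec (ball z e) q \<and> (\<exists>w\<in>ball z e. q w \<noteq> 0)"

lemma generically_alt:
  "generically P \<longleftrightarrow> (\<forall>z. \<exists>e q. thin_datum z e q \<and> (\<forall>w\<in>ball z e. q w \<noteq> 0 \<longrightarrow> P w))"
  unfolding generically_def thin_datum_def by blast

lemma meromorphic_vec_alt:
  "meromorphic_vec F \<longleftrightarrow> (\<forall>z. \<exists>e p q. thin_datum z e q \<and> holomorphic_vec (ball z e) p \<and>
     (\<forall>w\<in>ball z e. q w \<noteq> 0 \<longrightarrow> F w = p w / q w))"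
  unfolding meromorphic_vec_def thin_datum_def by blast

text \<open>The smaller ball could a priori lie in the zero set of \<open>q\<close>; the identity
  theorem excludes this.\<close>

lemma thin_datum_smaller:
  assumes "thin_datum z e q" "0 < d" "d \<le> e" shows "thin_datum z d q"
proof -
  have "ball z d \<subseteq> ball z e" using assms by auto
  then show ?thesis
    using assms holomorphic_vec_nonzero_on_subset[of z e q "ball z d"] holomorphic_vec_subset
    unfolding thin_datum_def by fastforce
qed

lemma thin_datum_mult: "thin_datum z e p \<Longrightarrow> thin_datum z e q \<Longrightarrow> thin_datum z e (\<lambda>w. p w * q w)"
  unfolding thin_datum_def using holomorphic_vec_mult_nonzero holomorphic_vec_mult by blast

text \<open>The product of two denominators vanishes wherever either does, so it serves both
  conditions at once. This makes generic statements stable under finite conjunctions.\<close>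

lemma thin_datum_common:
  assumes "thin_datum z d p" "thin_datum z e q"
  shows "thin_datum z (min d e) (\<lambda>w. p w * q w)"
proof -
  have "min d e > 0" using assms by (auto simp: thin_datum_def)
  with assms show ?thesis by (intro thin_datum_mult) (auto intro: thin_datum_smaller)
qed

lemma thin_datum_dense:
  assumes "thin_datum z e q" "open V" "V \<inter> ball z e \<noteq> {}"
  shows "\<exists>w\<in>V \<inter> ball z e. q w \<noteq> 0"
  using assms holomorphic_vec_nonzero_on_subset[of z e q "V \<inter> ball z e"]
  by (auto simp: thin_datum_def)

lemma thin_datum_const: "e > 0 \<Longrightarrow> thin_datum z e (\<lambda>_. 1)"
  by (auto simp: thin_datum_def holomorphic_vec_const intro!: exI[of _ z])

lemma generically_mono: "generically P \<Longrightarrow> (\<And>s. P s \<Longrightarrow> Q s) \<Longrightarrow> generically Q"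
  unfolding generically_def by meson

lemma generically_True: "(\<And>s. P s) \<Longrightarrow> generically P"
  unfolding generically_alt using thin_datum_const[OF zero_less_one] by blast

lemma generically_conj:
  assumes "generically P" "generically Q" shows "generically (\<lambda>s. P s \<and> Q s)"
  unfolding generically_alt
proof
  fix z :: "complex ^ 'a"
  obtain d p where p: "thin_datum z d p" "\<forall>w\<in>ball z d. p w \<noteq> 0 \<longrightarrow> P w"
    using assms(1) unfolding generically_alt by blast
  obtain e q where q: "thin_datum z e q" "\<forall>w\<in>ball z e. q w \<noteq> 0 \<longrightarrow> Q w"
    using assms(2) unfolding generically_alt by blast
  show "\<exists>e q. thin_datum z e q \<and> (\<forall>w\<in>ball z e. q w \<noteq> 0 \<longrightarrow> P w \<and> Q w)"
    using thin_datum_common[OF p(1) q(1)] p(2) q(2)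
    by (intro exI[of _ "min d e"] exI[of _ "\<lambda>w. p w * q w"]) auto
qed

lemma generically_ball:
  assumes "finite I" "\<And>i. i \<in> I \<Longrightarrow> generically (P i)"
  shows "generically (\<lambda>s. \<forall>i\<in>I. P i s)"
  using assms by (induction I) (auto intro: generically_True generically_conj)

text \<open>A nonzero denominator cannot vanish on an open part of its ball. Used with continuity,
  this carries a generic identity over to every regular parameter.\<close>

lemma generically_dense:
  assumes "generically P" "open V" "V \<noteq> {}" shows "\<exists>w\<in>V. P w"
proof -
  obtain z where z: "z \<in> V" using assms by blast
  obtain e q where q: "thin_datum z e q" "\<forall>w\<in>ball z e. q w \<noteq> 0 \<longrightarrow> P w"
    using assms(1) unfolding generically_alt by blast
  then have "V \<inter> ball z e \<noteq> {}" using z by (auto simp: thin_datum_def)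
  with thin_datum_dense[OF q(1) assms(2)] q(2) show ?thesis by blast
qed

text \<open>Surjective linear maps are open, so the image of a small ball meets the set where
  \<open>q\<close> is nonzero; otherwise \<open>q\<close> could vanish on the whole range of
  \<open>T\<close>.\<close>

lemma thin_datum_pullback:
  fixes T :: "complex ^ 'r \<Rightarrow> complex ^ 'k"
  assumes q: "thin_datum (T z) e q" and T: "complex_linear T" and surj: "surj T"
  shows "\<exists>d. thin_datum z d (\<lambda>w. q (T w)) \<and> ball z d \<subseteq> T -` ball (T z) e"
proof -
  have lin: "linear T" using T by (simp add: complex_linear_def)
  have "open (T -` ball (T z) e)"
    using lin linear_continuous_on[of T UNIV] open_vimage[of "ball (T z) e" T] linear_conv_bounded_linear by blast
  moreover have "z \<in> T -` ball (T z) e" using q by (simp add: thin_datum_def)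
  ultimately obtain d where d: "d > 0" "ball z d \<subseteq> T -` ball (T z) e"
    by (meson open_contains_ball)
  have hol: "holomorphic_vec (ball z d) (\<lambda>w. q (T w))"
    using q d by (intro holomorphic_vec_compose_linear[OF _ T]) (auto simp: thin_datum_def)
  have "open (T ` ball z d)" using open_surjective_linear_image[OF open_ball lin surj] .
  moreover have "T z \<in> T ` ball z d \<inter> ball (T z) e" using d q by (simp add: thin_datum_def)
  ultimately obtain w where "w \<in> T ` ball z d" "q w \<noteq> 0"
    using thin_datum_dense[OF q, of "T ` ball z d"] by blast
  with hol d(1) have "thin_datum z d (\<lambda>w. q (T w))" by (auto simp: thin_datum_def)
  with d(2) show ?thesis by blast
qed

lemma generically_compose_linear:
  fixes P :: "complex ^ 'k \<Rightarrow> bool" and T :: "complex ^ 'r \<Rightarrow> complex ^ 'k"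
  assumes P: "generically P" and T: "complex_linear T" and surj: "surj T"
  shows "generically (\<lambda>s. P (T s))"
  unfolding generically_alt
proof
  fix z
  obtain e q where q: "thin_datum (T z) e q" "\<forall>w\<in>ball (T z) e. q w \<noteq> 0 \<longrightarrow> P w"
    using P unfolding generically_alt by blast
  obtain d where "thin_datum z d (\<lambda>w. q (T w))" "ball z d \<subseteq> T -` ball (T z) e"
    using thin_datum_pullback[OF q(1) T surj] by blast
  with q(2) show "\<exists>e q. thin_datum z e q \<and> (\<forall>w\<in>ball z e. q w \<noteq> 0 \<longrightarrow> P (T w))"
    by (intro exI[of _ d] exI[of _ "\<lambda>w. q (T w)"]) auto
qed

lemma meromorphic_vec_holomorphic: "holomorphic_vec UNIV F \<Longrightarrow> meromorphic_vec F"
  unfolding meromorphic_vec_alt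
  using thin_datum_const[OF zero_less_one] holomorphic_vec_subset[of UNIV F]
  by (metis div_by_1 subset_UNIV)

lemma meromorphic_vec_compose_linear:
  fixes F :: "complex ^ 'k \<Rightarrow> complex" and T :: "complex ^ 'r \<Rightarrow> complex ^ 'k"
  assumes F: "meromorphic_vec F" and T: "complex_linear T" and surj: "surj T"
  shows "meromorphic_vec (\<lambda>s. F (T s))"
  unfolding meromorphic_vec_alt
proof
  fix z
  obtain e p q where q: "thin_datum (T z) e q" "holomorphic_vec (ball (T z) e) p"
      "\<forall>w\<in>ball (T z) e. q w \<noteq> 0 \<longrightarrow> F w = p w / q w"
    using F unfolding meromorphic_vec_alt by meson
  obtain d where d: "thin_datum z d (\<lambda>w. q (T w))" "ball z d \<subseteq> T -` ball (T z) e"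
    using thin_datum_pullback[OF q(1) T surj] by blast
  have "holomorphic_vec (ball z d) (\<lambda>w. p (T w))"
    using d by (intro holomorphic_vec_compose_linear[OF q(2) T]) auto
  with d q(3) show "\<exists>e p q. thin_datum z e q \<and> holomorphic_vec (ball z e) p \<and> (\<forall>w\<in>ball z e. q w \<noteq> 0 \<longrightarrow> F (T w) = p w / q w)"
    by - (rule exI[of _ d], rule exI[of _ "\<lambda>w. p (T w)"], rule exI[of _ "\<lambda>w. q (T w)"], auto)
qed

lemma meromorphic_vec_const: "meromorphic_vec (\<lambda>_. c)"
  by (rule meromorphic_vec_holomorphic[OF holomorphic_vec_const])

text \<open>Both parts work over a ball on which the two functions are quotients at once, with the
  product of the denominators as the new denominator.\<close>

lemma
  assumes F: "meromorphic_vec F" and H: "meromorphic_vec H"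
  shows meromorphic_vec_add: "meromorphic_vec (\<lambda>s. F s + H s)"
    and meromorphic_vec_mult: "meromorphic_vec (\<lambda>s. F s * H s)"
proof -
  have "\<exists>e a b p q. thin_datum z e p \<and> thin_datum z e q \<and> holomorphic_vec (ball z e) a \<and> holomorphic_vec (ball z e) b
      \<and> (\<forall>w\<in>ball z e. p w \<noteq> 0 \<longrightarrow> F w = a w / p w) \<and> (\<forall>w\<in>ball z e. q w \<noteq> 0 \<longrightarrow> H w = b w / q w)" for z
  proof -
    obtain d a p where p: "thin_datum z d p" "holomorphic_vec (ball z d) a" "\<forall>w\<in>ball z d. p w \<noteq> 0 \<longrightarrow> F w = a w / p w"
      using F unfolding meromorphic_vec_alt by meson
    obtain e b q where q: "thin_datum z e q" "holomorphic_vec (ball z e) b" "\<forall>w\<in>ball z e. q w \<noteq> 0 \<longrightarrow> H w = b w / q w"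
      using H unfolding meromorphic_vec_alt by meson
    have "min d e > 0" using p q by (simp add: thin_datum_def)
    moreover from this have "thin_datum z (min d e) p" "thin_datum z (min d e) q"
      using thin_datum_smaller[OF p(1), of "min d e"] thin_datum_smaller[OF q(1), of "min d e"] by auto
    moreover have "ball z (min d e) \<subseteq> ball z d" "ball z (min d e) \<subseteq> ball z e" by auto
    moreover from this have "holomorphic_vec (ball z (min d e)) a" "holomorphic_vec (ball z (min d e)) b"
      using p(2) q(2) holomorphic_vec_subset by blast+
    ultimately show ?thesis using p(3) q(3) by blast
  qed
  then obtain e a b p q where *: "\<And>z. thin_datum z (e z) (p z)" "\<And>z. thin_datum z (e z) (q z)"
    "\<And>z. holomorphic_vec (ball z (e z)) (a z)" "\<And>z. holomorphic_vec (ball z (e z)) (b z)"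
    "\<And>z w. w\<in>ball z (e z) \<Longrightarrow> p z w \<noteq> 0 \<Longrightarrow> F w = a z w / p z w"
    "\<And>z w. w\<in>ball z (e z) \<Longrightarrow> q z w \<noteq> 0 \<Longrightarrow> H w = b z w / q z w"
    by metis
  have hol: "holomorphic_vec (ball z (e z)) (p z)" "holomorphic_vec (ball z (e z)) (q z)" for z
    using *(1,2) by (auto simp: thin_datum_def)
  show "meromorphic_vec (\<lambda>s. F s + H s)"
    unfolding meromorphic_vec_alt
  proof
    fix z
    show "\<exists>e p q. thin_datum z e q \<and> holomorphic_vec (ball z e) p \<and> (\<forall>w\<in>ball z e. q w \<noteq> 0 \<longrightarrow> F w + H w = p w / q w)"
      using *(1-4)[of z] hol[of z]
      by - (rule exI[of _ "e z"], rule exI[of _ "\<lambda>w. a z w * q z w + b z w * p z w"], rule exI[of _ "\<lambda>w. p z w * q z w"],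
        auto intro!: thin_datum_mult holomorphic_vec_add holomorphic_vec_mult simp: *(5,6)[where z=z] add_frac_eq)
  qed
  show "meromorphic_vec (\<lambda>s. F s * H s)"
    unfolding meromorphic_vec_alt
  proof
    fix z
    show "\<exists>e p q. thin_datum z e q \<and> holomorphic_vec (ball z e) p \<and> (\<forall>w\<in>ball z e. q w \<noteq> 0 \<longrightarrow> F w * H w = p w / q w)"
      using *(1-4)[of z] hol[of z]
      by - (rule exI[of _ "e z"], rule exI[of _ "\<lambda>w. a z w * b z w"], rule exI[of _ "\<lambda>w. p z w * q z w"],
        auto intro!: thin_datum_mult holomorphic_vec_mult simp: *(5,6)[where z=z])
  qed
qed

text \<open>Off the zeros of the local denominator the total function \<open>F\<close> agrees with
  \<open>p / q\<close> near the point; at the remaining points its values are arbitrary, so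
  continuity cannot be expected there.\<close>

lemma meromorphic_vec_regular:
  assumes "meromorphic_vec F"
  shows "generically (\<lambda>s. \<exists>e>0. continuous_on (ball s e) F)"
  unfolding generically_alt
proof
  fix z
  obtain e p q where q: "thin_datum z e q" "holomorphic_vec (ball z e) p" "\<forall>w\<in>ball z e. q w \<noteq> 0 \<longrightarrow> F w = p w / q w"
    using assms unfolding meromorphic_vec_alt by meson
  have "\<exists>d>0. continuous_on (ball w d) F" if "w \<in> ball z e" "q w \<noteq> 0" for w
  proof -
    let ?V = "{w\<in>ball z e. q w \<noteq> 0}"
    have "open ?V" using q holomorphic_vec_open_nonzero unfolding thin_datum_def by blast
    moreover have "w \<in> ?V" using that by simp
    ultimately obtain d where d: "d > 0" "ball w d \<subseteq> ?V" using openE by blast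
    have "continuous_on (ball z e) p" "continuous_on (ball z e) q"
      using q holomorphic_vec_continuous_on by (auto simp: thin_datum_def)
    moreover have "ball w d \<subseteq> ball z e" using d by auto
    ultimately have "continuous_on (ball w d) p" "continuous_on (ball w d) q"
      using continuous_on_subset by blast+
    then have "continuous_on (ball w d) (\<lambda>w. p w / q w)"
      using d by (intro continuous_on_divide) auto
    then have "continuous_on (ball w d) F"
      by (rule continuous_on_eq) (use d q in auto)
    with d show ?thesis by blast
  qed
  with q show "\<exists>e q. thin_datum z e q \<and> (\<forall>w\<in>ball z e. q w \<noteq> 0 \<longrightarrow> (\<exists>e>0. continuous_on (ball w e) F))"
    by blast
qed

text \<open>An identity theorem on the connected space \<open>complex ^ 'r\<close>. The zero set of
  \<open>F\<close> is only known up to thin sets, so the open and closed set is not the interior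
  \<open>S\<close> of the zero set but the interior of the closure of \<open>S\<close>, which
  absorbs the thin holes.\<close>

lemma meromorphic_vec_eq_zero:
  fixes F :: "complex ^ 'r \<Rightarrow> complex"
  assumes F: "meromorphic_vec F" and W: "open W" "W \<noteq> {}" and 0: "\<And>s. s \<in> W \<Longrightarrow> F s = 0"
  shows "generically (\<lambda>s. F s = 0)"
proof -
  define S where "S = interior {s. F s = 0}"
  define A where "A = interior (closure S)"
  \<comment> \<open>On a chart that meets \<open>A\<close> the numerator vanishes on a nonempty open
    set, hence on the whole ball.\<close>
  have local: "\<forall>w\<in>ball z e. p w = 0"
    if q: "thin_datum z e q" "holomorphic_vec (ball z e) p" "\<forall>w\<in>ball z e. q w \<noteq> 0 \<longrightarrow> F w = p w / q w"
      and ne: "A \<inter> ball z e \<noteq> {}" for z e p q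
  proof -
    have "open (A \<inter> ball z e)" by (simp add: A_def open_Int)
    then have ne: "S \<inter> ball z e \<noteq> {}"
      using ne open_Int_closure_eq_empty[of "A \<inter> ball z e" S] interior_subset[of "closure S"]
      unfolding A_def by blast
    have "open S" by (simp add: S_def)
    have opn: "open {w\<in>ball z e. q w \<noteq> 0}"
      using q holomorphic_vec_open_nonzero unfolding thin_datum_def by blast
    let ?V = "S \<inter> {w\<in>ball z e. q w \<noteq> 0}"
    have "?V \<noteq> {}" using thin_datum_dense[OF q(1) \<open>open S\<close> ne] by blast
    moreover have "p w = 0" if "w \<in> ?V" for w
      using that q(3) interior_subset[of "{s. F s = 0}"] unfolding S_def by force
    ultimately show ?thesis
      using holomorphic_vec_eq_zero[OF q(2), of ?V] opn \<open>open S\<close> by blast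
  qed
  \<comment> \<open>Near a limit point of \<open>A\<close> the numerator vanishes, so
    \<open>F\<close> is zero wherever \<open>q\<close> is not. Such points are dense in the ball,
    which puts the ball into the closure of \<open>S\<close>.\<close>
  have "closure A \<subseteq> A"
  proof
    fix z assume z: "z \<in> closure A"
    obtain e p q where q: "thin_datum z e q" "holomorphic_vec (ball z e) p" "\<forall>w\<in>ball z e. q w \<noteq> 0 \<longrightarrow> F w = p w / q w"
      using F unfolding meromorphic_vec_alt by meson
    have e: "e > 0" using q by (simp add: thin_datum_def)
    then have "A \<inter> ball z e \<noteq> {}"
      using z by (metis Int_commute centre_in_ball disjoint_iff open_Int_closure_eq_empty open_ball)
    note p0 = local[OF q this]
    have opn: "open {w\<in>ball z e. q w \<noteq> 0}"
      using q holomorphic_vec_open_nonzero unfolding thin_datum_def by blast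
    then have sub: "{w\<in>ball z e. q w \<noteq> 0} \<subseteq> S"
      unfolding S_def by (intro interior_maximal) (use q p0 in auto)
    have "ball z e \<subseteq> closure S"
    proof
      fix w assume w: "w \<in> ball z e"
      show "w \<in> closure S"
        unfolding closure_iff_nhds_not_empty
      proof (intro allI impI)
        fix B V assume "V \<subseteq> B" "open V" "w \<in> V"
        with thin_datum_dense[OF q(1) this(2)] w sub show "S \<inter> B \<noteq> {}" by blast
      qed
    qed
    then have "ball z e \<subseteq> A" unfolding A_def by (intro interior_maximal) auto
    with e show "z \<in> A" by auto
  qed
  then have "closed A" by (metis closure_subset closed_closure subset_antisym)
  moreover have "open A" by (simp add: A_def)
  moreover have "A \<noteq> {}"
  proof -
    have "W \<subseteq> S" unfolding S_def using W 0 by (intro interior_maximal) auto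
    then have "W \<subseteq> A" unfolding A_def using W closure_subset by (intro interior_maximal) auto
    with W show ?thesis by auto
  qed
  ultimately have "A = UNIV" using clopen by blast
  show ?thesis
    unfolding generically_alt
  proof
    fix z
    obtain e p q where q: "thin_datum z e q" "holomorphic_vec (ball z e) p" "\<forall>w\<in>ball z e. q w \<noteq> 0 \<longrightarrow> F w = p w / q w"
      using F unfolding meromorphic_vec_alt by meson
    have "A \<inter> ball z e \<noteq> {}" using q \<open>A = UNIV\<close> by (simp add: thin_datum_def)
    from local[OF q this] q show "\<exists>e q. thin_datum z e q \<and> (\<forall>w\<in>ball z e. q w \<noteq> 0 \<longrightarrow> F w = 0)"
      by (metis div_0)
  qed
qed

lemma meromorphic_vec_eq:
  fixes F :: "complex ^ 'r \<Rightarrow> complex"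
  assumes "meromorphic_vec F" "meromorphic_vec H" "open W" "W \<noteq> {}" "\<And>s. s \<in> W \<Longrightarrow> F s = H s"
  shows "generically (\<lambda>s. F s = H s)"
proof -
  have "meromorphic_vec (\<lambda>s. F s + - 1 * H s)"
    by (intro meromorphic_vec_add meromorphic_vec_mult meromorphic_vec_const assms)
  from meromorphic_vec_eq_zero[OF this assms(3,4)] assms(5)
  show ?thesis by simp
qed

text \<open>On regions of this kind the zeta functions are given by convergent integrals. With the
  nonemptiness below, they are the open sets from which identities are continued.\<close>

lemma open_right_halfspaces: "open {s :: complex ^ 'r. \<forall>i. Re (s $ i) > k}"
proof -
  have "open (\<Inter>i. {s :: complex ^ 'r. Re (s $ i) > k})"
    by (intro open_INT finite ballI open_Collect_less continuous_intros)
  then show ?thesis by (simp add: Collect_all_eq)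
qed

lemma right_halfspaces_nonempty: "{s :: complex ^ 'r. \<forall>i. Re (s $ i) > k} \<noteq> {}"
proof -
  have "(\<chi> i. of_real (k + 1)) \<in> {s :: complex ^ 'r. \<forall>i. Re (s $ i) > k}" by simp
  then show ?thesis by blast
qed

section \<open>Bases of a character lattice\<close>

definition lattice_point :: "(complex ^ 'm ^ 'm) set \<Rightarrow> ('r::finite \<Rightarrow> 'm charac) \<Rightarrow> ('r \<Rightarrow> int) \<Rightarrow> 'm charac" where
  "lattice_point G \<omega> n = restrict (\<lambda>g. \<Prod>i\<in>UNIV. \<omega> i g powi n i) G"

lemma sum_indicator_singleton:
  fixes f :: "'a \<Rightarrow> 'b::semiring_1"
  assumes "finite B" "b \<in> B"
  shows "(\<Sum>x\<in>B. indicator {b} x * f x) = f b"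
proof -
  have "(\<Sum>x\<in>B. indicator {b} x * f x) = (\<Sum>x\<in>B. if x = b then f x else 0)"
    by (intro sum.cong) auto
  then show ?thesis using assms by simp
qed

lemma tensor_relations_add:
  "u \<in> tensor_relations G X \<Longrightarrow> v \<in> tensor_relations G X \<Longrightarrow> (\<lambda>\<theta>. u \<theta> + v \<theta>) \<in> tensor_relations G X"
proof (induction rule: tensor_relations.induct)
  case (add u \<theta> \<theta>' c)
  from tensor_relations.add[OF add.IH[OF add.prems] add.hyps(2,3), of c] show ?case
    by (simp add: algebra_simps)
qed simp

lemma tensor_relations_scale:
  "u \<in> tensor_relations G X \<Longrightarrow> (\<lambda>\<theta>. c * u \<theta>) \<in> tensor_relations G X"
proof (induction rule: tensor_relations.induct)
  case zero
  then show ?case using tensor_relations.zero by simp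
next
  case (add u \<theta> \<theta>' d)
  from tensor_relations.add[OF add.IH add.hyps(2,3), of "c * d"] show ?case
    by (simp add: algebra_simps)
qed

lemma tensor_relations_sum:
  "(\<And>i. i \<in> I \<Longrightarrow> u i \<in> tensor_relations G X) \<Longrightarrow> (\<lambda>\<theta>. \<Sum>i\<in>I. u i \<theta>) \<in> tensor_relations G X"
  by (induction I rule: infinite_finite_induct)
    (auto intro: tensor_relations.zero tensor_relations_add)

lemma tensor_relations_diff:
  assumes "u \<in> tensor_relations G X" "v \<in> tensor_relations G X"
  shows "(\<lambda>\<theta>. u \<theta> - v \<theta>) \<in> tensor_relations G X"
  using tensor_relations_add[OF assms(1) tensor_relations_scale[OF assms(2), of "-1"]] by simp

lemma tensor_coset_eqI:
  assumes "(\<lambda>\<theta>. u \<theta> - v \<theta>) \<in> tensor_relations G X"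
  shows "tensor_coset G X u = tensor_coset G X v"
proof -
  have "(\<lambda>\<theta>. w \<theta> - u \<theta>) \<in> tensor_relations G X \<longleftrightarrow> (\<lambda>\<theta>. w \<theta> - v \<theta>) \<in> tensor_relations G X" for w
    using tensor_relations_add[OF _ assms, of "\<lambda>\<theta>. w \<theta> - u \<theta>"]
      tensor_relations_diff[OF _ assms, of "\<lambda>\<theta>. w \<theta> - v \<theta>"] by auto
  then show ?thesis by (simp add: tensor_coset_def)
qed

text \<open>\<open>nz\<close> makes integer powers additive in the exponent, and \<open>ext\<close>
  lets the equality of characters as total functions be tested on \<open>G\<close>.\<close>

locale character_basis =
  fixes G :: "(complex ^ 'm::finite ^ 'm) set" and X :: "'m charac set" and \<omega> :: "'r::finite \<Rightarrow> 'm charac"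
  assumes nz: "g \<in> G \<Longrightarrow> \<omega> i g \<noteq> 0" and ext: "\<omega> i \<in> extensional G"
    and basis: "Z_basis G X \<omega>"
begin

lemma bij: "bij_betw (lattice_point G \<omega>) UNIV X"
  using basis unfolding Z_basis_def lattice_point_def .

lemma lattice_point_add:
  "restrict (\<lambda>g. lattice_point G \<omega> n g * lattice_point G \<omega> k g) G = lattice_point G \<omega> (\<lambda>i. n i + k i)"
  by (auto simp: lattice_point_def restrict_def fun_eq_iff power_int_add nz prod.distrib)

lemma lattice_point_in: "lattice_point G \<omega> n \<in> X"
  using bij by (auto simp: bij_betw_def)

lemma lattice_point_unit: "lattice_point G \<omega> (\<lambda>j. if j = i then 1 else 0) = \<omega> i"
proof
  fix g
  have "(\<Prod>j\<in>UNIV. \<omega> j g powi (if j = i then 1 else 0)) = (\<Prod>j\<in>UNIV. if j = i then \<omega> j g else 1)"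
    by (intro prod.cong) auto
  then show "lattice_point G \<omega> (\<lambda>j. if j = i then 1 else 0) g = \<omega> i g"
    using ext[of i] by (auto simp: lattice_point_def restrict_def extensional_def)
qed

definition exponent :: "'m charac \<Rightarrow> 'r \<Rightarrow> int" where
  "exponent = inv_into UNIV (lattice_point G \<omega>)"

lemma exponent_lattice_point [simp]: "exponent (lattice_point G \<omega> n) = n"
  using bij by (auto simp: exponent_def bij_betw_def)

lemma lattice_point_exponent [simp]: "\<theta> \<in> X \<Longrightarrow> lattice_point G \<omega> (exponent \<theta>) = \<theta>"
  using bij by (auto simp: exponent_def bij_betw_def f_inv_into_f)

lemma exponent_mult:
  assumes "\<theta> \<in> X" "\<theta>' \<in> X"
  shows "exponent (restrict (\<lambda>g. \<theta> g * \<theta>' g) G) j = exponent \<theta> j + exponent \<theta>' j"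
  using lattice_point_add[of "exponent \<theta>" "exponent \<theta>'"] assms
  by (metis exponent_lattice_point lattice_point_exponent)

lemma exponent_basis: "exponent (\<omega> i) = (\<lambda>j. if j = i then 1 else 0)"
  using exponent_lattice_point lattice_point_unit by metis

text \<open>The \<open>j\<close>-th exponent is additive on \<open>X\<close>, so its linear
  extension kills every generator of the relations. The sum runs over all sufficiently large finite
  sets because a relation comes without a designated finite support.\<close>

lemma tensor_relations_exponent:
  "u \<in> tensor_relations G X \<Longrightarrow>
     \<exists>A. finite A \<and> (\<forall>B. finite B \<and> A \<subseteq> B \<longrightarrow> (\<Sum>\<theta>\<in>B. u \<theta> * of_int (exponent \<theta> j)) = 0)"
proof (induction rule: tensor_relations.induct)
  case (add u \<theta> \<theta>' c)
  then obtain A where A: "finite A" "\<And>B. finite B \<Longrightarrow> A \<subseteq> B \<Longrightarrow> (\<Sum>\<theta>\<in>B. u \<theta> * of_int (exponent \<theta> j)) = 0"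
    by blast
  let ?m = "restrict (\<lambda>g. \<theta> g * \<theta>' g) G"
  let ?A = "A \<union> {?m, \<theta>, \<theta>'}"
  have "(\<Sum>\<zeta>\<in>B. (u \<zeta> + c * (indicator {?m} \<zeta> - indicator {\<theta>} \<zeta> - indicator {\<theta>'} \<zeta>)) * of_int (exponent \<zeta> j)) = 0"
    if B: "finite B" "?A \<subseteq> B" for B
  proof -
    have "(\<Sum>\<zeta>\<in>B. (u \<zeta> + c * (indicator {?m} \<zeta> - indicator {\<theta>} \<zeta> - indicator {\<theta>'} \<zeta>)) * of_int (exponent \<zeta> j))
      = (\<Sum>\<zeta>\<in>B. u \<zeta> * of_int (exponent \<zeta> j)) + c * ((\<Sum>\<zeta>\<in>B. indicator {?m} \<zeta> * complex_of_int (exponent \<zeta> j))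
         - (\<Sum>\<zeta>\<in>B. indicator {\<theta>} \<zeta> * complex_of_int (exponent \<zeta> j)) - (\<Sum>\<zeta>\<in>B. indicator {\<theta>'} \<zeta> * complex_of_int (exponent \<zeta> j)))"
      by (simp add: algebra_simps sum.distrib sum_subtractf sum_distrib_left)
    also have "\<dots> = 0"
      using B A(2)[of B] by (subst (1 2 3) sum_indicator_singleton) (auto simp: exponent_mult[OF add.hyps(2,3)])
    finally show ?thesis .
  qed
  with A(1) show ?case by (intro exI[of _ ?A]) auto
qed auto

text \<open>The difference of the representatives of \<open>s\<close> and \<open>t\<close> is a
  relation; the linear extension of the \<open>j\<close>-th exponent kills it and takes the value
  \<open>s $ j - t $ j\<close> on it.\<close>

lemma inj_tensor_sum: "inj (tensor_sum G X \<omega>)"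
proof (rule injI)
  fix s t :: "complex ^ 'r"
  assume eq: "tensor_sum G X \<omega> s = tensor_sum G X \<omega> t"
  define u where "u = (\<lambda>s \<theta>. \<Sum>i\<in>UNIV. (s :: complex ^ 'r) $ i * indicator {\<omega> i} \<theta>)"
  have \<omega>X: "\<omega> i \<in> X" for i using lattice_point_in lattice_point_unit by metis
  have "{\<theta>. u s \<theta> \<noteq> 0} \<subseteq> range \<omega>"
  proof
    fix \<theta> assume \<theta>: "\<theta> \<in> {\<theta>. u s \<theta> \<noteq> 0}"
    show "\<theta> \<in> range \<omega>"
    proof (rule ccontr)
      assume "\<theta> \<notin> range \<omega>"
      then have "u s \<theta> = 0" unfolding u_def by (intro sum.neutral) (auto simp: indicator_def)
      with \<theta> show False by simp
    qed
  qed
  moreover from this have "finite {\<theta>. u s \<theta> \<noteq> 0}"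
    by (rule finite_subset) simp
  ultimately have "u s \<in> tensor_coset G X (u s)"
    using \<omega>X tensor_relations.zero by (auto simp: tensor_coset_def)
  also have "tensor_coset G X (u s) = tensor_coset G X (u t)"
    using eq unfolding tensor_sum_def u_def .
  finally have "(\<lambda>\<theta>. u s \<theta> - u t \<theta>) \<in> tensor_relations G X"
    by (simp add: tensor_coset_def)
  then have "s $ j - t $ j = 0" for j
  proof -
    assume "(\<lambda>\<theta>. u s \<theta> - u t \<theta>) \<in> tensor_relations G X"
    from tensor_relations_exponent[OF this, of j] obtain A where A: "finite A"
      "\<forall>B. finite B \<and> A \<subseteq> B \<longrightarrow> (\<Sum>\<theta>\<in>B. (u s \<theta> - u t \<theta>) * of_int (exponent \<theta> j)) = 0"
      by (elim exE conjE)
    define B where "B = A \<union> range \<omega>"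
    have B: "finite B" "A \<subseteq> B" "\<omega> i \<in> B" for i using A by (auto simp: B_def)
    have "(\<Sum>\<theta>\<in>B. u s \<theta> * of_int (exponent \<theta> j)) = s $ j" for s
    proof -
      have "(\<Sum>\<theta>\<in>B. u s \<theta> * of_int (exponent \<theta> j))
        = (\<Sum>i\<in>UNIV. \<Sum>\<theta>\<in>B. s $ i * indicator {\<omega> i} \<theta> * of_int (exponent \<theta> j))"
        unfolding u_def sum_distrib_right by (rule sum.swap)
      also have "\<dots> = (\<Sum>i\<in>UNIV. s $ i * of_int (exponent (\<omega> i) j))"
        using B by (intro sum.cong refl) (simp only: mult.assoc sum_distrib_left[symmetric] sum_indicator_singleton)
      also have "\<dots> = (\<Sum>i\<in>UNIV. if i = j then s $ i else 0)"
        by (intro sum.cong) (auto simp: exponent_basis)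
      finally show ?thesis by simp
    qed
    with A(2)[rule_format, OF conjI, OF B(1,2)] show ?thesis by (simp add: left_diff_distrib sum_subtractf)
  qed
  then show "s = t" by (simp add: vec_eq_iff)
qed

text \<open>In \<open>X \<otimes> \<complex>\<close> the class of \<open>\<Prod>\<^sub>i \<omega>\<^sub>i\<^bsup>n\<^sub>i\<^esup>\<close> is \<open>\<Sum>\<^sub>i n\<^sub>i [\<omega>\<^sub>i]\<close>.\<close>

lemma lattice_point_relation:
  "(\<lambda>\<theta>. indicator {lattice_point G \<omega> n} \<theta> - (\<Sum>i\<in>UNIV. of_int (n i) * indicator {\<omega> i} \<theta>)) \<in> tensor_relations G X"
proof -
  define E where "E = (\<lambda>(n :: 'r \<Rightarrow> int) \<theta>. indicator {lattice_point G \<omega> n} \<theta> - (\<Sum>i\<in>UNIV. complex_of_int (n i) * indicator {\<omega> i} \<theta>))"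
  define R where "R = tensor_relations G X"
  \<comment> \<open>The defect \<open>E\<close> is additive modulo relations, which reduces the
    claim to multiples of single basis vectors.\<close>
  have cocycle: "(\<lambda>\<theta>. E (\<lambda>i. n i + k i) \<theta> - E n \<theta> - E k \<theta>) \<in> R" for n k
  proof -
    have "(\<lambda>\<theta>. 0 + 1 * (indicator {restrict (\<lambda>g. lattice_point G \<omega> n g * lattice_point G \<omega> k g) G} \<theta>
        - indicator {lattice_point G \<omega> n} \<theta> - indicator {lattice_point G \<omega> k} \<theta>)) \<in> R"
      unfolding R_def by (intro tensor_relations.intros lattice_point_in)
    then show ?thesis
      unfolding lattice_point_add E_def by (simp add: algebra_simps sum.distrib)
  qed
  have plus: "E (\<lambda>i. n i + k i) \<in> R" if "E n \<in> R" "E k \<in> R" for n k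
    using tensor_relations_add[OF tensor_relations_add[OF cocycle[of n k, unfolded R_def] that(1)[unfolded R_def]] that(2)[unfolded R_def]]
    by (simp add: R_def)
  have minus: "E k \<in> R" if "E (\<lambda>i. n i + k i) \<in> R" "E n \<in> R" for n k
    using tensor_relations_diff[OF tensor_relations_diff[OF that[unfolded R_def]] cocycle[of n k, unfolded R_def]]
    by (simp add: R_def)
  have E0: "E (\<lambda>_. 0) \<in> R"
    using tensor_relations_scale[OF cocycle[of "\<lambda>_. 0" "\<lambda>_. 0", unfolded R_def], of "-1"] by (simp add: R_def)
  define e where "e = (\<lambda>(j :: 'r) (k :: int) i. if i = j then k else 0)"
  have "(\<Sum>i\<in>UNIV. complex_of_int (if i = j then 1 else 0) * indicator {\<omega> i} \<theta>) = (\<Sum>i\<in>UNIV. if i = j then indicator {\<omega> i} \<theta> else 0)" for j \<theta>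
    by (intro sum.cong) auto
  then have unit: "E (e j 1) \<in> R" for j
    by (simp add: E_def e_def lattice_point_unit R_def tensor_relations.zero)
  have e_add: "e j (k + l) = (\<lambda>i. e j k i + e j l i)" for j k l by (auto simp: e_def)
  have "E (e j (int k)) \<in> R" for j k
  proof (induction k)
    case 0
    then show ?case using E0 by (simp add: e_def cong: if_cong)
  next
    case (Suc k)
    have "int (Suc k) = int k + 1" by simp
    then show ?case using plus[OF Suc unit[of j]] by (simp only: e_add)
  qed
  \<comment> \<open>Negative multiples follow by cancellation, since \<open>e j (int k)\<close> and
    \<open>e j (- int k)\<close> add up to zero.\<close>
  moreover from this have "E (e j (- int k)) \<in> R" for j k
    using minus[of "e j (int k)" "e j (- int k)"] E0 by (simp add: e_add[symmetric]) (simp add: e_def cong: if_cong)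
  ultimately have e: "E (e j k) \<in> R" for j k by (metis int_cases2)
  have "E (\<lambda>i. if i \<in> S then n i else 0) \<in> R" if "finite S" for S n
    using that
  proof (induction S)
    case empty
    then show ?case using E0 by simp
  next
    case (insert j S)
    have "(\<lambda>i. if i \<in> insert j S then n i else 0) = (\<lambda>i. (if i \<in> S then n i else 0) + e j (n j) i)"
      using insert by (auto simp: e_def)
    then show ?case using plus[OF insert.IH e] by simp
  qed
  from this[of UNIV n] show ?thesis by (simp add: E_def R_def)
qed

end

text \<open>The matrix of \<open>T\<close> consists of the integer exponents of the
  \<open>\<omega>' i\<close> in the basis \<open>\<omega>\<close>, so the transition between the two
  charts is linear over the complex numbers.\<close>

lemma tensor_sum_change_of_basis:
  fixes \<omega> \<omega>' :: "'r::finite \<Rightarrow> 'm::finite charac"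
  assumes "character_basis G X \<omega>" "character_basis G X \<omega>'"
  obtains T where "complex_linear T" "\<And>s. tensor_sum G X \<omega>' s = tensor_sum G X \<omega> (T s)"
proof -
  interpret A: character_basis G X \<omega> by fact
  interpret B: character_basis G X \<omega>' by fact
  define n where "n i = A.exponent (\<omega>' i)" for i
  have \<omega>': "\<omega>' i = lattice_point G \<omega> (n i)" for i
    using B.lattice_point_in B.lattice_point_unit A.lattice_point_exponent by (metis n_def)
  define T where "T = (\<lambda>s :: complex ^ 'r. \<chi> j. \<Sum>i\<in>UNIV. s $ i * of_int (n i j))"
  have "complex_linear T"
    unfolding complex_linear_def
    by (auto intro!: linearI simp: T_def vec_eq_iff algebra_simps sum.distrib sum_distrib_left scaleR_sum_right)
  moreover have "tensor_sum G X \<omega>' s = tensor_sum G X \<omega> (T s)" for s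
    unfolding tensor_sum_def
  proof (rule tensor_coset_eqI)
    have "(\<lambda>\<theta>. \<Sum>i\<in>UNIV. s $ i * (indicator {lattice_point G \<omega> (n i)} \<theta> - (\<Sum>j\<in>UNIV. of_int (n i j) * indicator {\<omega> j} \<theta>))) \<in> tensor_relations G X"
      by (intro tensor_relations_sum tensor_relations_scale A.lattice_point_relation)
    moreover have "(\<Sum>i\<in>UNIV. s $ i * (indicator {lattice_point G \<omega> (n i)} \<theta> - (\<Sum>j\<in>UNIV. of_int (n i j) * indicator {\<omega> j} \<theta>)))
       = (\<Sum>i\<in>UNIV. s $ i * indicator {\<omega>' i} \<theta>) - (\<Sum>i\<in>UNIV. T s $ i * indicator {\<omega> i} \<theta>)" for \<theta>
    proof -
      have "(\<Sum>i\<in>UNIV. s $ i * (\<Sum>j\<in>UNIV. of_int (n i j) * indicator {\<omega> j} \<theta>)) = (\<Sum>i\<in>UNIV. T s $ i * indicator {\<omega> i} \<theta>)"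
        unfolding T_def sum_distrib_left by (subst sum.swap) (simp add: sum_distrib_right mult.assoc)
      then show ?thesis by (simp add: \<omega>' right_diff_distrib sum_subtractf)
    qed
    ultimately show "(\<lambda>\<theta>. (\<Sum>i\<in>UNIV. s $ i * indicator {\<omega>' i} \<theta>) - (\<Sum>i\<in>UNIV. T s $ i * indicator {\<omega> i} \<theta>)) \<in> tensor_relations G X"
      by simp
  qed
  ultimately show ?thesis using that by blast
qed

text \<open>Going back and forth gives a map that an injective chart cannot distinguish from the
  identity; so each chart change inverts the other.\<close>

lemma tensor_sum_change_of_basis_bij:
  fixes \<omega> \<omega>' :: "'r::finite \<Rightarrow> 'm::finite charac"
  assumes "character_basis G X \<omega>" "character_basis G X \<omega>'"
  obtains T T' where "complex_linear T" "complex_linear T'" "\<And>s. T (T' s) = s" "\<And>s. T' (T s) = s"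
    "\<And>s. tensor_sum G X \<omega>' s = tensor_sum G X \<omega> (T s)"
    "\<And>s. tensor_sum G X \<omega> s = tensor_sum G X \<omega>' (T' s)"
proof -
  obtain T where T: "complex_linear T" "\<And>s. tensor_sum G X \<omega>' s = tensor_sum G X \<omega> (T s)"
    using tensor_sum_change_of_basis[OF assms] by blast
  obtain T' where T': "complex_linear T'" "\<And>s. tensor_sum G X \<omega> s = tensor_sum G X \<omega>' (T' s)"
    using tensor_sum_change_of_basis[OF assms(2,1)] by blast
  have "T (T' s) = s" "T' (T s) = s" for s
    using character_basis.inj_tensor_sum[OF assms(1)] character_basis.inj_tensor_sum[OF assms(2)] T(2) T'(2)
    by (metis injD)+
  with T T' show ?thesis using that by blast
qed

text \<open>The chart is injective, so the \<open>s\<close> inside the definite description is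
  unique.\<close>

lemma degree_form_tensor_sum:
  assumes "character_basis G X \<omega>"
  shows "degree_form (tensor_sum G X \<omega>) f (tensor_sum G X \<omega> s) = (\<Sum>i\<in>UNIV. s $ i * of_nat (total_degree (f i)))"
  unfolding degree_form_def using character_basis.inj_tensor_sum[OF assms]
  by (intro the_equality) (auto dest: injD)

section \<open>Polynomial functions\<close>

lemma mpoly_eval_superset:
  assumes "finite S" "Poly_Mapping.keys p \<subseteq> S"
  shows "mpoly_eval p x = (\<Sum>m\<in>S. Poly_Mapping.lookup p m * (\<Prod>i\<in>UNIV. x i ^ Poly_Mapping.lookup m i))"
  unfolding mpoly_eval_def using assms
  by (intro sum.mono_neutral_left) (auto simp: in_keys_iff)

lemma lookup_complexify [simp]: "Poly_Mapping.lookup (complexify p) m = of_real (Poly_Mapping.lookup p m)"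
  by (simp add: complexify_def Poly_Mapping.map.rep_eq when_def)

lemma keys_complexify [simp]: "Poly_Mapping.keys (complexify p) = Poly_Mapping.keys p"
  by (auto simp: in_keys_iff)

lemma complexify_eq_0_iff [simp]: "complexify p = 0 \<longleftrightarrow> p = 0"
  by (metis keys_complexify keys_eq_empty)

lemma mpoly_eval_complexify_one [simp]:
  "mpoly_eval (complexify (1 :: ('x::finite, real) mpoly)) x = 1"
  by (simp add: mpoly_eval_def)

definition monomial_degree :: "('x::finite \<Rightarrow>\<^sub>0 nat) \<Rightarrow> nat" where
  "monomial_degree m = (\<Sum>i\<in>UNIV. Poly_Mapping.lookup m i)"

text \<open>Digits in base \<open>N\<close> are read off one at a time: the remainder modulo
  \<open>N\<close> gives the lowest, and cancelling it shifts the others down.\<close>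

lemma power_base_expansion_inj:
  fixes a b :: "nat \<Rightarrow> nat"
  assumes "\<And>j. j < n \<Longrightarrow> a j < N" "\<And>j. j < n \<Longrightarrow> b j < N"
    and "(\<Sum>j<n. a j * N ^ j) = (\<Sum>j<n. b j * N ^ j)" and "j < n"
  shows "a j = b j"
  using assms
proof (induction n arbitrary: a b j)
  case (Suc n)
  have split: "(\<Sum>j<Suc n. c j * N ^ j) = c 0 + N * (\<Sum>j<n. c (Suc j) * N ^ j)" for c :: "nat \<Rightarrow> nat"
    by (simp add: sum.lessThan_Suc_shift sum_distrib_left algebra_simps del: sum.lessThan_Suc)
  have eq: "a 0 + N * (\<Sum>j<n. a (Suc j) * N ^ j) = b 0 + N * (\<Sum>j<n. b (Suc j) * N ^ j)"
    using Suc.prems(3) unfolding split .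
  have lt: "a 0 < N" "b 0 < N" using Suc.prems by auto
  have "a 0 = (a 0 + N * (\<Sum>j<n. a (Suc j) * N ^ j)) mod N" using lt by simp
  also have "\<dots> = b 0" unfolding eq using lt by simp
  finally have 0: "a 0 = b 0" .
  with eq lt have "(\<Sum>j<n. a (Suc j) * N ^ j) = (\<Sum>j<n. b (Suc j) * N ^ j)" by simp
  then have "a (Suc k) = b (Suc k)" if "k < n" for k
    using that Suc.prems(1,2) by (intro Suc.IH[of "\<lambda>j. a (Suc j)" "\<lambda>j. b (Suc j)"]) auto
  with 0 Suc.prems(4) show ?case by (cases j) auto
qed simp

text \<open>Kronecker substitution: \<open>x\<^sub>j = t\<^bsup>N^j\<^esup>\<close> with \<open>N\<close> larger than all exponents separates monomials.\<close>

lemma mpoly_eval_nonzero: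
  fixes p :: "('x::finite, 'k::{idom, ring_char_0}) mpoly"
  assumes "p \<noteq> 0" shows "\<exists>x. mpoly_eval p x \<noteq> 0"
proof -
  obtain \<iota> :: "'x \<Rightarrow> nat" where \<iota>: "bij_betw \<iota> UNIV {..<CARD('x)}"
    using ex_bij_betw_finite_nat[of "UNIV :: 'x set"] by (auto simp: atLeast0LessThan)
  let ?K = "Poly_Mapping.keys p"
  \<comment> \<open>Exceeds the sum of all degrees and therefore every single exponent, as digits in
    base \<open>N\<close> require.\<close>
  define N where "N = Suc (\<Sum>m\<in>?K. monomial_degree m)"
  define e where "e = (\<lambda>m :: 'x \<Rightarrow>\<^sub>0 nat. \<Sum>i\<in>UNIV. Poly_Mapping.lookup m i * N ^ \<iota> i)"
  have bound: "Poly_Mapping.lookup m i < N" if "m \<in> ?K" for m i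
  proof -
    have "Poly_Mapping.lookup m i \<le> monomial_degree m"
      unfolding monomial_degree_def by (rule member_le_sum) auto
    also have "\<dots> \<le> (\<Sum>m\<in>?K. monomial_degree m)" by (rule member_le_sum) (use that in auto)
    finally show ?thesis by (simp add: N_def)
  qed
  have inj: "m = m'" if m: "m \<in> ?K" "m' \<in> ?K" "e m = e m'" for m m'
  proof -
    define \<kappa> where "\<kappa> = inv_into UNIV \<iota>"
    have \<kappa>: "\<kappa> (\<iota> i) = i" for i using \<iota> by (simp add: \<kappa>_def bij_betw_def)
    have e: "e m = (\<Sum>j<CARD('x). Poly_Mapping.lookup m (\<kappa> j) * N ^ j)" for m
      unfolding e_def using \<kappa> by (subst sum.reindex_bij_betw[OF \<iota>, symmetric]) simp
    have "Poly_Mapping.lookup m (\<kappa> j) = Poly_Mapping.lookup m' (\<kappa> j)" if "j < CARD('x)" for j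
      by (rule power_base_expansion_inj[of "CARD('x)" _ N]) (use m e bound that in auto)
    moreover have "\<iota> i < CARD('x)" for i using \<iota> by (auto simp: bij_betw_def)
    ultimately show ?thesis using \<kappa> by (metis poly_mapping_eqI)
  qed
  define P where "P = (\<Sum>m\<in>?K. Polynomial.monom (Poly_Mapping.lookup p m) (e m))"
  obtain m0 where m0: "m0 \<in> ?K" using assms by fastforce
  have "Polynomial.coeff P (e m0) = (\<Sum>m\<in>?K. if m = m0 then Poly_Mapping.lookup p m else 0)"
    unfolding P_def Polynomial.coeff_sum using inj m0 by (intro sum.cong) auto
  also have "\<dots> \<noteq> 0" using m0 by (simp add: in_keys_iff)
  finally have "P \<noteq> 0" by auto
  then have "finite {t. poly P t = 0}" by (rule poly_roots_finite)
  then obtain t where "poly P t \<noteq> 0"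
    using ex_new_if_finite[OF infinite_UNIV_char_0] by blast
  moreover have "poly P t = mpoly_eval p (\<lambda>i. t ^ (N ^ \<iota> i))"
    unfolding P_def mpoly_eval_def e_def poly_sum poly_monom
    by (simp add: power_sum power_mult[symmetric] mult.commute)
  ultimately show ?thesis by metis
qed

section \<open>Restriction of polynomials to lines through the origin\<close>

definition radial_poly :: "('x::finite, real) mpoly \<Rightarrow> ('x \<Rightarrow> complex) \<Rightarrow> complex poly" where
  "radial_poly p x = (\<Sum>m\<in>Poly_Mapping.keys p.
     Polynomial.monom (of_real (Poly_Mapping.lookup p m) * (\<Prod>i\<in>UNIV. x i ^ Poly_Mapping.lookup m i)) (monomial_degree m))"

lemma poly_radial_poly: "poly (radial_poly p x) t = mpoly_eval (complexify p) (\<lambda>i. t * x i)"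
  by (simp add: radial_poly_def mpoly_eval_def poly_sum poly_monom monomial_degree_def
      power_mult_distrib prod.distrib power_sum mult_ac)

text \<open>The leading form. Its value at \<open>x\<close> is the coefficient of degree
  \<open>total_degree p\<close> along the line through \<open>x\<close>, which is how the total
  degree becomes visible on a line.\<close>

definition top_part :: "('x::finite, real) mpoly \<Rightarrow> ('x, real) mpoly" where
  "top_part p = Poly_Mapping.mapp (\<lambda>m c. if monomial_degree m = total_degree p then c else 0) p"

lemma lookup_top_part:
  "Poly_Mapping.lookup (top_part p) m = (if monomial_degree m = total_degree p then Poly_Mapping.lookup p m else 0)"
  by (simp add: top_part_def mapp.rep_eq in_keys_iff)

lemma top_part_nonzero:
  assumes "p \<noteq> 0" shows "top_part p \<noteq> 0"
proof -
  have "total_degree p \<in> monomial_degree ` Poly_Mapping.keys p"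
    using assms unfolding total_degree_def monomial_degree_def by (simp only: if_False, intro Max_in) auto
  then obtain m where "m \<in> Poly_Mapping.keys p" "total_degree p = monomial_degree m" by auto
  then have "Poly_Mapping.lookup (top_part p) m \<noteq> 0" by (simp add: lookup_top_part in_keys_iff)
  then show ?thesis by auto
qed

lemma coeff_radial_poly:
  "Polynomial.coeff (radial_poly p x) (total_degree p) = mpoly_eval (complexify (top_part p)) x"
proof -
  have "Poly_Mapping.keys (complexify (top_part p)) \<subseteq> Poly_Mapping.keys p"
    by (auto simp: in_keys_iff lookup_top_part split: if_splits)
  then show ?thesis
    unfolding radial_poly_def Polynomial.coeff_sum
    by (subst mpoly_eval_superset[of "Poly_Mapping.keys p"]) (auto simp: lookup_top_part intro!: sum.cong)
qed

section \<open>Real Zariski topology, real points and scalar maps\<close>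

lemma topspace_zariski_R [simp]: "topspace (zariski_R coord) = UNIV"
proof -
  have "UNIV = {x. mpoly_eval (complexify 1) (coord x) \<noteq> 0}" by simp
  then show ?thesis unfolding zariski_R_def topology_generated_by_topspace by blast
qed

lemma openin_zariski_R: "openin (zariski_R coord) {x. mpoly_eval (complexify q) (coord x) \<noteq> 0}"
  unfolding zariski_R_def by (rule topology_generated_by_Basis) blast

lemma continuous_map_zariski_R:
  assumes "\<And>q. openin T {x \<in> topspace T. mpoly_eval (complexify q) (coord (h x)) \<noteq> 0}"
  shows "continuous_map T (zariski_R coord) h"
  unfolding zariski_R_def
proof (rule continuous_on_generated_topo)
  fix U assume "U \<in> {U. \<exists>q. U = {x. mpoly_eval (complexify q) (coord x) \<noteq> 0}}"
  then obtain q where "U = {x. mpoly_eval (complexify q) (coord x) \<noteq> 0}" by blast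
  then show "openin T (h -` U \<inter> topspace T)"
    using assms[of q] by (simp add: vimage_def Int_def conj_commute)
next
  show "h ` topspace T \<subseteq> \<Union> {U. \<exists>q. U = {x. mpoly_eval (complexify q) (coord x) \<noteq> 0}}"
    using topspace_zariski_R[of coord] unfolding zariski_R_def topology_generated_by_topspace by blast
qed

lemma continuous_on_mpoly_eval [continuous_intros]:
  fixes h :: "'a::topological_space \<Rightarrow> 'x::finite \<Rightarrow> complex"
  assumes "\<And>i. continuous_on S (\<lambda>x. h x i)"
  shows "continuous_on S (\<lambda>x. mpoly_eval q (h x))"
  unfolding mpoly_eval_def by (intro continuous_intros assms)

text \<open>Polynomials are continuous, so the inclusion of the real points is continuous from the
  Euclidean into the Zariski topology.\<close>

lemma open_real_points:
  assumes "openin (zariski_R vec_nth) (U :: (complex ^ 'n) set)" shows "open (real_points U)"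
proof -
  have "continuous_map euclidean (zariski_R vec_nth) (complex_vec :: real ^ 'n \<Rightarrow> _)"
  proof (rule continuous_map_zariski_R)
    fix q :: "('n, real) mpoly"
    show "openin euclidean {x \<in> topspace euclidean. mpoly_eval (complexify q) (vec_nth (complex_vec x)) \<noteq> 0}"
      by (simp, intro open_Collect_neq continuous_intros) (simp add: complex_vec_def, intro continuous_intros)
  qed
  from openin_continuous_map_preimage[OF this assms] show ?thesis
    by (simp add: real_points_def)
qed

lemma vec_nth_smult: "vec_nth (c *s x) = (\<lambda>i. c * x $ i)"
  by (simp add: fun_eq_iff)

lemma closure_of_UNIV_meets:
  assumes "T closure_of S = UNIV" "openin T U" "U \<noteq> {}" shows "\<exists>x\<in>S. x \<in> U"
proof -
  obtain u where "u \<in> U" using assms(3) by blast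
  moreover have "u \<in> T closure_of S" using assms(1) by simp
  ultimately show ?thesis using assms(2) by (auto simp: in_closure_of)
qed

text \<open>The coefficients stay real because \<open>a\<close> is real; hence scaling by
  \<open>a\<close> is continuous for the topology given by real polynomials.\<close>

definition rescale :: "real \<Rightarrow> ('x::finite, real) mpoly \<Rightarrow> ('x, real) mpoly" where
  "rescale a p = Poly_Mapping.mapp (\<lambda>m c. c * a ^ monomial_degree m) p"

lemma mpoly_eval_rescale:
  "mpoly_eval (complexify (rescale a p)) x = mpoly_eval (complexify p) (\<lambda>i. of_real a * x i)"
proof -
  have look: "Poly_Mapping.lookup (rescale a p) m = Poly_Mapping.lookup p m * a ^ monomial_degree m" for m
    by (simp add: rescale_def mapp.rep_eq in_keys_iff)
  then have "Poly_Mapping.keys (complexify (rescale a p)) \<subseteq> Poly_Mapping.keys p"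
    by (auto simp: in_keys_iff)
  then show ?thesis
    by (subst mpoly_eval_superset[of "Poly_Mapping.keys p"])
      (auto simp: look mpoly_eval_def monomial_degree_def power_mult_distrib prod.distrib power_sum mult_ac intro!: sum.cong)
qed

lemma continuous_map_zariski_scale:
  "continuous_map (zariski_R vec_nth) (zariski_R vec_nth) (\<lambda>x :: complex ^ 'n. of_real a *s x)"
proof (rule continuous_map_zariski_R)
  fix q :: "('n, real) mpoly"
  have "mpoly_eval (complexify q) (vec_nth (of_real a *s x)) = mpoly_eval (complexify (rescale a q)) (vec_nth x)"
    for x :: "complex ^ 'n"
    by (simp add: mpoly_eval_rescale vec_nth_smult)
  then show "openin (zariski_R vec_nth) {x \<in> topspace (zariski_R vec_nth). mpoly_eval (complexify q) (vec_nth (of_real a *s (x :: complex ^ 'n))) \<noteq> 0}"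
    using openin_zariski_R[of vec_nth "rescale a q"] by simp
qed


section \<open>Prehomogeneous actions\<close>

lemma matrix_inv:
  fixes A :: "'k::semiring_1 ^ 'm ^ 'm"
  assumes "invertible A" shows "A ** matrix_inv A = mat 1" "matrix_inv A ** A = mat 1"
  using someI_ex[OF assms[unfolded invertible_def]] unfolding matrix_inv_def by auto

lemma matrix_inv_unique:
  fixes A :: "'k::semiring_1 ^ 'm ^ 'm"
  assumes "A ** B = mat 1" "B ** A = mat 1" shows "matrix_inv A = B"
proof -
  have "invertible A" using assms invertible_def by blast
  then have "matrix_inv A = matrix_inv A ** (A ** B)" by (simp add: assms)
  also have "\<dots> = B" by (simp add: matrix_mul_assoc matrix_inv[OF \<open>invertible A\<close>])
  finally show ?thesis .
qed

lemma group_GL: "group (GL :: ('k::field ^ 'm ^ 'm) monoid)"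
proof (rule groupI)
  fix x y z :: "'k ^ 'm ^ 'm"
  assume x: "x \<in> carrier GL" and y: "y \<in> carrier GL"
  show "x \<otimes>\<^bsub>GL\<^esub> y \<in> carrier GL" using x y by (simp add: GL_def invertible_mult)
  show "\<exists>y\<in>carrier GL. y \<otimes>\<^bsub>GL\<^esub> x = \<one>\<^bsub>GL\<^esub>"
    using x unfolding GL_def by (auto simp: invertible_def)
qed (auto simp: GL_def matrix_mul_assoc invertible_def intro: exI[of _ "mat 1"])

lemma subgroup_GL_inverse:
  assumes "subgroup H GL" "g \<in> H" shows "matrix_inv g \<in> H" "invertible g"
proof -
  interpret group GL by (rule group_GL)
  have g: "g \<in> carrier GL" using subgroup.mem_carrier[OF assms] .
  then show "invertible g" by (simp add: GL_def)
  have "inv\<^bsub>GL\<^esub> g \<in> H" using assms by (rule subgroup.m_inv_closed)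
  moreover have "matrix_inv g = inv\<^bsub>GL\<^esub> g"
    using l_inv[OF g] r_inv[OF g] by (intro matrix_inv_unique) (auto simp: GL_def)
  ultimately show "matrix_inv g \<in> H" by simp
qed

locale linear_action =
  fixes G :: "(complex ^ 'm::finite ^ 'm) set" and \<rho> :: "complex ^ 'm ^ 'm \<Rightarrow> complex ^ 'n::finite ^ 'n"
  assumes subgroup: "subgroup G GL" and hom: "\<rho> \<in> hom (subgrp G) GL"
begin

lemma invertible_\<rho>: "g \<in> G \<Longrightarrow> invertible (\<rho> g)"
  using hom by (auto simp: hom_def subgrp_def GL_def)

lemma \<rho>_mult: "g \<in> G \<Longrightarrow> h \<in> G \<Longrightarrow> \<rho> (g ** h) = \<rho> g ** \<rho> h"
  using hom by (auto simp: hom_def subgrp_def GL_def)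

lemma one_in: "mat 1 \<in> G"
  using subgroup.one_closed[OF subgroup] by (simp add: GL_def)

lemma mult_in: "g \<in> G \<Longrightarrow> h \<in> G \<Longrightarrow> g ** h \<in> G"
  using subgroup.m_closed[OF subgroup] by (simp add: GL_def)

lemma \<rho>_one: "\<rho> (mat 1) = mat 1"
proof -
  have "\<rho> (mat 1) ** \<rho> (mat 1) = \<rho> (mat 1)" using \<rho>_mult[OF one_in one_in] by simp
  then have "matrix_inv (\<rho> (mat 1)) ** (\<rho> (mat 1) ** \<rho> (mat 1)) = mat 1"
    using matrix_inv[OF invertible_\<rho>[OF one_in]] by simp
  then show ?thesis by (simp add: matrix_mul_assoc matrix_inv[OF invertible_\<rho>[OF one_in]])
qed

lemma act_inverse:
  assumes "g \<in> G" shows "(x v* \<rho> g) v* \<rho> (matrix_inv g) = x"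
  using assms \<rho>_mult[of g "matrix_inv g", symmetric] subgroup_GL_inverse[OF subgroup assms] \<rho>_one matrix_inv(1)[of g]
  by (simp add: vector_matrix_mul_assoc)

lemma orbit_unique:
  assumes "(\<lambda>g. x v* \<rho> g) ` G \<inter> (\<lambda>g. y v* \<rho> g) ` G \<noteq> {}"
  shows "(\<lambda>g. x v* \<rho> g) ` G = (\<lambda>g. y v* \<rho> g) ` G"
proof -
  have sub: "(\<lambda>g. x v* \<rho> g) ` G \<subseteq> (\<lambda>g. y v* \<rho> g) ` G"
    if gh: "g \<in> G" "h \<in> G" "x v* \<rho> g = y v* \<rho> h" for x y g h
  proof
    fix z assume "z \<in> (\<lambda>g. x v* \<rho> g) ` G"
    then obtain k where k: "k \<in> G" "z = x v* \<rho> k" by blast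
    have "x = (y v* \<rho> h) v* \<rho> (matrix_inv g)" using act_inverse[OF gh(1), of x] gh(3) by simp
    then have "z = y v* \<rho> (h ** matrix_inv g ** k)"
      using k gh subgroup_GL_inverse(1)[OF subgroup gh(1)]
      by (simp add: \<rho>_mult mult_in vector_matrix_mul_assoc)
    then show "z \<in> (\<lambda>g. y v* \<rho> g) ` G"
      using k gh subgroup_GL_inverse(1)[OF subgroup gh(1)] by (auto intro: mult_in)
  qed
  obtain g h where "g \<in> G" "h \<in> G" "x v* \<rho> g = y v* \<rho> h" using assms by auto
  then show ?thesis using sub[of g h x y] sub[of h g y x] by auto
qed

text \<open>The scalars commute with \<open>G\<close>, so they permute the orbits, and two open dense orbits meet.\<close>

lemma open_orbit_scale:
  assumes Xp: "open_dense_orbit G \<rho> Xp" and a: "a \<noteq> 0" and y: "y \<in> Xp"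
  shows "of_real a *s y \<in> Xp"
proof -
  obtain x where x: "Xp = (\<lambda>g. x v* \<rho> g) ` G" using Xp unfolding open_dense_orbit_def by blast
  have opn: "openin (zariski_R vec_nth) Xp" and dense: "zariski_R vec_nth closure_of Xp = UNIV"
    using Xp unfolding open_dense_orbit_def by auto
  have orbit: "(\<lambda>z. of_real a *s z) ` Xp = (\<lambda>g. (of_real a *s x) v* \<rho> g) ` G"
    unfolding x image_image by (simp add: scalar_vector_matrix_assoc)
  \<comment> \<open>The image is rewritten as a preimage under scaling by the inverse, so that
    continuity yields openness.\<close>
  have "(\<lambda>z. of_real a *s z) ` Xp = {z. of_real (inverse a) *s z \<in> Xp}"
  proof (intro subset_antisym subsetI)
    fix z assume "z \<in> {z. of_real (inverse a) *s z \<in> Xp}"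
    moreover have "z = of_real a *s (of_real (inverse a) *s z)" using a by (simp add: vector_smult_assoc)
    ultimately show "z \<in> (\<lambda>z. of_real a *s z) ` Xp" by blast
  qed (use a in \<open>auto simp: vector_smult_assoc\<close>)
  then have "openin (zariski_R vec_nth) ((\<lambda>z. of_real a *s z) ` Xp)"
    using openin_continuous_map_preimage[OF continuous_map_zariski_scale opn, of "inverse a"] by simp
  moreover have "(\<lambda>z. of_real a *s z) ` Xp \<noteq> {}" using y by auto
  ultimately have "Xp \<inter> (\<lambda>z. of_real a *s z) ` Xp \<noteq> {}"
    using closure_of_UNIV_meets[OF dense] by blast
  then have "(\<lambda>z. of_real a *s z) ` Xp = Xp"
    using orbit_unique[of "of_real a *s x" x] unfolding orbit by (simp add: x Int_commute)
  with y show ?thesis by blast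
qed

text \<open>Scalars commute with the action, so \<open>F (t *s z) / F z\<close> does not change
  along the orbit and is a polynomial in \<open>t\<close> alone. Multiplicativity under doubling
  forces it to be a monomial, and density of the orbit forces its degree to be the total
  degree.\<close>

lemma relative_invariant_homogeneous:
  assumes Xp: "open_dense_orbit G \<rho> Xp" and inv: "relative_invariant G \<rho> p 1 \<theta>"
    and nz: "\<And>x. x \<in> Xp \<Longrightarrow> mpoly_eval (complexify p) (vec_nth x) \<noteq> 0" and y: "y \<in> Xp"
  shows "mpoly_eval (complexify p) (vec_nth (t *s y)) = t ^ total_degree p * mpoly_eval (complexify p) (vec_nth y)"
proof -
  define F where "F = (\<lambda>x :: complex ^ 'n. mpoly_eval (complexify p) (vec_nth x))"
  define d where "d = total_degree p"
  obtain x where x: "Xp = (\<lambda>g. x v* \<rho> g) ` G" using Xp unfolding open_dense_orbit_def by blast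
  have xX: "x \<in> Xp" unfolding x using one_in \<rho>_one by (auto intro!: image_eqI[of _ _ "mat 1"])
  have Fx: "F x \<noteq> 0" using nz[OF xX] by (simp add: F_def)
  have rel: "F (z v* \<rho> g) = \<theta> g * F z" if "g \<in> G" for g z
    using inv that unfolding relative_invariant_def F_def by simp
  have poly: "poly (radial_poly p (vec_nth z)) t = F (t *s z)" for t z
    by (simp add: poly_radial_poly F_def vec_nth_smult)
  define Q where "Q = radial_poly p (vec_nth x)"
  have Q: "poly Q t = F (t *s x)" for t by (simp add: Q_def poly)
  have proportional: "F (t *s z) * F x = poly Q t * F z" if "z \<in> Xp" for t z
  proof -
    obtain g where g: "g \<in> G" "z = x v* \<rho> g" using \<open>z \<in> Xp\<close> x by blast
    have "F (t *s z) = \<theta> g * F (t *s x)" unfolding g(2) by (simp add: rel[OF g(1), symmetric] scalar_vector_matrix_assoc)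
    moreover have "F z = \<theta> g * F x" unfolding g(2) by (simp add: rel[OF g(1)])
    ultimately show ?thesis by (simp add: Q)
  qed
  have "p \<noteq> 0" using inv by (simp add: relative_invariant_def)
  then obtain w0 where "mpoly_eval (complexify (top_part p)) w0 \<noteq> 0"
    using mpoly_eval_nonzero[of "complexify (top_part p)"] top_part_nonzero by auto
  then have "(\<chi> i. w0 i) \<in> {z. mpoly_eval (complexify (top_part p)) (vec_nth z) \<noteq> 0}"
    by (simp add: vec_lambda_inverse)
  \<comment> \<open>Density of the orbit supplies a point at which the leading form is nonzero;
    along its line \<open>F\<close> has a nonzero coefficient in degree \<open>d\<close>, and by
    proportionality so has \<open>Q\<close>.\<close>
  then obtain z where z: "z \<in> Xp" "mpoly_eval (complexify (top_part p)) (vec_nth z) \<noteq> 0"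
    using Xp closure_of_UNIV_meets[OF _ openin_zariski_R[of vec_nth "top_part p"], of Xp]
    unfolding open_dense_orbit_def by blast
  have "smult (F x) (radial_poly p (vec_nth z)) = smult (F z) Q"
    by (rule poly_ext) (use proportional[OF z(1)] in \<open>simp add: poly mult.commute\<close>)
  then have "Polynomial.coeff (smult (F x) (radial_poly p (vec_nth z))) d = Polynomial.coeff (smult (F z) Q) d" by simp
  then have "Polynomial.coeff Q d \<noteq> 0"
    using z(2) Fx by (auto simp: coeff_radial_poly d_def)
  \<comment> \<open>Doubling suffices: 2 is a real scalar, so it preserves the orbit, and its powers
    are distinct, so it separates the coefficients of \<open>Q\<close>.\<close>
  have "of_real 2 *s x \<in> Xp" by (rule open_orbit_scale[OF Xp _ xX]) simp
  from proportional[OF this] have "poly Q (t * 2) * F x = poly Q t * poly Q 2" for t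
    by (simp add: Q vector_smult_assoc)
  then have "smult (F x) (pcompose Q [:0, 2:]) = smult (poly Q 2) Q"
    by (intro poly_ext) (simp add: poly_pcompose mult.commute)
  then have "Polynomial.coeff (smult (F x) (pcompose Q [:0, 2:])) k = Polynomial.coeff (smult (poly Q 2) Q) k" for k
    by simp
  then have coeffs: "F x * (2 ^ k * Polynomial.coeff Q k) = poly Q 2 * Polynomial.coeff Q k" for k
    by (simp add: coeff_pcompose_linear)
  then have Q2: "poly Q 2 = F x * 2 ^ d" using \<open>Polynomial.coeff Q d \<noteq> 0\<close> coeffs[of d] by simp
  have "Polynomial.coeff Q k = 0" if "k \<noteq> d" for k
  proof (rule ccontr)
    assume "Polynomial.coeff Q k \<noteq> 0"
    with coeffs[of k] Fx have "(2::complex) ^ k = 2 ^ d" by (simp add: Q2)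
    then have "of_nat (2 ^ k) = (of_nat (2 ^ d) :: complex)" by simp
    then have "(2::nat) ^ k = 2 ^ d" using of_nat_eq_iff by blast
    then show False using that by simp
  qed
  then have "Q = Polynomial.monom (Polynomial.coeff Q d) d" by (intro poly_eqI) auto
  then have Qt: "poly Q t = Polynomial.coeff Q d * t ^ d" for t by (metis poly_monom)
  have "F x = Polynomial.coeff Q d" using Q[of 1] Qt[of 1] by simp
  with proportional[OF y, of t] Qt Fx show ?thesis by (simp add: F_def d_def)
qed

text \<open>Inverse and transpose both reverse products, so together they preserve them. The results
  of this locale thereby apply to the dual space.\<close>

lemma linear_action_contragredient: "linear_action G (contragredient \<rho>)"
proof (rule linear_action.intro)
  show "subgroup G GL" by (rule subgroup)
  show "contragredient \<rho> \<in> hom (subgrp G) GL"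
  proof (rule homI)
    fix g assume "g \<in> carrier (subgrp G)"
    then have "invertible (\<rho> g)" using invertible_\<rho> by (simp add: subgrp_def)
    then have "invertible (matrix_inv (\<rho> g))" using matrix_inv invertible_def by blast
    then have "invertible (transpose (matrix_inv (\<rho> g)))"
      unfolding invertible_def by (metis matrix_transpose_mul transpose_mat)
    then show "contragredient \<rho> g \<in> carrier GL"
      by (simp add: contragredient_def GL_def)
  next
    fix g h assume gh: "g \<in> carrier (subgrp G)" "h \<in> carrier (subgrp G)"
    then have gh: "g \<in> G" "h \<in> G" by (auto simp: subgrp_def)
    let ?A = "\<rho> g" and ?B = "\<rho> h"
    note inv = matrix_inv[OF invertible_\<rho>[OF gh(1)]] matrix_inv[OF invertible_\<rho>[OF gh(2)]]
    have "matrix_inv (?A ** ?B) = matrix_inv ?B ** matrix_inv ?A"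
    proof (rule matrix_inv_unique)
      have "(?A ** ?B) ** (matrix_inv ?B ** matrix_inv ?A) = ?A ** (?B ** matrix_inv ?B) ** matrix_inv ?A"
        by (simp only: matrix_mul_assoc)
      then show "(?A ** ?B) ** (matrix_inv ?B ** matrix_inv ?A) = mat 1" by (simp add: inv)
      have "(matrix_inv ?B ** matrix_inv ?A) ** (?A ** ?B) = matrix_inv ?B ** (matrix_inv ?A ** ?A) ** ?B"
        by (simp only: matrix_mul_assoc)
      then show "(matrix_inv ?B ** matrix_inv ?A) ** (?A ** ?B) = mat 1" by (simp add: inv)
    qed
    then show "contragredient \<rho> (g \<otimes>\<^bsub>subgrp G\<^esub> h) = contragredient \<rho> g \<otimes>\<^bsub>GL\<^esub> contragredient \<rho> h"
      using gh by (simp add: contragredient_def subgrp_def GL_def \<rho>_mult matrix_transpose_mul)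
  qed
qed

end

lemma basic_relative_invariants_nonzero:
  assumes "basic_relative_invariants Xp f" "x \<in> Xp"
  shows "mpoly_eval (complexify (f i)) (vec_nth x) \<noteq> 0"
proof -
  have "zero_locus (f i) \<in> irreducible_components (zariski_R vec_nth) (- Xp)"
    using assms(1) unfolding basic_relative_invariants_def bij_betw_def by blast
  then have "zero_locus (f i) \<subseteq> - Xp" by (simp add: irreducible_components_def)
  with assms(2) show ?thesis by (auto simp: zero_locus_def)
qed

lemma basic_relative_invariants_nonzero_real:
  "basic_relative_invariants Xp f \<Longrightarrow> x \<in> real_points Xp \<Longrightarrow>
     mpoly_eval (complexify (f i)) (vec_nth (complex_vec x)) \<noteq> 0"
  by (simp add: basic_relative_invariants_nonzero real_points_def)

section \<open>Schwartz functions\<close>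

text \<open>Translates between derivatives and the difference quotients in which
  \<open>smooth_map\<close> is phrased.\<close>

lemma has_vector_derivative_iff_quotient:
  fixes f :: "real \<Rightarrow> 'a::real_normed_vector"
  shows "(f has_vector_derivative v) (at 0) \<longleftrightarrow> ((\<lambda>t. (1 / t) *\<^sub>R (f t - f 0) - v) \<longlongrightarrow> 0) (at 0)"
proof -
  have "(f has_vector_derivative v) (at 0) \<longleftrightarrow> ((\<lambda>t. norm ((f t - f 0) - t *\<^sub>R v) / norm t) \<longlongrightarrow> 0) (at 0)"
    unfolding has_vector_derivative_def has_derivative_iff_norm by (simp add: bounded_linear_scaleR_left)
  also have "\<dots> \<longleftrightarrow> ((\<lambda>t. norm ((1 / t) *\<^sub>R (f t - f 0) - v)) \<longlongrightarrow> 0) (at 0)"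
  proof (rule filterlim_cong[OF refl refl])
    have "norm ((f t - f 0) - t *\<^sub>R v) / norm t = norm ((1 / t) *\<^sub>R (f t - f 0) - v)" if "t \<noteq> 0" for t
    proof -
      have "(f t - f 0) - t *\<^sub>R v = t *\<^sub>R ((1 / t) *\<^sub>R (f t - f 0) - v)"
        using that by (simp add: algebra_simps)
      then show ?thesis using that by (metis norm_scaleR nonzero_mult_div_cancel_left norm_eq_zero real_norm_def)
    qed
    then show "\<forall>\<^sub>F t in at 0. norm ((f t - f 0) - t *\<^sub>R v) / norm t = norm ((1 / t) *\<^sub>R (f t - f 0) - v)"
      by (simp add: eventually_at_filter)
  qed
  finally show ?thesis by (simp add: tendsto_norm_zero_iff)
qed

lemma has_vector_derivative_iff_cmod_quotient:
  fixes f :: "real \<Rightarrow> complex"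
  shows "(f has_vector_derivative v) (at 0) \<longleftrightarrow> ((\<lambda>t. cmod (of_real (1 / t) * (f t - f 0) - v)) \<longlongrightarrow> 0) (at 0)"
  unfolding has_vector_derivative_iff_quotient by (simp add: tendsto_norm_zero_iff scaleR_conv_of_real)

text \<open>\<open>smooth_map\<close> quantifies existentially over a family of derivatives.
  Derivatives being unique, any candidate family agrees with \<open>partial_derivs\<close> on
  \<open>U\<close>; openness ensures that the derivative at a point of \<open>U\<close> is
  determined by values inside \<open>U\<close>.\<close>

lemma partial_derivs_family:
  fixes F :: "'e::euclidean_space \<Rightarrow> complex"
  assumes U: "open U" and D0: "D [] = F"
    and cont: "\<And>es x. set es \<subseteq> Basis \<Longrightarrow> x \<in> U \<Longrightarrow> isCont (D es) x"
    and der: "\<And>es x b. set es \<subseteq> Basis \<Longrightarrow> x \<in> U \<Longrightarrow> b \<in> Basis \<Longrightarrow>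
      ((\<lambda>t. D es (x + t *\<^sub>R b)) has_vector_derivative D (b # es) x) (at 0)"
  shows "smooth_function U F"
    and "set es \<subseteq> Basis \<Longrightarrow> x \<in> U \<Longrightarrow> partial_derivs es F x = D es x"
proof -
  show "smooth_function U F"
    unfolding smooth_map_def
  proof (intro exI[of _ D] conjI allI impI ballI D0)
    fix es :: "'e list" and x assume *: "set es \<subseteq> Basis" "x \<in> U"
    show "((\<lambda>y. cmod (D es y - D es x)) \<longlongrightarrow> 0) (at x)"
      using cont[OF *] by (simp add: tendsto_norm_zero_iff LIM_zero_iff isCont_def)
    fix b :: 'e assume b: "b \<in> Basis"
    show "((\<lambda>t. cmod (of_real (1 / t) * (D es (x + t *\<^sub>R b) - D es x) - D (b # es) x)) \<longlongrightarrow> 0) (at 0)"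
      using der[OF * b] unfolding has_vector_derivative_iff_cmod_quotient by simp
  qed
  show "set es \<subseteq> Basis \<Longrightarrow> x \<in> U \<Longrightarrow> partial_derivs es F x = D es x"
  proof (induction es arbitrary: x)
    case (Cons b es)
    have "((\<lambda>t. partial_derivs es F (x + t *\<^sub>R b)) has_vector_derivative D (b # es) x) (at 0)"
    proof (rule has_vector_derivative_transform_within_open)
      show "((\<lambda>t. D es (x + t *\<^sub>R b)) has_vector_derivative D (b # es) x) (at 0)"
        using Cons by (intro der) auto
      have "continuous_on UNIV (\<lambda>t. x + t *\<^sub>R b)" by (intro continuous_intros)
      from open_vimage[OF U this] show "open ((\<lambda>t. x + t *\<^sub>R b) -` U)" .
    qed (use Cons in auto)
    then show ?case by (simp add: vector_derivative_at)
  qed (simp add: D0)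
qed

text \<open>On \<open>U\<close> the family hidden in \<open>smooth_map\<close> is
  \<open>partial_derivs\<close>, which therefore inherits continuity and differentiability.\<close>

lemma smooth_function_partial_derivs:
  fixes F :: "'e::euclidean_space \<Rightarrow> complex"
  assumes F: "smooth_function U F" and U: "open U" and es: "set es \<subseteq> Basis" and x: "x \<in> U"
  shows "isCont (partial_derivs es F) x"
    and "b \<in> Basis \<Longrightarrow> ((\<lambda>t. partial_derivs es F (x + t *\<^sub>R b)) has_vector_derivative partial_derivs (b # es) F x) (at 0)"
proof -
  obtain D where D0: "D [] = F"
    and cont: "\<And>es x. set es \<subseteq> Basis \<Longrightarrow> x \<in> U \<Longrightarrow> ((\<lambda>y. cmod (D es y - D es x)) \<longlongrightarrow> 0) (at x)"
    and der: "\<And>es x b. set es \<subseteq> Basis \<Longrightarrow> x \<in> U \<Longrightarrow> b \<in> Basis \<Longrightarrow>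
      ((\<lambda>t. cmod (of_real (1 / t) * (D es (x + t *\<^sub>R b) - D es x) - D (b # es) x)) \<longlongrightarrow> 0) (at 0)"
    using F unfolding smooth_map_def by blast
  have der': "((\<lambda>t. D es (x + t *\<^sub>R b)) has_vector_derivative D (b # es) x) (at 0)"
    if "set es \<subseteq> Basis" "x \<in> U" "b \<in> Basis" for es x b
    using der[OF that] unfolding has_vector_derivative_iff_cmod_quotient by simp
  have cont': "isCont (D es) x" if "set es \<subseteq> Basis" "x \<in> U" for es x
    using cont[OF that] by (simp add: tendsto_norm_zero_iff LIM_zero_iff isCont_def)
  have eq: "D es x = partial_derivs es F x" if "set es \<subseteq> Basis" "x \<in> U" for es x
    by (rule partial_derivs_family(2)[of U D, symmetric]) (use U D0 cont' der' that in auto)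
  have near: "\<forall>\<^sub>F y in nhds x. D es y = partial_derivs es F y"
    using eq[OF es] U x by (metis (mono_tags, lifting) eventually_nhds)
  with cont'[OF es x] show "isCont (partial_derivs es F) x"
    using isCont_cong by fastforce
  show "((\<lambda>t. partial_derivs es F (x + t *\<^sub>R b)) has_vector_derivative partial_derivs (b # es) F x) (at 0)"
    if b: "b \<in> Basis"
  proof (rule has_vector_derivative_transform_within_open)
    have "set (b # es) \<subseteq> Basis" using es b by simp
    then show "((\<lambda>t. D es (x + t *\<^sub>R b)) has_vector_derivative partial_derivs (b # es) F x) (at 0)"
      using der'[OF es x b] eq[of "b # es" x] x by metis
    have "continuous_on UNIV (\<lambda>t. x + t *\<^sub>R b)" by (intro continuous_intros)
    from open_vimage[OF U this] show "open ((\<lambda>t. x + t *\<^sub>R b) -` U)" .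
  qed (use x eq[OF es] in auto)
qed

text \<open>
  A coinduction principle for Schwartz functions: it replaces Leibniz rules for iterated derivatives
  by closure properties under single ones.
\<close>

definition schwartz_closed :: "('e::euclidean_space \<Rightarrow> complex) set \<Rightarrow> bool" where
  "schwartz_closed S \<longleftrightarrow> (\<forall>F\<in>S. continuous_on UNIV F \<and> bounded (range F) \<and>
     (\<forall>b\<in>Basis. (\<lambda>x. of_real (x \<bullet> b) * F x) \<in> S \<and>
        (\<exists>F'\<in>S. \<forall>x. ((\<lambda>t. F (x + t *\<^sub>R b)) has_vector_derivative F' x) (at 0))))"

text \<open>The norm is at most the sum of the \<open>\<bar>x \<bullet> b\<bar>\<close>, so each
  further power of decay is paid for by one multiplication with a coordinate, which stays in
  \<open>S\<close>.\<close>

lemma schwartz_closed_decay: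
  fixes S :: "('e::euclidean_space \<Rightarrow> complex) set"
  assumes S: "schwartz_closed S" and "F \<in> S"
  shows "\<exists>B. \<forall>x. (1 + norm x) ^ k * cmod (F x) \<le> B"
  using assms(2)
proof (induction k arbitrary: F)
  case 0
  then have "bounded (range F)" using S by (auto simp: schwartz_closed_def)
  then show ?case by (auto simp: bounded_iff)
next
  case (Suc k)
  obtain B where B: "\<And>x. (1 + norm x) ^ k * cmod (F x) \<le> B" using Suc by blast
  have "\<exists>C. \<forall>x. (1 + norm x) ^ k * cmod (of_real (x \<bullet> b) * F x) \<le> C" if "b \<in> Basis" for b
    using Suc.prems S that by (intro Suc.IH) (auto simp: schwartz_closed_def)
  then obtain C where C: "\<And>b x. b \<in> Basis \<Longrightarrow> (1 + norm x) ^ k * cmod (of_real (x \<bullet> b) * F x) \<le> C b"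
    by metis
  show ?case
  proof (intro exI allI)
    fix x :: 'e
    have "(1 + norm x) ^ Suc k * cmod (F x) = (1 + norm x) ^ k * cmod (F x) + norm x * ((1 + norm x) ^ k * cmod (F x))"
      by (simp add: algebra_simps)
    also have "norm x * ((1 + norm x) ^ k * cmod (F x)) \<le> (\<Sum>b\<in>Basis. \<bar>x \<bullet> b\<bar>) * ((1 + norm x) ^ k * cmod (F x))"
      by (intro mult_right_mono norm_le_l1) auto
    also have "\<dots> = (\<Sum>b\<in>Basis. (1 + norm x) ^ k * cmod (of_real (x \<bullet> b) * F x))"
      by (simp add: sum_distrib_right sum_distrib_left norm_mult mult_ac)
    also have "\<dots> \<le> (\<Sum>b\<in>Basis. C b)" by (intro sum_mono C)
    finally show "(1 + norm x) ^ Suc k * cmod (F x) \<le> B + (\<Sum>b\<in>Basis. C b)" using B[of x] by linarith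
  qed
qed

lemma schwartz_closed_imp_schwartz:
  fixes S :: "('e::euclidean_space \<Rightarrow> complex) set"
  assumes S: "schwartz_closed S" and F: "F \<in> S"
  shows "schwartz_function F"
proof -
  have step: "(\<forall>x. ((\<lambda>t. H (x + t *\<^sub>R b)) has_vector_derivative vector_derivative (\<lambda>t. H (x + t *\<^sub>R b)) (at 0)) (at 0))
      \<and> (\<lambda>x. vector_derivative (\<lambda>t. H (x + t *\<^sub>R b)) (at 0)) \<in> S" if "H \<in> S" "b \<in> Basis" for H b
  proof -
    obtain F' where F': "F' \<in> S" "\<And>x. ((\<lambda>t. H (x + t *\<^sub>R b)) has_vector_derivative F' x) (at 0)"
      using S \<open>H \<in> S\<close> \<open>b \<in> Basis\<close> unfolding schwartz_closed_def by meson
    then have "(\<lambda>x. vector_derivative (\<lambda>t. H (x + t *\<^sub>R b)) (at 0)) = F'"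
      by (auto simp: vector_derivative_at)
    with F' show ?thesis by (metis vector_derivative_at)
  qed
  have mem: "partial_derivs es F \<in> S" if "set es \<subseteq> Basis" for es
    using that F step by (induction es) auto
  have "smooth_function UNIV F"
  proof (rule partial_derivs_family(1)[where D = "\<lambda>es. partial_derivs es F"])
    fix es x assume "set es \<subseteq> (Basis :: 'e set)"
    from mem[OF this] show "isCont (partial_derivs es F) x"
      using S by (auto simp: schwartz_closed_def continuous_on_eq_continuous_at)
  qed (use step mem in auto)
  moreover have "bounded (range (\<lambda>x. of_real ((1 + norm x) ^ k) * partial_derivs es F x))"
    if es: "set es \<subseteq> Basis" for es :: "'e list" and k
  proof -
    obtain B where "\<And>x. (1 + norm x) ^ k * cmod (partial_derivs es F x) \<le> B"
      using schwartz_closed_decay[OF S mem[OF es]] by blast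
    then have "\<forall>x. cmod (of_real ((1 + norm x) ^ k) * partial_derivs es F x) \<le> B"
      by (simp add: norm_mult norm_power flip: of_real_power of_real_add)
    then show ?thesis by (auto simp: bounded_iff)
  qed
  ultimately show ?thesis unfolding schwartz_function_def by blast
qed

text \<open>The orbit of \<open>F\<close> under operators of the Weyl algebra, in normal order:
  derivatives are taken first, coordinates are multiplied on afterwards. Differentiating such an
  element produces the commutator term of the product rule, which calls for
  \<open>plus\<close>.\<close>

inductive_set weyl_orbit :: "('e::euclidean_space \<Rightarrow> complex) \<Rightarrow> ('e \<Rightarrow> complex) set"
  for F :: "'e \<Rightarrow> complex" where
  deriv: "set es \<subseteq> Basis \<Longrightarrow> partial_derivs es F \<in> weyl_orbit F"
| coord: "u \<in> weyl_orbit F \<Longrightarrow> b \<in> Basis \<Longrightarrow> (\<lambda>x. of_real (x \<bullet> b) * u x) \<in> weyl_orbit F"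
| plus: "u \<in> weyl_orbit F \<Longrightarrow> v \<in> weyl_orbit F \<Longrightarrow> (\<lambda>x. u x + v x) \<in> weyl_orbit F"

lemma schwartz_closed_weyl_orbit:
  fixes F :: "'e::euclidean_space \<Rightarrow> complex"
  assumes F: "schwartz_function F" shows "schwartz_closed (weyl_orbit F)"
proof -
  have smooth: "smooth_function UNIV F" using F by (simp add: schwartz_function_def)
  have decay: "\<exists>B. \<forall>x. (1 + norm x) ^ k * cmod (u x) \<le> B" if "u \<in> weyl_orbit F" for u k
    using that
  proof (induction arbitrary: k)
    case (deriv es)
    then have "bounded (range (\<lambda>x. of_real ((1 + norm x) ^ k) * partial_derivs es F x))"
      using F by (simp add: schwartz_function_def)
    then obtain B where "\<forall>x. cmod (of_real ((1 + norm x) ^ k) * partial_derivs es F x) \<le> B"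
      by (auto simp: bounded_iff)
    then show ?case by (auto simp: norm_mult norm_power simp flip: of_real_power of_real_add)
  next
    case (coord u b)
    obtain B where B: "\<And>x. (1 + norm x) ^ Suc k * cmod (u x) \<le> B" using coord.IH by blast
    have "(1 + norm x) ^ k * cmod (of_real (x \<bullet> b) * u x) \<le> B" for x
    proof -
      have "\<bar>x \<bullet> b\<bar> \<le> 1 + norm x" using Basis_le_norm[OF coord.hyps(2), of x] by linarith
      then have "(1 + norm x) ^ k * cmod (of_real (x \<bullet> b) * u x) \<le> (1 + norm x) ^ k * ((1 + norm x) * cmod (u x))"
        by (auto simp: norm_mult intro!: mult_left_mono mult_right_mono)
      also have "\<dots> \<le> B" using B[of x] by (simp add: mult_ac)
      finally show ?thesis .
    qed
    then show ?case by blast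
  next
    case (plus u v)
    obtain B C where B: "\<And>x. (1 + norm x) ^ k * cmod (u x) \<le> B" "\<And>x. (1 + norm x) ^ k * cmod (v x) \<le> C"
      using plus.IH by meson
    have "(1 + norm x) ^ k * cmod (u x + v x) \<le> B + C" for x
    proof -
      have "(1 + norm x) ^ k * cmod (u x + v x) \<le> (1 + norm x) ^ k * (cmod (u x) + cmod (v x))"
        by (intro mult_left_mono norm_triangle_ineq) auto
      with B[of x] show ?thesis by (simp add: distrib_left)
    qed
    then show ?case by blast
  qed
  have cont: "continuous_on UNIV u" if "u \<in> weyl_orbit F" for u
    using that
  proof induction
    case (deriv es)
    then show ?case
      using smooth_function_partial_derivs(1)[OF smooth open_UNIV] by (simp add: continuous_at_imp_continuous_on)
  qed (auto intro!: continuous_intros)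
  have der: "\<exists>u'\<in>weyl_orbit F. \<forall>x. ((\<lambda>t. u (x + t *\<^sub>R b)) has_vector_derivative u' x) (at 0)"
    if "u \<in> weyl_orbit F" and b: "b \<in> Basis" for u b
    using that(1)
  proof induction
    case (deriv es)
    then have "partial_derivs (b # es) F \<in> weyl_orbit F" using b by (intro weyl_orbit.deriv) auto
    then show ?case
      using smooth_function_partial_derivs(2)[OF smooth open_UNIV deriv _ b] by blast
  next
    case (coord u c)
    then obtain u' where u': "u' \<in> weyl_orbit F" "\<And>x. ((\<lambda>t. u (x + t *\<^sub>R b)) has_vector_derivative u' x) (at 0)"
      by blast
    let ?v = "\<lambda>x. of_real (b \<bullet> c) * u x + of_real (x \<bullet> c) * u' x"
    have "((\<lambda>t. of_real ((x + t *\<^sub>R b) \<bullet> c) * u (x + t *\<^sub>R b)) has_vector_derivative ?v x) (at 0)" for x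
    proof -
      have "((\<lambda>t. (x + t *\<^sub>R b) \<bullet> c) has_real_derivative (b \<bullet> c)) (at 0)"
        by (auto intro!: derivative_eq_intros simp: inner_add_left)
      then have "((\<lambda>t. complex_of_real ((x + t *\<^sub>R b) \<bullet> c)) has_vector_derivative of_real (b \<bullet> c)) (at 0)"
        by (rule has_vector_derivative_of_real)
      from has_vector_derivative_mult[OF this u'(2)[of x]] show ?thesis by (simp add: add.commute)
    qed
    note deriv = this
    have "?v \<in> weyl_orbit F"
    \<comment> \<open>Basis vectors are orthonormal, so the commutator term is \<open>u\<close>
      itself or absent; no other scalars occur.\<close>
    proof (cases "b = c")
      case True
      then have "?v = (\<lambda>x. u x + of_real (x \<bullet> c) * u' x)" using b by (simp add: inner_Basis)
      then show ?thesis using weyl_orbit.plus[OF coord.hyps(1) weyl_orbit.coord[OF u'(1) coord.hyps(2)]] by simp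
    next
      case False
      then have "?v = (\<lambda>x. of_real (x \<bullet> c) * u' x)" using b coord.hyps by (simp add: inner_Basis)
      then show ?thesis using weyl_orbit.coord[OF u'(1) coord.hyps(2)] by simp
    qed
    with deriv show ?case by (intro bexI[of _ ?v] allI)
  next
    case (plus u v)
    then obtain u' v' where "u' \<in> weyl_orbit F" "\<And>x. ((\<lambda>t. u (x + t *\<^sub>R b)) has_vector_derivative u' x) (at 0)"
      "v' \<in> weyl_orbit F" "\<And>x. ((\<lambda>t. v (x + t *\<^sub>R b)) has_vector_derivative v' x) (at 0)"
      by blast
    then show ?case
      by (intro bexI[of _ "\<lambda>x. u' x + v' x"] allI has_vector_derivative_add weyl_orbit.plus)
  qed
  show ?thesis
    unfolding schwartz_closed_def
  proof (intro ballI conjI)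
    fix u assume u: "u \<in> weyl_orbit F"
    show "bounded (range u)" using decay[OF u, of 0] by (auto simp: bounded_iff)
  qed (use cont der weyl_orbit.coord in auto)
qed

text \<open>Each Schwartz function lies in a closed set, its own Weyl orbit, whose members are
  Schwartz by coinduction. This converse gives access to closure properties from the
  definition.\<close>

lemma schwartz_closed_Collect: "schwartz_closed (Collect (schwartz_function :: ('e::euclidean_space \<Rightarrow> complex) \<Rightarrow> bool))"
  unfolding schwartz_closed_def
proof (intro ballI)
  fix F :: "'e \<Rightarrow> complex" assume "F \<in> Collect schwartz_function"
  then have W: "schwartz_closed (weyl_orbit F)" by (simp add: schwartz_closed_weyl_orbit)
  have F: "F \<in> weyl_orbit F" using weyl_orbit.deriv[of "[]" F] by simp
  show "continuous_on UNIV F \<and> bounded (range F) \<and>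
     (\<forall>b\<in>Basis. (\<lambda>x. of_real (x \<bullet> b) * F x) \<in> Collect schwartz_function \<and>
        (\<exists>F'\<in>Collect schwartz_function. \<forall>x. ((\<lambda>t. F (x + t *\<^sub>R b)) has_vector_derivative F' x) (at 0)))"
    using W[unfolded schwartz_closed_def, rule_format, OF F] schwartz_closed_imp_schwartz[OF W] by blast
qed

lemma
  fixes F :: "'e::euclidean_space \<Rightarrow> complex"
  assumes "schwartz_function F"
  shows schwartz_function_continuous: "continuous_on UNIV F"
    and schwartz_function_bounded: "bounded (range F)"
    and schwartz_function_coord: "b \<in> Basis \<Longrightarrow> schwartz_function (\<lambda>x. of_real (x \<bullet> b) * F x)"
    and schwartz_function_decay: "\<exists>B. \<forall>x. (1 + norm x) ^ k * cmod (F x) \<le> B"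
  using schwartz_closed_Collect[unfolded schwartz_closed_def, rule_format, of F] assms
    schwartz_closed_decay[OF schwartz_closed_Collect, of F] by auto

lemma schwartz_function_deriv:
  assumes "schwartz_function F" "b \<in> Basis"
  obtains F' where "schwartz_function F'" "\<And>x. ((\<lambda>t. F (x + t *\<^sub>R b)) has_vector_derivative F' x) (at 0)"
  using schwartz_closed_Collect[unfolded schwartz_closed_def, rule_format, of F] assms by auto

lemma schwartz_function_scale:
  assumes "schwartz_function F" shows "schwartz_function (\<lambda>x. c * F x)"
proof (rule schwartz_closed_imp_schwartz)
  show "schwartz_closed ((\<lambda>F x. c * F x) ` Collect schwartz_function)" (is "schwartz_closed ?S")
    unfolding schwartz_closed_def
  proof (intro ballI)
    fix H assume "H \<in> ?S"
    then obtain F where F: "schwartz_function F" and H: "H = (\<lambda>x. c * F x)" by blast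
    have "continuous_on UNIV H"
      unfolding H using schwartz_function_continuous[OF F] by (intro continuous_intros)
    moreover obtain B where "\<And>x. cmod (F x) \<le> B" using schwartz_function_bounded[OF F] by (auto simp: bounded_iff)
    then have "\<forall>x. cmod (H x) \<le> cmod c * B" unfolding H by (auto simp: norm_mult intro!: mult_left_mono)
    then have "bounded (range H)" by (auto simp: bounded_iff)
    moreover have "(\<lambda>x. of_real (x \<bullet> b) * H x) \<in> ?S" if "b \<in> Basis" for b
      unfolding H using schwartz_function_coord[OF F that]
      by (intro image_eqI[of _ _ "\<lambda>x. of_real (x \<bullet> b) * F x"]) (auto simp: mult_ac)
    moreover have "\<exists>F'\<in>?S. \<forall>x. ((\<lambda>t. H (x + t *\<^sub>R b)) has_vector_derivative F' x) (at 0)" if "b \<in> Basis" for b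
    proof -
      obtain F' where F': "schwartz_function F'" "\<And>x. ((\<lambda>t. F (x + t *\<^sub>R b)) has_vector_derivative F' x) (at 0)"
        using schwartz_function_deriv[OF F \<open>b \<in> Basis\<close>] by blast
      from F'(2) have "\<forall>x. ((\<lambda>t. H (x + t *\<^sub>R b)) has_vector_derivative c * F' x) (at 0)"
        unfolding H by (intro allI has_vector_derivative_mult_right)
      with F'(1) show ?thesis by (intro bexI[of _ "\<lambda>x. c * F' x"] imageI) auto
    qed
    ultimately show "continuous_on UNIV H \<and> bounded (range H) \<and> (\<forall>b\<in>Basis. (\<lambda>x. of_real (x \<bullet> b) * H x) \<in> ?S \<and>
        (\<exists>F'\<in>?S. \<forall>x. ((\<lambda>t. H (x + t *\<^sub>R b)) has_vector_derivative F' x) (at 0)))"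
      by blast
  qed
qed (use assms in auto)

lemma Basis_vec_cases:
  assumes "b \<in> (Basis :: (real ^ 'n) set)" obtains i where "b = axis i 1"
  using assms by (auto simp: Basis_vec_def)

text \<open>A coordinate multiplication or a partial derivative alters exactly one factor, so the
  set of all such products is closed.\<close>

lemma schwartz_function_prod:
  fixes \<phi> :: "'n::finite \<Rightarrow> real \<Rightarrow> complex"
  assumes "\<And>i. schwartz_function (\<phi> i)"
  shows "schwartz_function (\<lambda>x :: real ^ 'n. \<Prod>i\<in>UNIV. \<phi> i (x $ i))"
proof (rule schwartz_closed_imp_schwartz)
  let ?P = "\<lambda>(\<phi> :: 'n \<Rightarrow> real \<Rightarrow> complex) (x :: real ^ 'n). \<Prod>i\<in>UNIV. \<phi> i (x $ i)"
  let ?S = "?P ` {\<phi>. \<forall>i. schwartz_function (\<phi> i)}"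
  show "(\<lambda>x. \<Prod>i\<in>UNIV. \<phi> i (x $ i)) \<in> ?S" using assms by auto
  show "schwartz_closed ?S"
    unfolding schwartz_closed_def
  proof (intro ballI)
    fix H assume "H \<in> ?S"
    then obtain \<phi> where \<phi>: "\<forall>i. schwartz_function (\<phi> i)" and H: "H = ?P \<phi>" by blast
    have cont: "continuous_on S (\<lambda>x. \<phi> i (h x))" if "continuous_on S h" for i S and h :: "real ^ 'n \<Rightarrow> real"
      using continuous_on_compose2[OF schwartz_function_continuous that] \<phi> by auto
    have 1: "continuous_on UNIV (?P \<phi>)" by (intro continuous_intros cont)
    have "\<exists>B. \<forall>t. cmod (\<phi> i t) \<le> B" for i
      using schwartz_function_bounded[of "\<phi> i"] \<phi> by (auto simp: bounded_iff)
    then obtain B where "\<And>i t. cmod (\<phi> i t) \<le> B i" by metis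
    then have "\<forall>x. cmod (?P \<phi> x) \<le> (\<Prod>i\<in>UNIV. B i)"
      by (auto simp: prod_norm[symmetric] intro!: prod_mono)
    then have 2: "bounded (range (?P \<phi>))" by (auto simp: bounded_iff)
    have 3: "(\<lambda>x. of_real (x \<bullet> b) * ?P \<phi> x) \<in> ?S \<and>
        (\<exists>F'\<in>?S. \<forall>x. ((\<lambda>t. ?P \<phi> (x + t *\<^sub>R b)) has_vector_derivative F' x) (at 0))"
      if "b \<in> Basis" for b
    proof
    obtain i where b: "b = axis i 1" using \<open>b \<in> Basis\<close> by (rule Basis_vec_cases)
    have split: "?P \<theta> x = \<theta> i (x $ i) * (\<Prod>j\<in>UNIV - {i}. \<theta> j (x $ j))" for \<theta> x
      by (simp add: prod.remove)
    have upd: "?P (\<phi>(i := \<theta>)) x = \<theta> (x $ i) * (\<Prod>j\<in>UNIV - {i}. \<phi> j (x $ j))" for \<theta> x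
      unfolding split by (auto intro!: prod.cong)
    have "schwartz_function (\<lambda>t. of_real t * \<phi> i t)"
      using schwartz_function_coord[of "\<phi> i" 1] \<phi> by simp
    then have "\<phi>(i := \<lambda>t. of_real t * \<phi> i t) \<in> {\<phi>. \<forall>i. schwartz_function (\<phi> i)}" using \<phi> by simp
    moreover have "(\<lambda>x. of_real (x \<bullet> b) * ?P \<phi> x) = ?P (\<phi>(i := \<lambda>t. of_real t * \<phi> i t))"
      unfolding upd unfolding split[of \<phi>] by (simp add: b inner_axis mult.assoc)
    ultimately show "(\<lambda>x. of_real (x \<bullet> b) * ?P \<phi> x) \<in> ?S" by (simp only: image_eqI)
    obtain \<phi>' where \<phi>': "schwartz_function \<phi>'" "\<And>x. ((\<lambda>t. \<phi> i (x + t *\<^sub>R 1)) has_vector_derivative \<phi>' x) (at 0)"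
      using schwartz_function_deriv[of "\<phi> i" 1] \<phi> by auto
    have "((\<lambda>t. ?P \<phi> (x + t *\<^sub>R b)) has_vector_derivative ?P (\<phi>(i := \<phi>')) x) (at 0)" for x
    proof -
      have "?P \<phi> (x + t *\<^sub>R b) = \<phi> i (x $ i + t *\<^sub>R 1) * (\<Prod>j\<in>UNIV - {i}. \<phi> j (x $ j))" for t
        unfolding split by (auto simp: b axis_def intro!: prod.cong)
      then show ?thesis unfolding upd
        using \<phi>'(2)[of "x $ i"] by (auto intro!: derivative_eq_intros)
    qed
    moreover have "\<phi>(i := \<phi>') \<in> {\<phi>. \<forall>i. schwartz_function (\<phi> i)}" using \<phi> \<phi>'(1) by simp
    ultimately show "\<exists>F'\<in>?S. \<forall>x. ((\<lambda>t. ?P \<phi> (x + t *\<^sub>R b)) has_vector_derivative F' x) (at 0)"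
      by (intro bexI[of _ "?P (\<phi>(i := \<phi>'))"] imageI allI)
    qed
    show "continuous_on UNIV H \<and> bounded (range H) \<and> (\<forall>b\<in>Basis. (\<lambda>x. of_real (x \<bullet> b) * H x) \<in> ?S \<and>
        (\<exists>F'\<in>?S. \<forall>x. ((\<lambda>t. H (x + t *\<^sub>R b)) has_vector_derivative F' x) (at 0)))"
      unfolding H using 1 2 3 by blast
  qed
qed


section \<open>Bump functions\<close>

text \<open>A single term of the exponential series at \<open>1 / y\<close> gives the bound; it
  makes \<open>exp (- (1 / y))\<close> flatter at 0 than any power.\<close>

lemma exp_minus_inverse_le:
  fixes y :: real assumes "y > 0" shows "exp (- (1 / y)) \<le> fact k * y ^ k"
proof -
  have "(1 / y) ^ k / fact k \<le> exp (1 / y)"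
    using sum_le_suminf[OF summable_exp_generic[of "1 / y"], of "{k}"] assms
    by (simp add: exp_def divide_inverse mult.commute)
  then show ?thesis using assms by (simp add: exp_minus field_simps)
qed

text \<open>The numerator \<open>p\<close> and the exponent \<open>k\<close> are kept free because
  all derivatives of the standard bump \<open>exp (- (1 / w))\<close>, with
  \<open>w = d\<^sup>2 - (t - c)\<^sup>2\<close>, have this shape; multiplication by
  \<open>t\<close> also preserves it.\<close>

definition bump :: "real \<Rightarrow> real \<Rightarrow> real poly \<Rightarrow> nat \<Rightarrow> real \<Rightarrow> real" where
  "bump c d p k t = (if \<bar>t - c\<bar> < d
     then poly p t / (d\<^sup>2 - (t - c)\<^sup>2) ^ k * exp (- (1 / (d\<^sup>2 - (t - c)\<^sup>2))) else 0)"

lemma bump_width_pos: "\<bar>t - c\<bar> < d \<Longrightarrow> d\<^sup>2 - (t - c)\<^sup>2 > (0::real)"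
  using power_strict_mono[of "\<bar>t - c\<bar>" d 2] by simp

text \<open>The exponential beats \<open>w ^ k\<close> with two powers to spare. The remaining
  \<open>w\<^sup>2\<close> is bounded on the support, and at most a multiple of the squared distance
  to any outside point \<open>s\<close>, as needed for a zero derivative at the edge.\<close>

lemma bump_bound:
  assumes d: "d > 0"
  obtains C where "\<And>t. \<bar>bump c d p k t\<bar> \<le> C"
    "\<And>s t. \<bar>s - c\<bar> \<ge> d \<Longrightarrow> \<bar>bump c d p k t\<bar> \<le> C * (t - s)\<^sup>2"
proof -
  have "compact (poly p ` {c - d..c + d})" by (intro compact_continuous_image continuous_intros) auto
  then obtain M where M: "\<And>t. t \<in> {c - d..c + d} \<Longrightarrow> \<bar>poly p t\<bar> \<le> M"
    using compact_imp_bounded by (force simp: bounded_iff)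
  have M0: "M \<ge> 0" using M[of c] d by auto
  define C where "C = M * fact (k + 2)"
  have C0: "C \<ge> 0" using M0 by (simp add: C_def)
  have main: "\<bar>bump c d p k t\<bar> \<le> C * (d\<^sup>2 - (t - c)\<^sup>2)\<^sup>2" if t: "\<bar>t - c\<bar> < d" for t
  proof -
    define w where "w = d\<^sup>2 - (t - c)\<^sup>2"
    have w: "w > 0" using bump_width_pos[OF t] by (simp add: w_def)
    have "\<bar>bump c d p k t\<bar> = \<bar>poly p t\<bar> / w ^ k * exp (- (1 / w))"
      using t w by (simp add: bump_def w_def abs_mult)
    also have "\<dots> \<le> M / w ^ k * (fact (k + 2) * w ^ (k + 2))"
      using w M[of t] M0 abs_less_iff[of "t - c" d] t by (intro mult_mono divide_right_mono exp_minus_inverse_le) auto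
    also have "\<dots> = C * w\<^sup>2" using w by (simp add: C_def power_add power2_eq_square)
    finally show ?thesis by (simp add: w_def)
  qed
  show ?thesis
  \<comment> \<open>The first summand covers \<open>w \<le> d\<^sup>2\<close>, the second
    \<open>w \<le> 2 * d * \<bar>t - s\<bar>\<close>; one constant serves both bounds.\<close>
  proof (rule that[of "C * (d\<^sup>2)\<^sup>2 + C * (2 * d)\<^sup>2"])
    fix t
    show "\<bar>bump c d p k t\<bar> \<le> C * (d\<^sup>2)\<^sup>2 + C * (2 * d)\<^sup>2"
    proof (cases "\<bar>t - c\<bar> < d")
      case True
      have "(d\<^sup>2 - (t - c)\<^sup>2)\<^sup>2 \<le> (d\<^sup>2)\<^sup>2"
        using bump_width_pos[OF True] by (intro power_mono) auto
      then have "C * (d\<^sup>2 - (t - c)\<^sup>2)\<^sup>2 \<le> C * (d\<^sup>2)\<^sup>2" using C0 by (rule mult_left_mono)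
      moreover have "C * (2 * d)\<^sup>2 \<ge> 0" using C0 by simp
      ultimately show ?thesis using main[OF True] by linarith
    next
      case False
      then show ?thesis using C0 by (simp add: bump_def)
    qed
    fix s assume s: "\<bar>s - c\<bar> \<ge> d"
    show "\<bar>bump c d p k t\<bar> \<le> (C * (d\<^sup>2)\<^sup>2 + C * (2 * d)\<^sup>2) * (t - s)\<^sup>2"
    proof (cases "\<bar>t - c\<bar> < d")
      case True
      have "d\<^sup>2 - (t - c)\<^sup>2 = (d + \<bar>t - c\<bar>) * (d - \<bar>t - c\<bar>)"
        by (simp add: algebra_simps power2_eq_square)
      also have "\<dots> \<le> (2 * d) * \<bar>t - s\<bar>"
        using True s by (intro mult_mono) auto
      finally have "(d\<^sup>2 - (t - c)\<^sup>2)\<^sup>2 \<le> ((2 * d) * \<bar>t - s\<bar>)\<^sup>2"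
        using bump_width_pos[OF True] by (intro power_mono) auto
      then have "C * (d\<^sup>2 - (t - c)\<^sup>2)\<^sup>2 \<le> C * ((2 * d) * \<bar>t - s\<bar>)\<^sup>2" using C0 by (rule mult_left_mono)
      also have "\<dots> = C * (2 * d)\<^sup>2 * (t - s)\<^sup>2" by (simp add: power_mult_distrib)
      also have "\<dots> \<le> (C * (d\<^sup>2)\<^sup>2 + C * (2 * d)\<^sup>2) * (t - s)\<^sup>2" using C0 by (intro mult_right_mono) auto
      finally show ?thesis using main[OF True] by linarith
    next
      case False
      then show ?thesis using C0 by (simp add: bump_def)
    qed
  qed
qed

text \<open>Quotient rule: \<open>[:d\<^sup>2 - c\<^sup>2, 2 * c, -1:]\<close> is \<open>w\<close>
  as a polynomial and \<open>[:-c, 1:]\<close> is \<open>t - c\<close>. The exponent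
  \<open>k + 2\<close> is the common denominator for the derivatives of \<open>1 / w ^ k\<close> and
  of the exponential.\<close>

lemma bump_has_derivative:
  assumes d: "d > 0"
  shows "(bump c d p k has_real_derivative
    bump c d (pderiv p * [:d\<^sup>2 - c\<^sup>2, 2 * c, -1:] ^ 2 + [:-c, 1:] * p * (smult (2 * real k) [:d\<^sup>2 - c\<^sup>2, 2 * c, -1:] - [:2:]))
      (k + 2) t) (at t)" (is "(_ has_real_derivative bump c d ?q _ _) _")
proof (cases "\<bar>t - c\<bar> < d")
  case True
  define w where "w = (\<lambda>t. d\<^sup>2 - (t - c)\<^sup>2)"
  have wt: "w t > 0" using bump_width_pos[OF True] by (simp add: w_def)
  have W: "poly [:d\<^sup>2 - c\<^sup>2, 2 * c, -1:] t = w t" for t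
    by (simp add: w_def power2_eq_square algebra_simps)
  have dw: "(w has_real_derivative (- 2 * (t - c))) (at t)"
    unfolding w_def by (auto intro!: derivative_eq_intros)
  have "((\<lambda>t. poly p t * inverse (w t) ^ k * exp (- inverse (w t))) has_real_derivative
      ((poly (pderiv p) t * inverse (w t) ^ k + poly p t * (real k * inverse (w t) ^ (k - 1) * (2 * (t - c) * inverse (w t) ^ 2))) * exp (- inverse (w t))
       + poly p t * inverse (w t) ^ k * (exp (- inverse (w t)) * (- 2 * (t - c) * inverse (w t) ^ 2)))) (at t)"
    using wt by (auto intro!: derivative_eq_intros dw poly_DERIV simp: power2_eq_square algebra_simps)
  moreover have "(poly (pderiv p) t * inverse (w t) ^ k + poly p t * (real k * inverse (w t) ^ (k - 1) * (2 * (t - c) * inverse (w t) ^ 2))) * exp (- inverse (w t))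
       + poly p t * inverse (w t) ^ k * (exp (- inverse (w t)) * (- 2 * (t - c) * inverse (w t) ^ 2)) = bump c d ?q (k + 2) t"
  proof -
    have k: "real k * inverse (w t) ^ (k - 1) = real k * (inverse (w t) ^ k * w t)"
      using wt by (cases k) auto
    have q: "poly ?q t = poly (pderiv p) t * (w t)\<^sup>2 + (t - c) * poly p t * (2 * real k * w t - 2)"
      by (simp only: poly_add poly_mult poly_power poly_diff poly_smult W) simp
    have b: "bump c d q (k + 2) t = poly q t * (inverse (w t) ^ k * inverse (w t) ^ 2) * exp (- inverse (w t))" for q
    proof -
      have "bump c d q (k + 2) t = poly q t / w t ^ (k + 2) * exp (- (1 / w t))"
        using True by (simp add: bump_def w_def)
      then show ?thesis by (simp add: divide_inverse power_inverse power_add power2_eq_square)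
    qed
    have alg: "(A * Ik + P * (r * (Ik * v) * (2 * s * I ^ 2))) * E + P * Ik * (E * (- 2 * s * I ^ 2))
      = (A * v ^ 2 + s * P * (2 * r * v - 2)) * (Ik * I ^ 2) * E" if "v * I = 1" for A Ik P r v s I E :: real
      using that by algebra
    show ?thesis unfolding k b q by (rule alg) (use wt in simp)
  qed
  ultimately have "((\<lambda>t. poly p t * inverse (w t) ^ k * exp (- inverse (w t))) has_real_derivative bump c d ?q (k + 2) t) (at t)"
    by simp
  moreover have "open {t. \<bar>t - c\<bar> < d}" by (intro open_Collect_less continuous_intros)
  ultimately show ?thesis
    by (rule has_field_derivative_transform_within_open)
      (use True in \<open>auto simp: bump_def w_def divide_inverse power_inverse\<close>)
next
  case False
  obtain C where C: "\<And>t. \<bar>bump c d p k t\<bar> \<le> C"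
    "\<And>s t. \<bar>s - c\<bar> \<ge> d \<Longrightarrow> \<bar>bump c d p k t\<bar> \<le> C * (t - s)\<^sup>2"
    using bump_bound[OF d] by blast
  \<comment> \<open>At the edge and outside, the value is 0 and the quadratic bound squeezes the
    difference quotient.\<close>
  have "((\<lambda>y. (bump c d p k y - bump c d p k t) / (y - t)) \<longlongrightarrow> 0) (at t)"
  proof (rule Lim_null_comparison)
    show "((\<lambda>y. C * \<bar>y - t\<bar>) \<longlongrightarrow> 0) (at t)" by (auto intro!: tendsto_eq_intros)
    have "norm ((bump c d p k y - bump c d p k t) / (y - t)) \<le> C * \<bar>y - t\<bar>" if "y \<noteq> t" for y
    proof -
      have "\<bar>bump c d p k y\<bar> \<le> C * \<bar>y - t\<bar> * \<bar>y - t\<bar>"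
        using C(2)[of t y] False by (simp add: power2_eq_square abs_mult[symmetric] mult.assoc)
      then show ?thesis using False that by (simp add: bump_def[of _ _ _ _ t] abs_divide divide_le_eq)
    qed
    then show "\<forall>\<^sub>F y in at t. norm ((bump c d p k y - bump c d p k t) / (y - t)) \<le> C * \<bar>y - t\<bar>"
      by (simp add: eventually_at_filter)
  qed
  then show ?thesis using False by (simp add: has_field_derivative_iff bump_def[of _ _ _ _ t])
qed

lemma schwartz_function_bump:
  assumes d: "d > 0" shows "schwartz_function (\<lambda>t. complex_of_real (bump c d p k t))"
proof (rule schwartz_closed_imp_schwartz)
  let ?S = "range (\<lambda>(p, k) t. complex_of_real (bump c d p k t))"
  show "(\<lambda>t. complex_of_real (bump c d p k t)) \<in> ?S" by (auto intro: image_eqI[of _ _ "(p, k)"])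
  show "schwartz_closed ?S"
    unfolding schwartz_closed_def
  proof (intro ballI)
    fix H assume "H \<in> ?S"
    then obtain p k where H: "H = (\<lambda>t. complex_of_real (bump c d p k t))" by auto
    note der = bump_has_derivative[OF d, of c p k]
    have "continuous_on UNIV (bump c d p k)"
      using der by (meson DERIV_isCont continuous_at_imp_continuous_on)
    then have 1: "continuous_on UNIV H" unfolding H by (intro continuous_intros)
    obtain C where "\<And>t. \<bar>bump c d p k t\<bar> \<le> C" using bump_bound[OF d, of c p k] by metis
    then have 2: "bounded (range H)" by (auto simp: bounded_iff H)
    have "complex_of_real x * complex_of_real (bump c d p k x) = of_real (bump c d ([:0, 1:] * p) k x)" for x
      by (simp add: bump_def)
    then have 3: "(\<lambda>x. of_real (x \<bullet> 1) * H x) \<in> ?S"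
      by (auto simp: H intro: image_eqI[of _ _ "([:0, 1:] * p, k)"])
    obtain q l where ql: "\<And>t. (bump c d p k has_real_derivative bump c d q l t) (at t)"
      by (rule that[OF der])
    have "((\<lambda>t. H (x + t *\<^sub>R 1)) has_vector_derivative of_real (bump c d q l x)) (at 0)" for x
    proof -
      have "((\<lambda>t. bump c d p k (t + x)) has_real_derivative bump c d q l x) (at 0)"
        using ql[of x] by (subst DERIV_shift[symmetric]) simp
      from has_vector_derivative_of_real[OF this] show ?thesis by (simp add: H add.commute)
    qed
    moreover have "(\<lambda>t. complex_of_real (bump c d q l t)) \<in> ?S" by (auto intro: image_eqI[of _ _ "(q, l)"])
    ultimately have "\<exists>F'\<in>?S. \<forall>x. ((\<lambda>t. H (x + t *\<^sub>R 1)) has_vector_derivative F' x) (at 0)"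
      by (intro bexI[of _ "\<lambda>t. complex_of_real (bump c d q l t)"] allI)
    with 1 2 3 show "continuous_on UNIV H \<and> bounded (range H) \<and> (\<forall>b\<in>Basis. (\<lambda>x. of_real (x \<bullet> b) * H x) \<in> ?S \<and>
        (\<exists>F'\<in>?S. \<forall>x. ((\<lambda>t. H (x + t *\<^sub>R b)) has_vector_derivative F' x) (at 0)))"
      by simp
  qed
qed

text \<open>A product of one-variable bumps, so that the support is a cube and fits the boxes used
  for integration.\<close>

lemma schwartz_bump_exists:
  fixes a :: "real ^ 'n"
  assumes "d > 0"
  obtains \<phi> :: "real ^ 'n \<Rightarrow> real" where "schwartz_function (\<lambda>x. complex_of_real (\<phi> x))"
    "\<And>x. \<phi> x \<ge> 0" "\<And>x. \<phi> x \<noteq> 0 \<longleftrightarrow> (\<forall>i. \<bar>x $ i - a $ i\<bar> < d)"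
proof -
  let ?\<phi> = "\<lambda>x. \<Prod>i\<in>UNIV. bump (a $ i) d 1 0 (x $ i)"
  have "schwartz_function (\<lambda>x. \<Prod>i\<in>UNIV. complex_of_real (bump (a $ i) d 1 0 (x $ i)))"
    by (intro schwartz_function_prod schwartz_function_bump assms)
  then have "schwartz_function (\<lambda>x. complex_of_real (?\<phi> x))" by simp
  moreover have "?\<phi> x \<ge> 0" for x by (intro prod_nonneg) (auto simp: bump_def)
  moreover have "?\<phi> x \<noteq> 0 \<longleftrightarrow> (\<forall>i. \<bar>x $ i - a $ i\<bar> < d)" for x by (simp add: bump_def)
  ultimately show ?thesis by (rule that[of ?\<phi>])
qed

section \<open>Integration on Euclidean space\<close>

lemma nn_integral_inverse_square_finite:
  "(\<integral>\<^sup>+x. ennreal (inverse (1 + x\<^sup>2)) \<partial>lborel) < (\<infinity> :: ennreal)"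
proof -
  have "integrable lborel (\<lambda>x::real. inverse (1 + x\<^sup>2))"
    using integrable_inverse_1_plus_square by (simp add: set_integrable_def)
  then show ?thesis by (simp add: integrable_iff_bounded)
qed

text \<open>The majorant is the product of the \<open>1 / (1 + (x \<bullet> b)\<^sup>2)\<close>,
  whose integral splits into one-dimensional ones. The exponent \<open>2 * DIM('e)\<close> arises
  because each \<open>1 + (x \<bullet> b)\<^sup>2\<close> is at most
  \<open>(1 + norm x)\<^sup>2\<close>.\<close>

lemma integrable_decay:
  fixes u :: "'e::euclidean_space \<Rightarrow> 'b::{banach, second_countable_topology}"
  assumes [measurable]: "u \<in> borel_measurable borel"
    and bound: "\<And>x. (1 + norm x) ^ (2 * DIM('e)) * norm (u x) \<le> B"
  shows "integrable lborel u"
proof (rule Bochner_Integration.integrable_bound)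
  let ?g = "\<lambda>x::'e. \<Prod>b\<in>Basis. inverse (1 + (x \<bullet> b)\<^sup>2)"
  have "(\<integral>\<^sup>+x. ennreal (?g x) \<partial>lborel) = (\<Prod>b\<in>(Basis :: 'e set). \<integral>\<^sup>+t. ennreal (inverse (1 + t\<^sup>2)) \<partial>lborel)"
    by (subst nn_integral_lborel_prod[symmetric]) (auto intro!: nn_integral_cong simp: prod_ennreal)
  also have "\<dots> < \<infinity>" using nn_integral_inverse_square_finite by (simp add: less_top[symmetric] power_eq_top_ennreal)
  finally have "integrable lborel ?g"
    by (intro integrableI_nonneg) (auto intro!: prod_nonneg)
  then show "integrable lborel (\<lambda>x. B * ?g x)" by simp
  have "norm (u x) \<le> B * ?g x" for x
  proof -
    have "(\<Prod>b\<in>(Basis :: 'e set). 1 + (x \<bullet> b)\<^sup>2) \<le> (\<Prod>b\<in>(Basis :: 'e set). (1 + norm x)\<^sup>2)"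
    proof (rule prod_mono, safe)
      fix b :: 'e assume "b \<in> Basis"
      then have "(x \<bullet> b)\<^sup>2 \<le> (norm x)\<^sup>2" using Basis_le_norm by (metis abs_le_square_iff abs_norm_cancel)
      then show "1 + (x \<bullet> b)\<^sup>2 \<le> (1 + norm x)\<^sup>2" by (simp add: power2_sum add_increasing2)
    qed (simp add: add_nonneg_nonneg)
    also have "\<dots> = (1 + norm x) ^ (2 * DIM('e))" by (simp add: power_mult)
    finally have "(\<Prod>b\<in>(Basis :: 'e set). 1 + (x \<bullet> b)\<^sup>2) * norm (u x) \<le> B"
      using bound[of x] by (meson mult_right_mono norm_ge_zero order_trans)
    moreover have pos: "(\<Prod>b\<in>(Basis :: 'e set). 1 + (x \<bullet> b)\<^sup>2) > 0"
      by (intro prod_pos) (simp add: add_pos_nonneg)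
    moreover have "?g x = inverse (\<Prod>b\<in>Basis. 1 + (x \<bullet> b)\<^sup>2)"
      using prod_inversef[of "\<lambda>b. 1 + (x \<bullet> b)\<^sup>2" Basis] by (simp add: o_def)
    ultimately show ?thesis by (simp only:) (simp add: divide_inverse[symmetric] le_divide_eq mult.commute)
  qed
  then show "AE x in lborel. norm (u x) \<le> norm (B * ?g x)"
    by (intro AE_I2) (metis abs_ge_self order_trans real_norm_def)
qed simp

lemma lborel_integral_scale:
  fixes f :: "'e::euclidean_space \<Rightarrow> 'b::{banach, second_countable_topology}"
  assumes [measurable]: "f \<in> borel_measurable borel" and c: "c \<noteq> 0"
  shows "(\<integral>x. f (c *\<^sub>R x) \<partial>lborel) = inverse (\<bar>c\<bar> ^ DIM('e)) *\<^sub>R (\<integral>x. f x \<partial>lborel)"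
proof -
  have "(\<integral>x. f x \<partial>lborel) = (\<integral>x. f x \<partial>density (distr lborel borel (\<lambda>x. 0 + c *\<^sub>R x)) (\<lambda>_. ennreal (\<bar>c\<bar> ^ DIM('e))))"
    using lborel_affine[OF c, of "0 :: 'e"] by simp
  also have "\<dots> = (\<integral>x. \<bar>c\<bar> ^ DIM('e) *\<^sub>R f (c *\<^sub>R x) \<partial>lborel)"
    by (subst integral_density) (auto simp: integral_distr)
  finally show ?thesis using c by simp
qed

lemma integrable_lborel_scale:
  fixes f :: "'e::euclidean_space \<Rightarrow> 'b::{banach, second_countable_topology}"
  assumes f: "integrable lborel f" and c: "c \<noteq> 0"
  shows "integrable lborel (\<lambda>x. f (c *\<^sub>R x))"
proof -
  have [measurable]: "f \<in> borel_measurable borel" using borel_measurable_integrable[OF f] by simp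
  have "integrable (density (distr lborel borel (\<lambda>x. 0 + c *\<^sub>R x)) (\<lambda>_. ennreal (\<bar>c\<bar> ^ DIM('e)))) f"
    using f lborel_affine[OF c, of "0 :: 'e"] by simp
  then have "integrable (distr lborel borel (\<lambda>x. 0 + c *\<^sub>R x)) (\<lambda>x. \<bar>c\<bar> ^ DIM('e) *\<^sub>R f x)"
    by (subst (asm) integrable_density) auto
  then have "integrable lborel (\<lambda>x. \<bar>c\<bar> ^ DIM('e) *\<^sub>R f (c *\<^sub>R x))"
    by (subst (asm) integrable_distr_eq) auto
  then have "integrable lborel (\<lambda>x. inverse (\<bar>c\<bar> ^ DIM('e)) *\<^sub>R (\<bar>c\<bar> ^ DIM('e) *\<^sub>R f (c *\<^sub>R x)))"
    by (rule integrable_scaleR_right)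
  then show ?thesis using c by simp
qed

lemma lborel_integral_shift:
  fixes f :: "'e::euclidean_space \<Rightarrow> 'b::{banach, second_countable_topology}"
  assumes [measurable]: "f \<in> borel_measurable borel"
  shows "(\<integral>x. f (x + c) \<partial>lborel) = (\<integral>x. f x \<partial>lborel)"
proof -
  have "(\<integral>x. f x \<partial>lborel) = (\<integral>x. f x \<partial>distr lborel borel ((+) c))" by (simp add: lborel_distr_plus)
  also have "\<dots> = (\<integral>x. f (c + x) \<partial>lborel)" by (subst integral_distr) auto
  finally show ?thesis by (simp add: add.commute)
qed

lemma lborel_integral_pos:
  fixes f :: "'e::euclidean_space \<Rightarrow> real"
  assumes f: "continuous_on UNIV f" "integrable lborel f" and nn: "\<And>x. f x \<ge> 0" and a: "f a > 0"
  shows "(\<integral>x. f x \<partial>lborel) > 0"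
proof -
  have "isCont f a" using f(1) by (simp add: continuous_on_eq_continuous_at)
  then obtain d where d: "d > 0" "\<And>x. dist x a < d \<Longrightarrow> dist (f x) (f a) < f a / 2"
    using a unfolding continuous_at_eps_delta by (metis half_gt_zero)
  have low: "f a / 2 \<le> f x" if "x \<in> ball a d" for x
  proof -
    have "\<bar>f x - f a\<bar> < f a / 2" using d(2)[of x] that by (simp add: dist_real_def dist_commute)
    then show ?thesis by linarith
  qed
  have "0 < f a / 2 * measure lborel (ball a d)" using a content_ball_pos[OF d(1)] by simp
  also have "\<dots> = (\<integral>x. f a / 2 * indicator (ball a d) x \<partial>lborel)" by simp
  also have "\<dots> \<le> (\<integral>x. f x \<partial>lborel)"
  proof (rule integral_mono[OF _ f(2)])
    show "integrable lborel (\<lambda>x. f a / 2 * indicator (ball a d) x)"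
      by (intro integrable_mult_right integrable_real_indicator) (use emeasure_lborel_ball_finite[of a d] in auto)
  qed (use low nn in \<open>auto simp: indicator_def\<close>)
  finally show ?thesis .
qed

lemma schwartz_function_measurable: "schwartz_function u \<Longrightarrow> u \<in> borel_measurable borel"
  by (intro borel_measurable_continuous_onI schwartz_function_continuous)

lemma schwartz_function_integrable: "schwartz_function u \<Longrightarrow> integrable lborel u"
  using schwartz_function_decay[of u] integrable_decay schwartz_function_measurable by metis


section \<open>Additive characters\<close>

locale additive_character =
  fixes \<psi> :: "real \<Rightarrow> complex"
  assumes nontrivial: "nontrivial_additive_character \<psi>"
begin

lemma cont: "continuous_on S \<psi>"
  using nontrivial unfolding nontrivial_additive_character_def by (meson continuous_on_subset subset_UNIV)

lemma norm_1 [simp]: "cmod (\<psi> x) = 1"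
  and plus: "\<psi> (x + y) = \<psi> x * \<psi> y"
  using nontrivial unfolding nontrivial_additive_character_def by auto

lemma nonzero [simp]: "\<psi> x \<noteq> 0" using norm_1[of x] by force

lemma zero [simp]: "\<psi> 0 = 1" using plus[of 0 0] by simp

lemma uminus: "\<psi> (- x) = cnj (\<psi> x)"
proof -
  have "\<psi> x * \<psi> (- x) = \<psi> x * cnj (\<psi> x)"
    using plus[of x "- x"] by (simp add: complex_norm_square[symmetric])
  then show ?thesis by simp
qed

lemma cont_compose [continuous_intros]: "continuous_on S h \<Longrightarrow> continuous_on S (\<lambda>x. \<psi> (h x))"
  using continuous_on_compose2[OF cont[of UNIV]] by auto

lemma measurable [measurable]: "\<psi> \<in> borel_measurable borel"
  by (intro borel_measurable_continuous_onI cont)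

text \<open>
  With \<open>\<Psi>\<close> a primitive of \<open>\<psi>\<close> and \<open>\<Psi> h \<noteq> \<Psi> 0\<close>, the identity \<open>\<Psi> (x + h) - \<Psi> x = \<psi> x (\<Psi> h - \<Psi> 0)\<close>
  shows that \<open>\<psi>\<close> is differentiable.
\<close>

lemma differentiable_at_0: "\<exists>\<alpha>. (\<psi> has_vector_derivative \<alpha>) (at 0)"
proof -
  \<comment> \<open>The interval from -2 to 2 leaves room for \<open>x + h\<close> with
    \<open>\<bar>x\<bar> < 1\<close> and \<open>0 < h < 1\<close>.\<close>
  obtain \<Psi> where \<Psi>0: "\<And>x. x \<in> {-2..2} \<Longrightarrow> (\<Psi> has_vector_derivative \<psi> x) (at x within {-2..2})"
    using antiderivative_continuous[OF cont] by blast
  have \<Psi>: "(\<Psi> has_vector_derivative \<psi> x) (at x)" if "-2 < x" "x < 2" for x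
    using \<Psi>0[of x] that by (simp add: at_within_Icc_at)
  have shift: "\<Psi> (x + h) - \<psi> x * \<Psi> h = \<Psi> x - \<psi> x * \<Psi> 0" if x: "-1 < x" "x < 1" and h: "0 < h" "h < 1" for x h
  proof -
    \<comment> \<open>Multiplicativity of \<open>\<psi>\<close> makes the two derivatives in
      \<open>h\<close> cancel, so the difference is constant and may be evaluated at 0.\<close>
    have "((\<lambda>h. \<Psi> (x + h) - \<psi> x * \<Psi> h) has_vector_derivative 0) (at t within {0..h})" if "t \<in> {0..h}" for t
    proof -
      have "((\<Psi> \<circ> (\<lambda>h. x + h)) has_vector_derivative 1 *\<^sub>R \<psi> (x + t)) (at t)"
        using x h that by (intro vector_diff_chain_at \<Psi>) (auto intro!: derivative_eq_intros)
      moreover have "((\<lambda>h. \<psi> x * \<Psi> h) has_vector_derivative \<psi> x * \<psi> t) (at t)"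
        using h that by (intro has_vector_derivative_mult_right \<Psi>) auto
      ultimately have "((\<lambda>h. \<Psi> (x + h) - \<psi> x * \<Psi> h) has_vector_derivative 1 *\<^sub>R \<psi> (x + t) - \<psi> x * \<psi> t) (at t)"
        unfolding o_def by (rule has_vector_derivative_diff)
      then show ?thesis by (simp add: plus has_vector_derivative_at_within)
    qed
    then obtain c where "\<And>t. t \<in> {0..h} \<Longrightarrow> \<Psi> (x + t) - \<psi> x * \<Psi> t = c"
      by (rule has_vector_derivative_zero_constant[of "{0..h}" "\<lambda>h. \<Psi> (x + h) - \<psi> x * \<Psi> h", rotated]) auto
    from this[of h] this[of 0] h show ?thesis by simp
  qed
  \<comment> \<open>Were \<open>\<Psi>\<close> equal to \<open>\<Psi> 0\<close> on the whole
    interval from 0 to 1, its derivative \<open>\<psi> (1/2)\<close> would vanish, against absolute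
    value 1.\<close>
  obtain h where h: "0 < h" "h < 1" "\<Psi> h \<noteq> \<Psi> 0"
  proof (rule ccontr)
    assume "\<not> thesis"
    with that have *: "\<And>h. 0 < h \<Longrightarrow> h < 1 \<Longrightarrow> \<Psi> h = \<Psi> 0" by blast
    have "((\<lambda>_. \<Psi> 0) has_vector_derivative \<psi> (1/2)) (at (1/2))"
      by (rule has_vector_derivative_transform_within_open[OF \<Psi>, of _ "{0<..<1}"]) (auto simp: *)
    moreover have "((\<lambda>_. \<Psi> 0) has_vector_derivative 0) (at (1/2))" by simp
    ultimately have "\<psi> (1/2) = 0" by (rule vector_derivative_unique_at)
    then show False by simp
  qed
  have "((\<lambda>x. (\<Psi> (x + h) - \<Psi> x) * (1 / (\<Psi> h - \<Psi> 0))) has_vector_derivative (\<psi> (0 + h) - \<psi> 0) * (1 / (\<Psi> h - \<Psi> 0))) (at 0)"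
  proof (intro has_vector_derivative_mult_left has_vector_derivative_diff)
    have "((\<Psi> \<circ> (\<lambda>x. x + h)) has_vector_derivative 1 *\<^sub>R \<psi> (0 + h)) (at 0)"
      using h by (intro vector_diff_chain_at \<Psi>) (auto intro!: derivative_eq_intros)
    then show "((\<lambda>x. \<Psi> (x + h)) has_vector_derivative \<psi> (0 + h)) (at 0)" by (simp add: o_def)
  qed (use \<Psi>[of 0] in simp)
  then have "(\<psi> has_vector_derivative (\<psi> (0 + h) - \<psi> 0) * (1 / (\<Psi> h - \<Psi> 0))) (at 0)"
  proof (rule has_vector_derivative_transform_within_open[of _ _ _ "{-1<..<1}"])
    fix x :: real assume "x \<in> {-1<..<1}"
    then have "\<Psi> (x + h) - \<Psi> x = \<psi> x * (\<Psi> h - \<Psi> 0)" using shift[of x h] h by (simp add: algebra_simps)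
    then show "(\<Psi> (x + h) - \<Psi> x) * (1 / (\<Psi> h - \<Psi> 0)) = \<psi> x" using h by simp
  qed auto
  then show ?thesis by blast
qed

text \<open>The constant with \<open>\<psi>' = \<alpha> \<psi>\<close>, so that
  \<open>\<psi> x = exp (\<alpha> x)\<close>; it takes the place of the usual factor 2 pi i in the
  rules for the Fourier transform.\<close>

definition \<alpha> :: complex where "\<alpha> = (SOME \<alpha>. (\<psi> has_vector_derivative \<alpha>) (at 0))"

lemma deriv_0: "(\<psi> has_vector_derivative \<alpha>) (at 0)"
  unfolding \<alpha>_def by (rule someI_ex[OF differentiable_at_0])

lemma deriv: "(\<psi> has_vector_derivative \<alpha> * \<psi> x) (at x)"
proof -
  have "((\<lambda>t. \<psi> x * \<psi> (t - x)) has_vector_derivative \<psi> x * \<alpha>) (at x)"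
  proof (rule has_vector_derivative_mult_right)
    have "((\<psi> \<circ> (\<lambda>t. t - x)) has_vector_derivative 1 *\<^sub>R \<alpha>) (at x)"
      using deriv_0 by (intro vector_diff_chain_at) (auto intro!: derivative_eq_intros)
    then show "((\<lambda>t. \<psi> (t - x)) has_vector_derivative \<alpha>) (at x)" by (simp add: o_def)
  qed
  moreover have "(\<lambda>t. \<psi> x * \<psi> (t - x)) = \<psi>" by (simp add: plus[symmetric])
  ultimately show ?thesis by (simp add: mult.commute)
qed

lemma \<alpha>_nonzero: "\<alpha> \<noteq> 0"
proof
  assume "\<alpha> = 0"
  then have "(\<psi> has_vector_derivative 0) (at x within UNIV)" for x using deriv[of x] by simp
  then obtain c where "\<And>x. x \<in> UNIV \<Longrightarrow> \<psi> x = c"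
    by (rule has_vector_derivative_zero_constant[of UNIV \<psi>, rotated]) auto
  then have "\<psi> x = 1" for x using zero by (metis UNIV_I)
  then show False using nontrivial by (simp add: nontrivial_additive_character_def)
qed

text \<open>The derivative of \<open>\<psi>\<close> has constant absolute value
  \<open>cmod \<alpha>\<close>. The bound yields the majorant for differentiating the Fourier
  transform under the integral sign.\<close>

lemma lipschitz: "cmod (\<psi> x - 1) \<le> cmod \<alpha> * \<bar>x\<bar>"
proof -
  have "norm (\<psi> x - \<psi> 0) \<le> cmod \<alpha> * norm (x - 0)"
  proof (rule differentiable_bound[OF convex_UNIV])
    show "(\<psi> has_derivative (\<lambda>h. h *\<^sub>R (\<alpha> * \<psi> t))) (at t within UNIV)" for t
      using deriv[of t] by (simp add: has_vector_derivative_def)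
    show "onorm (\<lambda>h. h *\<^sub>R (\<alpha> * \<psi> t)) \<le> cmod \<alpha>" for t
      by (rule onorm_le) (simp add: norm_mult)
  qed auto
  then show ?thesis by simp
qed

lemma additive_character_dilate:
  assumes "a \<noteq> 0" shows "nontrivial_additive_character (dilate \<psi> a)"
  unfolding nontrivial_additive_character_def dilate_def
proof (intro conjI allI)
  obtain x where "\<psi> x \<noteq> 1" using nontrivial by (auto simp: nontrivial_additive_character_def)
  then show "\<exists>x. \<psi> (a * x) \<noteq> 1" using assms by (intro exI[of _ "x / a"]) simp
qed (auto intro!: continuous_intros simp: distrib_left plus)

end


section \<open>Fourier transform of Schwartz functions\<close>

context additive_character
begin

abbreviation FT :: "(real ^ 'n \<Rightarrow> complex) \<Rightarrow> real ^ 'n \<Rightarrow> complex" where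
  "FT \<equiv> fourier_scalar \<psi>"

lemma FT_integrable:
  fixes u :: "real ^ 'n \<Rightarrow> complex"
  assumes "integrable lborel u" shows "integrable lborel (\<lambda>x. u x * \<psi> (y \<bullet> x))"
  by (rule Bochner_Integration.integrable_bound[OF assms]) (use assms in \<open>auto simp: norm_mult\<close>)

lemma FT_bound:
  fixes u :: "real ^ 'n \<Rightarrow> complex"
  shows "cmod (FT u y) \<le> (\<integral>x. cmod (u x) \<partial>lborel)"
proof -
  have "cmod (FT u y) \<le> (\<integral>x. cmod (u x * \<psi> (y \<bullet> x)) \<partial>lborel)"
    unfolding fourier_scalar_def by (rule integral_norm_bound)
  then show ?thesis by (simp add: norm_mult)
qed

lemma FT_continuous:
  fixes u :: "real ^ 'n \<Rightarrow> complex"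
  assumes u: "integrable lborel u" shows "continuous_on UNIV (FT u)"
  unfolding continuous_on_sequentially
proof (intro allI ballI impI, elim conjE)
  fix X :: "nat \<Rightarrow> real ^ 'n" and y assume X: "X \<longlonglongrightarrow> y"
  have [measurable]: "u \<in> borel_measurable lborel" using u by auto
  have "(\<lambda>n. \<integral>x. u x * \<psi> (X n \<bullet> x) \<partial>lborel) \<longlonglongrightarrow> (\<integral>x. u x * \<psi> (y \<bullet> x) \<partial>lborel)"
  proof (rule integral_dominated_convergence[where w = "\<lambda>x. cmod (u x)"])
    have "(\<lambda>n. \<psi> (X n \<bullet> x)) \<longlonglongrightarrow> \<psi> (y \<bullet> x)" for x
      using cont[of UNIV] by (intro continuous_on_tendsto_compose[of UNIV \<psi>] tendsto_intros X) auto
    then show "AE x in lborel. (\<lambda>n. u x * \<psi> (X n \<bullet> x)) \<longlonglongrightarrow> u x * \<psi> (y \<bullet> x)"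
      by (intro AE_I2 tendsto_intros)
  qed (use u in \<open>auto simp: norm_mult\<close>)
  then show "(FT u \<circ> X) \<longlonglongrightarrow> FT u y" by (simp add: o_def fourier_scalar_def)
qed

lemma FT_scale:
  fixes u :: "real ^ 'n \<Rightarrow> complex"
  shows "FT (\<lambda>x. c * u x) y = c * FT u y"
  by (simp add: fourier_scalar_def mult.assoc)

text \<open>Dominated convergence for the difference quotients of the character; by the Lipschitz
  bound the second integrability assumption provides the majorant.\<close>

lemma FT_deriv:
  fixes u :: "real ^ 'n \<Rightarrow> complex"
  assumes u: "integrable lborel u" "integrable lborel (\<lambda>x. of_real (x \<bullet> b) * u x)"
  shows "((\<lambda>t. FT u (y + t *\<^sub>R b)) has_vector_derivative FT (\<lambda>x. \<alpha> * (of_real (x \<bullet> b) * u x)) y) (at 0)"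
  unfolding has_vector_derivative_iff_quotient tendsto_at_iff_sequentially
proof (intro allI impI)
  fix X :: "nat \<Rightarrow> real" assume X: "\<forall>i. X i \<in> UNIV - {0}" "X \<longlonglongrightarrow> 0"
  have [measurable]: "u \<in> borel_measurable lborel" using u by auto
  define q where "q = (\<lambda>n x. u x * \<psi> (y \<bullet> x) * ((\<psi> (X n * (b \<bullet> x)) - 1) / X n))"
  have "(\<lambda>n. \<integral>x. q n x \<partial>lborel) \<longlonglongrightarrow> (\<integral>x. \<alpha> * (of_real (x \<bullet> b) * u x) * \<psi> (y \<bullet> x) \<partial>lborel)"
  proof (rule integral_dominated_convergence[where w = "\<lambda>x. cmod \<alpha> * cmod (of_real (x \<bullet> b) * u x)"])
    show "integrable lborel (\<lambda>x. cmod \<alpha> * cmod (of_real (x \<bullet> b) * u x))"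
      using u(2) by (intro integrable_mult_right integrable_norm)
    have "cmod (q n x) \<le> cmod \<alpha> * cmod (of_real (x \<bullet> b) * u x)" for n x
    proof -
      have "cmod ((\<psi> (X n * (b \<bullet> x)) - 1) / X n) \<le> cmod \<alpha> * \<bar>b \<bullet> x\<bar>"
        using lipschitz[of "X n * (b \<bullet> x)"] X(1)[rule_format, of n]
        by (simp add: norm_divide divide_le_eq abs_mult mult_ac)
      then have "cmod (u x) * cmod ((\<psi> (X n * (b \<bullet> x)) - 1) / X n) \<le> cmod (u x) * (cmod \<alpha> * \<bar>b \<bullet> x\<bar>)"
        by (rule mult_left_mono) simp
      then show ?thesis by (simp add: q_def norm_mult norm_divide inner_commute mult_ac)
    qed
    then show "AE x in lborel. cmod (q n x) \<le> cmod \<alpha> * cmod (of_real (x \<bullet> b) * u x)" for n by simp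
    have "(\<lambda>n. (\<psi> (X n * (b \<bullet> x)) - 1) / X n) \<longlonglongrightarrow> \<alpha> * of_real (b \<bullet> x)" for x
    proof -
      have "((\<psi> \<circ> (\<lambda>t. t * (b \<bullet> x))) has_vector_derivative (b \<bullet> x) *\<^sub>R (\<alpha> * \<psi> (0 * (b \<bullet> x)))) (at 0)"
        by (intro vector_diff_chain_at deriv) (auto intro!: derivative_eq_intros)
      then have "((\<lambda>t. \<psi> (t * (b \<bullet> x))) has_vector_derivative \<alpha> * of_real (b \<bullet> x)) (at 0)"
        by (simp add: o_def scaleR_conv_of_real mult.commute)
      then have "((\<lambda>t. (1 / t) *\<^sub>R (\<psi> (t * (b \<bullet> x)) - \<psi> (0 * (b \<bullet> x))) - \<alpha> * of_real (b \<bullet> x)) \<circ> X) \<longlonglongrightarrow> 0"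
        using X unfolding has_vector_derivative_iff_quotient tendsto_at_iff_sequentially by blast
      then have "(\<lambda>n. (\<psi> (X n * (b \<bullet> x)) - 1) / X n - \<alpha> * of_real (b \<bullet> x)) \<longlonglongrightarrow> 0"
        by (simp add: o_def scaleR_conv_of_real)
      then show ?thesis by (rule LIM_zero_cancel)
    qed
    then have "(\<lambda>n. q n x) \<longlonglongrightarrow> u x * \<psi> (y \<bullet> x) * (\<alpha> * of_real (b \<bullet> x))" for x
      unfolding q_def by (intro tendsto_intros)
    then show "AE x in lborel. (\<lambda>n. q n x) \<longlonglongrightarrow> \<alpha> * (of_real (x \<bullet> b) * u x) * \<psi> (y \<bullet> x)"
      by (simp add: inner_commute mult_ac)
  qed (auto simp: q_def)
  moreover have "(\<integral>x. q n x \<partial>lborel) = (1 / X n) *\<^sub>R (FT u (y + X n *\<^sub>R b) - FT u y)" for n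
  proof -
    have "q n x = (1 / X n) *\<^sub>R (u x * \<psi> ((y + X n *\<^sub>R b) \<bullet> x) - u x * \<psi> (y \<bullet> x))" for x
      by (simp add: q_def inner_add_left plus scaleR_conv_of_real[where 'a = complex] diff_divide_distrib right_diff_distrib mult_ac)
    then show ?thesis
      unfolding fourier_scalar_def using FT_integrable[OF u(1)] by simp
  qed
  ultimately have "(\<lambda>n. (1 / X n) *\<^sub>R (FT u (y + X n *\<^sub>R b) - FT u y)) \<longlonglongrightarrow> FT (\<lambda>x. \<alpha> * (of_real (x \<bullet> b) * u x)) y"
    by (simp add: fourier_scalar_def)
  then show "((\<lambda>t. (1 / t) *\<^sub>R (FT u (y + t *\<^sub>R b) - FT u (y + 0 *\<^sub>R b)) - FT (\<lambda>x. \<alpha> * (of_real (x \<bullet> b) * u x)) y) \<circ> X) \<longlonglongrightarrow> 0"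
    by (simp add: o_def LIM_zero)
qed

text \<open>
  Integration by parts: both sides are the derivative at \<open>t = 0\<close> of
  \<open>\<integral>u(x + t b) \<psi>(y \<bullet> x) dx = \<psi>(- t (y \<bullet> b)) FT u y\<close>.
\<close>

lemma FT_of_deriv:
  fixes u :: "real ^ 'n \<Rightarrow> complex"
  assumes u: "schwartz_function u" and u': "schwartz_function u'"
    and der: "\<And>x. ((\<lambda>t. u (x + t *\<^sub>R b)) has_vector_derivative u' x) (at 0)" and b: "norm b = 1"
  shows "FT u' y = - \<alpha> * of_real (y \<bullet> b) * FT u y"
proof -
  define X where "X = (\<lambda>n. inverse (real (Suc n)))"
  have X: "X n > 0" "X n \<le> 1" "X \<longlonglongrightarrow> 0" for n
    unfolding X_def using LIMSEQ_inverse_real_of_nat by (auto simp: inverse_le_1_iff)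
  have X': "\<forall>i. X i \<in> UNIV - {0}" using X(1) by (simp add: less_imp_neq[symmetric])
  note [measurable] = schwartz_function_measurable[OF u] schwartz_function_measurable[OF u']
  define N where "N = 2 * CARD('n)"
  obtain B where B: "\<And>x. (1 + norm x) ^ N * cmod (u' x) \<le> B" using schwartz_function_decay[OF u'] by blast
  have B0: "B \<ge> 0" using B[of 0] by (simp add: order_trans[OF norm_ge_zero])
  have der': "((\<lambda>t. u (x + t *\<^sub>R b)) has_vector_derivative u' (x + s *\<^sub>R b)) (at s)" for x s
  proof -
    have "(((\<lambda>t. u (x + s *\<^sub>R b + t *\<^sub>R b)) \<circ> (\<lambda>t. t - s)) has_vector_derivative 1 *\<^sub>R u' (x + s *\<^sub>R b)) (at s)"
      using der[of "x + s *\<^sub>R b"] by (intro vector_diff_chain_at) (auto intro!: derivative_eq_intros)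
    moreover have "(\<lambda>t. u (x + s *\<^sub>R b + t *\<^sub>R b)) \<circ> (\<lambda>t. t - s) = (\<lambda>t. u (x + t *\<^sub>R b))"
      by (auto simp: o_def algebra_simps)
    ultimately show ?thesis by simp
  qed
  \<comment> \<open>Majorant for the difference quotients of \<open>u\<close>: by the mean value
    inequality they are bounded by values of \<open>u'\<close> at distance at most 1, and this shift
    costs at most a factor \<open>2 ^ N\<close> in the decay.\<close>
  define w where "w = (\<lambda>x :: real ^ 'n. B * 2 ^ N * inverse ((1 + norm x) ^ N))"
  have pos: "(1 + norm x) ^ N > 0" for x :: "real ^ 'n"
    by (intro zero_less_power add_pos_nonneg) auto
  have w: "integrable lborel w"
  proof (rule integrable_decay)
    show "w \<in> borel_measurable borel" unfolding w_def by measurable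
    show "(1 + norm x) ^ (2 * DIM(real ^ 'n)) * norm (w x) \<le> B * 2 ^ N" for x
    proof -
      have "(1 + norm x) ^ (2 * DIM(real ^ 'n)) * norm (w x) = ((1 + norm x) ^ N * inverse ((1 + norm x) ^ N)) * (B * 2 ^ N)"
        using B0 by (simp add: w_def abs_mult N_def)
      also have "(1 + norm x) ^ N * inverse ((1 + norm x) ^ N) = 1" by (rule right_inverse[OF less_imp_neq[OF pos, symmetric]])
      finally show ?thesis by simp
    qed
  qed
  have arith: "1 + a \<le> 2 * (1 + c)" if "a \<le> c + d" "d \<le> 1" "0 \<le> c" for a c d :: real
    using that by (simp add: distrib_left)
  have bound: "cmod ((1 / X n) *\<^sub>R (u (x + X n *\<^sub>R b) - u x)) \<le> w x" for n x
  proof -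
    have "norm (u (x + X n *\<^sub>R b) - u (x + 0 *\<^sub>R b)) \<le> w x * norm (X n - 0)"
    proof (rule differentiable_bound[of "{0..X n}" "\<lambda>t. u (x + t *\<^sub>R b)" "\<lambda>s h. h *\<^sub>R u' (x + s *\<^sub>R b)"])
      fix s assume s: "s \<in> {0..X n}"
      show "((\<lambda>t. u (x + t *\<^sub>R b)) has_derivative (\<lambda>h. h *\<^sub>R u' (x + s *\<^sub>R b))) (at s within {0..X n})"
        using der'[of x s] unfolding has_vector_derivative_def by (rule has_derivative_at_withinI)
      have "norm x \<le> norm (x + s *\<^sub>R b) + norm (s *\<^sub>R b)" by (metis add_diff_cancel_right' norm_triangle_ineq4)
      moreover have "norm (s *\<^sub>R b) \<le> 1" using s X(2)[of n] b by simp
      ultimately have "1 + norm x \<le> 2 * (1 + norm (x + s *\<^sub>R b))"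
        by (intro arith) auto
      then have "(1 + norm x) ^ N \<le> 2 ^ N * (1 + norm (x + s *\<^sub>R b)) ^ N"
        unfolding power_mult_distrib[symmetric] by (intro power_mono) auto
      then have "(1 + norm x) ^ N * cmod (u' (x + s *\<^sub>R b)) \<le> 2 ^ N * (1 + norm (x + s *\<^sub>R b)) ^ N * cmod (u' (x + s *\<^sub>R b))"
        by (rule mult_right_mono) simp
      also have "\<dots> \<le> 2 ^ N * B" using B[of "x + s *\<^sub>R b"] by (simp add: mult.assoc)
      finally have "cmod (u' (x + s *\<^sub>R b)) \<le> w x" using pos[of x] by (simp add: w_def field_simps)
      from mult_left_mono[OF this abs_ge_zero] show "onorm (\<lambda>h. h *\<^sub>R u' (x + s *\<^sub>R b)) \<le> w x"
        by (intro onorm_le) (simp add: mult.commute)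
    qed (use X in \<open>auto simp: less_imp_le\<close>)
    then show ?thesis using X(1)[of n] by (simp add: pos_divide_le_eq)
  qed
  have "(\<lambda>n. \<integral>x. (1 / X n) *\<^sub>R (u (x + X n *\<^sub>R b) - u x) * \<psi> (y \<bullet> x) \<partial>lborel) \<longlonglongrightarrow> (\<integral>x. u' x * \<psi> (y \<bullet> x) \<partial>lborel)"
  proof (rule integral_dominated_convergence[OF _ _ w])
    show "AE x in lborel. norm ((1 / X n) *\<^sub>R (u (x + X n *\<^sub>R b) - u x) * \<psi> (y \<bullet> x)) \<le> w x" for n
      using bound by (simp add: norm_mult)
    have "(\<lambda>n. (1 / X n) *\<^sub>R (u (x + X n *\<^sub>R b) - u x)) \<longlonglongrightarrow> u' x" for x
    proof -
      have "((\<lambda>t. (1 / t) *\<^sub>R (u (x + t *\<^sub>R b) - u (x + 0 *\<^sub>R b)) - u' x) \<circ> X) \<longlonglongrightarrow> 0"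
        using der[of x] X' X(3) unfolding has_vector_derivative_iff_quotient tendsto_at_iff_sequentially by blast
      then show ?thesis by (simp add: o_def LIM_zero_iff)
    qed
    then show "AE x in lborel. (\<lambda>n. (1 / X n) *\<^sub>R (u (x + X n *\<^sub>R b) - u x) * \<psi> (y \<bullet> x)) \<longlonglongrightarrow> u' x * \<psi> (y \<bullet> x)"
      by (intro AE_I2 tendsto_intros)
  qed auto
  \<comment> \<open>Translating the integral by \<open>X n *\<^sub>R b\<close> moves the difference
    quotient from \<open>u\<close> to the character.\<close>
  moreover have "(\<integral>x. (1 / X n) *\<^sub>R (u (x + X n *\<^sub>R b) - u x) * \<psi> (y \<bullet> x) \<partial>lborel)
    = ((\<psi> (X n * (- (y \<bullet> b))) - 1) / X n) * FT u y" for n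
  proof -
    have int: "integrable lborel (\<lambda>x. u x * \<psi> (y \<bullet> x))"
      by (intro FT_integrable schwartz_function_integrable u)
    have shift: "(\<integral>x. u (x + X n *\<^sub>R b) * \<psi> (y \<bullet> (x + X n *\<^sub>R b)) \<partial>lborel) = FT u y"
      unfolding fourier_scalar_def by (rule lborel_integral_shift) measurable
    have int': "integrable lborel (\<lambda>x. u (x + X n *\<^sub>R b) * \<psi> (y \<bullet> (x + X n *\<^sub>R b)))"
    proof -
      have "integrable (distr lborel borel ((+) (X n *\<^sub>R b))) (\<lambda>x. u x * \<psi> (y \<bullet> x))"
        using int by (simp add: lborel_distr_plus)
      then show ?thesis by (subst (asm) integrable_distr_eq) (auto simp: add.commute)
    qed
    have "(1 / X n) *\<^sub>R (u (x + X n *\<^sub>R b) - u x) * \<psi> (y \<bullet> x)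
      = (1 / X n) *\<^sub>R (\<psi> (X n * (- (y \<bullet> b))) * (u (x + X n *\<^sub>R b) * \<psi> (y \<bullet> (x + X n *\<^sub>R b))) - u x * \<psi> (y \<bullet> x))" for x
    proof -
      have e: "\<psi> (X n * (- (y \<bullet> b))) * \<psi> (y \<bullet> (x + X n *\<^sub>R b)) = \<psi> (y \<bullet> x)"
        by (simp add: plus[symmetric] inner_add_right)
      have "\<psi> (X n * (- (y \<bullet> b))) * (u (x + X n *\<^sub>R b) * \<psi> (y \<bullet> (x + X n *\<^sub>R b))) = u (x + X n *\<^sub>R b) * \<psi> (y \<bullet> x)"
        unfolding e[symmetric] by (rule mult.left_commute)
      then show ?thesis by (simp only:) (simp add: left_diff_distrib)
    qed
    then have "(\<integral>x. (1 / X n) *\<^sub>R (u (x + X n *\<^sub>R b) - u x) * \<psi> (y \<bullet> x) \<partial>lborel)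
      = (\<integral>x. (1 / X n) *\<^sub>R (\<psi> (X n * (- (y \<bullet> b))) * (u (x + X n *\<^sub>R b) * \<psi> (y \<bullet> (x + X n *\<^sub>R b))) - u x * \<psi> (y \<bullet> x)) \<partial>lborel)"
      by (simp only:)
    also have "\<dots> = (1 / X n) *\<^sub>R (\<psi> (X n * (- (y \<bullet> b))) * FT u y - FT u y)"
    proof -
      have "integrable lborel (\<lambda>x. \<psi> (X n * (- (y \<bullet> b))) * (u (x + X n *\<^sub>R b) * \<psi> (y \<bullet> (x + X n *\<^sub>R b))))"
        using int' by (rule integrable_mult_right)
      from Bochner_Integration.integral_diff[OF this int] show ?thesis
        by (simp only: integral_scaleR_right integral_mult_right_zero shift) (simp add: fourier_scalar_def)
    qed
    also have "\<dots> = ((\<psi> (X n * (- (y \<bullet> b))) - 1) / X n) * FT u y"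
      by (simp add: scaleR_conv_of_real[where 'a = complex] left_diff_distrib diff_divide_distrib)
    finally show ?thesis .
  qed
  ultimately have "(\<lambda>n. ((\<psi> (X n * (- (y \<bullet> b))) - 1) / X n) * FT u y) \<longlonglongrightarrow> FT u' y"
    by (simp add: fourier_scalar_def)
  moreover have "(\<lambda>n. ((\<psi> (X n * (- (y \<bullet> b))) - 1) / X n) * FT u y) \<longlonglongrightarrow> (\<alpha> * of_real (- (y \<bullet> b))) * FT u y"
  proof (rule tendsto_mult_right)
    have "((\<psi> \<circ> (\<lambda>t. t * (- (y \<bullet> b)))) has_vector_derivative (- (y \<bullet> b)) *\<^sub>R (\<alpha> * \<psi> (0 * (- (y \<bullet> b))))) (at 0)"
      by (intro vector_diff_chain_at deriv) (auto intro!: derivative_eq_intros)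
    then have "((\<lambda>t. \<psi> (t * (- (y \<bullet> b)))) has_vector_derivative \<alpha> * of_real (- (y \<bullet> b))) (at 0)"
      by (simp add: o_def scaleR_conv_of_real mult.commute)
    then have "((\<lambda>t. (1 / t) *\<^sub>R (\<psi> (t * (- (y \<bullet> b))) - \<psi> (0 * (- (y \<bullet> b)))) - \<alpha> * of_real (- (y \<bullet> b))) \<circ> X) \<longlonglongrightarrow> 0"
      using X' X(3) unfolding has_vector_derivative_iff_quotient tendsto_at_iff_sequentially by blast
    then have "(\<lambda>n. (\<psi> (X n * (- (y \<bullet> b))) - 1) / X n - \<alpha> * of_real (- (y \<bullet> b))) \<longlonglongrightarrow> 0"
      by (simp add: o_def scaleR_conv_of_real)
    then show "(\<lambda>n. (\<psi> (X n * (- (y \<bullet> b))) - 1) / X n) \<longlonglongrightarrow> \<alpha> * of_real (- (y \<bullet> b))"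
      by (rule LIM_zero_cancel)
  qed
  ultimately have "FT u' y = (\<alpha> * of_real (- (y \<bullet> b))) * FT u y" by (rule LIMSEQ_unique)
  then show ?thesis by simp
qed

text \<open>The transform exchanges coordinates and derivatives up to factors
  \<open>\<alpha>\<close>, so the image of the Schwartz space is closed under both, and coinduction
  applies to it.\<close>

lemma schwartz_function_FT:
  fixes u :: "real ^ 'n \<Rightarrow> complex"
  assumes "schwartz_function u" shows "schwartz_function (FT u)"
proof (rule schwartz_closed_imp_schwartz)
  let ?S = "(FT :: (real ^ 'n \<Rightarrow> complex) \<Rightarrow> real ^ 'n \<Rightarrow> complex) ` Collect schwartz_function"
  show "FT u \<in> ?S" using assms by simp
  show "schwartz_closed ?S"
    unfolding schwartz_closed_def
  proof (intro ballI)
    fix H :: "real ^ 'n \<Rightarrow> complex" assume "H \<in> ?S"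
    then obtain u :: "real ^ 'n \<Rightarrow> complex" where u: "schwartz_function u" and H: "H = FT u" by blast
    have 1: "continuous_on UNIV H" unfolding H by (intro FT_continuous schwartz_function_integrable u)
    have 2: "bounded (range H)" unfolding H using FT_bound[of u] by (auto simp: bounded_iff)
    have 3: "(\<lambda>y. of_real (y \<bullet> b) * H y) \<in> ?S" if b: "b \<in> Basis" for b
    proof -
      obtain u' where u': "schwartz_function u'" "\<And>x. ((\<lambda>t. u (x + t *\<^sub>R b)) has_vector_derivative u' x) (at 0)"
        using schwartz_function_deriv[OF u b] by blast
      have "(\<lambda>y. of_real (y \<bullet> b) * H y) = FT (\<lambda>x. - (1 / \<alpha>) * u' x)"
        unfolding FT_scale FT_of_deriv[OF u u' norm_Basis[OF b]] H using \<alpha>_nonzero by auto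
      then show ?thesis by (simp only:) (intro imageI CollectI schwartz_function_scale u')
    qed
    have 4: "\<exists>F'\<in>?S. \<forall>x. ((\<lambda>t. H (x + t *\<^sub>R b)) has_vector_derivative F' x) (at 0)" if b: "b \<in> Basis" for b
    proof (rule bexI[of _ "FT (\<lambda>x. \<alpha> * (of_real (x \<bullet> b) * u x))"], rule allI)
      show "((\<lambda>t. H (x + t *\<^sub>R b)) has_vector_derivative FT (\<lambda>x. \<alpha> * (of_real (x \<bullet> b) * u x)) x) (at 0)" for x
        unfolding H by (intro FT_deriv schwartz_function_integrable schwartz_function_coord u b)
      show "FT (\<lambda>x. \<alpha> * (of_real (x \<bullet> b) * u x)) \<in> ?S"
        using schwartz_function_scale[OF schwartz_function_coord[OF u b]] by auto
    qed
    show "continuous_on UNIV H \<and> bounded (range H) \<and> (\<forall>b\<in>Basis. (\<lambda>x. of_real (x \<bullet> b) * H x) \<in> ?S \<and>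
        (\<exists>F'\<in>?S. \<forall>x. ((\<lambda>t. H (x + t *\<^sub>R b)) has_vector_derivative F' x) (at 0)))"
      using 1 2 3 4 by blast
  qed
qed


text \<open>Fubini for the symmetric kernel \<open>\<psi> (x \<bullet> y)\<close>.\<close>

lemma FT_integral_swap:
  fixes u w :: "real ^ 'n \<Rightarrow> complex"
  assumes u: "integrable lborel u" and w: "integrable lborel w"
  shows "(\<integral>y. FT u y * w y \<partial>lborel) = (\<integral>x. u x * FT w x \<partial>lborel)"
proof -
  have [measurable]: "u \<in> borel_measurable borel" "w \<in> borel_measurable borel"
    using borel_measurable_integrable[OF u] borel_measurable_integrable[OF w] by simp_all
  let ?f = "\<lambda>x y. u x * w y * \<psi> (x \<bullet> y)"
  have "integrable (lborel \<Otimes>\<^sub>M lborel) (case_prod ?f)"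
  proof (rule lborel_pair.Fubini_integrable)
    show "case_prod ?f \<in> borel_measurable (lborel \<Otimes>\<^sub>M lborel)" by measurable
    have "integrable lborel (\<lambda>x. cmod (u x) * (\<integral>y. cmod (w y) \<partial>lborel))"
      using integrable_norm[OF u] by (rule integrable_mult_left)
    then show "integrable lborel (\<lambda>x. \<integral>y. cmod (case_prod ?f (x, y)) \<partial>lborel)"
      by (simp add: norm_mult)
    have "integrable lborel (\<lambda>y. u x * (w y * \<psi> (x \<bullet> y)))" for x
      using FT_integrable[OF w] by (rule integrable_mult_right)
    then show "AE x in lborel. integrable lborel (\<lambda>y. case_prod ?f (x, y))"
      by (simp add: mult.assoc)
  qed
  from lborel_pair.Fubini_integral[OF this]
  have "(\<integral>y. (\<integral>x. ?f x y \<partial>lborel) \<partial>lborel) = (\<integral>x. (\<integral>y. ?f x y \<partial>lborel) \<partial>lborel)" .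
  moreover have "(\<integral>x. ?f x y \<partial>lborel) = FT u y * w y" for y
  proof -
    have "(\<integral>x. ?f x y \<partial>lborel) = (\<integral>x. w y * (u x * \<psi> (y \<bullet> x)) \<partial>lborel)"
      by (simp add: mult_ac inner_commute)
    then show ?thesis by (simp add: fourier_scalar_def mult.commute)
  qed
  moreover have "(\<integral>y. ?f x y \<partial>lborel) = u x * FT w x" for x
    by (simp add: fourier_scalar_def mult.assoc)
  ultimately show ?thesis by simp
qed

text \<open>
  Both sides are the limit for \<open>\<epsilon> \<rightarrow> 0\<close> of \<open>\<integral>FT u(y) g(\<epsilon> y) dy = \<integral>u(\<epsilon> x) FT g(x) dx\<close>.
\<close>

lemma FT_inversion_0:
  fixes u g :: "real ^ 'n \<Rightarrow> complex"
  assumes u: "continuous_on UNIV u" "bounded (range u)" "integrable lborel u" "integrable lborel (FT u)"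
    and g: "continuous_on UNIV g" "bounded (range g)" "integrable lborel g" "integrable lborel (FT g)"
    and g0: "g 0 = 1"
  shows "(\<integral>y. FT u y \<partial>lborel) = (\<integral>y. FT g y \<partial>lborel) * u 0"
proof -
  define X where "X = (\<lambda>n. inverse (real (Suc n)))"
  have X: "X n > 0" "X \<longlonglongrightarrow> 0" for n
    unfolding X_def using LIMSEQ_inverse_real_of_nat by auto
  have X0: "(\<lambda>n. X n *\<^sub>R x) \<longlonglongrightarrow> 0" for x :: "real ^ 'n"
    using tendsto_scaleR[OF X(2) tendsto_const[of x]] by simp
  have [measurable]: "u \<in> borel_measurable borel" "g \<in> borel_measurable borel"
      "FT u \<in> borel_measurable borel" "FT g \<in> borel_measurable borel"
    using FT_continuous u g by (auto intro!: borel_measurable_continuous_onI)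
  \<comment> \<open>Both limits below are instances: \<open>g\<close> dilated against
    \<open>FT u\<close>, and \<open>u\<close> dilated against \<open>FT g\<close>.\<close>
  have lim: "(\<lambda>n. \<integral>y. v y * h (X n *\<^sub>R y) \<partial>lborel) \<longlonglongrightarrow> (\<integral>y. v y * h 0 \<partial>lborel)"
    if [measurable]: "v \<in> borel_measurable borel" and v: "integrable lborel v" and h: "continuous_on UNIV h" "bounded (range h)"
    for v h :: "real ^ 'n \<Rightarrow> complex"
  proof -
    obtain B where B: "\<And>x. cmod (h x) \<le> B" using h(2) by (auto simp: bounded_iff)
    have [measurable]: "h \<in> borel_measurable borel" using h by (intro borel_measurable_continuous_onI)
    show ?thesis
    proof (rule integral_dominated_convergence[where w = "\<lambda>y. B * cmod (v y)"])
      show "integrable lborel (\<lambda>y. B * cmod (v y))" using v by simp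
      have "(\<lambda>n. h (X n *\<^sub>R y)) \<longlonglongrightarrow> h 0" for y
        by (rule continuous_on_tendsto_compose[OF h(1) X0]) auto
      then show "AE y in lborel. (\<lambda>n. v y * h (X n *\<^sub>R y)) \<longlonglongrightarrow> v y * h 0"
        by (intro AE_I2 tendsto_intros)
      show "AE y in lborel. norm (v y * h (X n *\<^sub>R y)) \<le> B * cmod (v y)" for n
        using B by (auto simp: norm_mult mult.commute[of B] intro!: mult_left_mono)
    qed measurable
  qed
  have "(\<integral>y. FT u y * g (X n *\<^sub>R y) \<partial>lborel) = (\<integral>x. FT g x * u (X n *\<^sub>R x) \<partial>lborel)" for n
  proof -
    define c where "c = X n"
    have c: "c > 0" using X by (simp add: c_def)
    have gc: "integrable lborel (\<lambda>y. g (c *\<^sub>R y))"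
      using integrable_lborel_scale[OF g(3)] c by simp
    have "(\<integral>y. FT u y * g (c *\<^sub>R y) \<partial>lborel) = (\<integral>x. u x * FT (\<lambda>y. g (c *\<^sub>R y)) x \<partial>lborel)"
      by (rule FT_integral_swap[OF u(3) gc])
    also have "\<dots> = (c ^ DIM(real ^ 'n)) *\<^sub>R (\<integral>x. u (c *\<^sub>R x) * FT (\<lambda>y. g (c *\<^sub>R y)) (c *\<^sub>R x) \<partial>lborel)"
    proof -
      have [measurable]: "FT (\<lambda>y. g (c *\<^sub>R y)) \<in> borel_measurable borel"
        by (intro borel_measurable_continuous_onI FT_continuous gc)
      show ?thesis
        using c by (subst lborel_integral_scale[where f = "\<lambda>x. u x * FT (\<lambda>y. g (c *\<^sub>R y)) x"]) auto
    qed
    finally have "(\<integral>y. FT u y * g (c *\<^sub>R y) \<partial>lborel) = \<dots>" .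
    \<comment> \<open>The Jacobian of this inner integral cancels that of the outer one.\<close>
    moreover have "FT (\<lambda>y. g (c *\<^sub>R y)) (c *\<^sub>R x) = inverse (c ^ DIM(real ^ 'n)) *\<^sub>R FT g x" for x
      using lborel_integral_scale[of "\<lambda>y. g y * \<psi> (x \<bullet> y)" c] c by (simp add: fourier_scalar_def)
    ultimately show ?thesis using c by (simp add: c_def[symmetric] mult.commute)
  qed
  then have "(\<integral>y. FT u y * g 0 \<partial>lborel) = (\<integral>x. FT g x * u 0 \<partial>lborel)"
    using LIMSEQ_unique[OF lim[OF _ u(4) g(1,2)]] lim[OF _ g(4) u(1,2)] by simp
  then show ?thesis using g0 by simp
qed

end

section \<open>Fourier inversion and the Plancherel constant\<close>

lemma additive_character_dilateI:
  assumes "nontrivial_additive_character \<psi>" "a \<noteq> 0" shows "additive_character (dilate \<psi> a)"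
  using additive_character.additive_character_dilate[of \<psi>] assms by (simp add: additive_character_def)

lemma fourier_scalar_dilate: "fourier_scalar (dilate \<psi> a) u y = fourier_scalar \<psi> u (a *\<^sub>R y)"
  by (simp add: fourier_scalar_def dilate_def)

text \<open>The value at 0 normalises the inversion limit; nonnegativity gives the positivity of the
  inversion constant.\<close>

lemma schwartz_test_function_exists:
  obtains g :: "real ^ 'n \<Rightarrow> real" where "schwartz_function (\<lambda>x. complex_of_real (g x))" "g 0 = 1" "\<And>x. g x \<ge> 0"
proof -
  obtain \<phi> :: "real ^ 'n \<Rightarrow> real" where \<phi>: "schwartz_function (\<lambda>x. complex_of_real (\<phi> x))"
    "\<And>x. \<phi> x \<ge> 0" "\<And>x. \<phi> x \<noteq> 0 \<longleftrightarrow> (\<forall>i. \<bar>x $ i - (0 :: real ^ 'n) $ i\<bar> < 1)"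
    using schwartz_bump_exists[of 1 "0 :: real ^ 'n"] by auto
  have pos: "\<phi> 0 > 0" using \<phi>(2)[of 0] \<phi>(3)[of 0] by auto
  show ?thesis
  proof (rule that[of "\<lambda>x. inverse (\<phi> 0) * \<phi> x"])
    show "schwartz_function (\<lambda>x. complex_of_real (inverse (\<phi> 0) * \<phi> x))"
      using schwartz_function_scale[OF \<phi>(1), of "of_real (inverse (\<phi> 0))"] by simp
  qed (use pos \<phi>(2) in auto)
qed

context additive_character
begin

text \<open>That one number serves every \<open>u\<close> follows by comparison with a fixed test
  function \<open>g\<close>, for which it is the integral of \<open>FT g\<close>. Its value is
  pinned down later through Plancherel.\<close>

definition FT_constant :: "'n::finite itself \<Rightarrow> complex" where
  "FT_constant _ = (SOME C. \<forall>u :: real ^ 'n \<Rightarrow> complex. continuous_on UNIV u \<and> bounded (range u) \<and>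
     integrable lborel u \<and> integrable lborel (FT u) \<longrightarrow> (\<integral>y. FT u y \<partial>lborel) = C * u 0)"

lemma FT_constant:
  fixes u :: "real ^ 'n \<Rightarrow> complex"
  assumes "continuous_on UNIV u" "bounded (range u)" "integrable lborel u" "integrable lborel (FT u)"
  shows "(\<integral>y. FT u y \<partial>lborel) = FT_constant TYPE('n) * u 0"
proof -
  obtain g :: "real ^ 'n \<Rightarrow> real" where g: "schwartz_function (\<lambda>x. complex_of_real (g x))" "g 0 = 1"
    by (rule schwartz_test_function_exists)
  have "\<forall>u :: real ^ 'n \<Rightarrow> complex. continuous_on UNIV u \<and> bounded (range u) \<and>
     integrable lborel u \<and> integrable lborel (FT u) \<longrightarrow> (\<integral>y. FT u y \<partial>lborel) = (\<integral>y. FT (\<lambda>x. of_real (g x)) y \<partial>lborel) * u 0"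
    using g(2) schwartz_function_continuous[OF g(1)] schwartz_function_bounded[OF g(1)]
      schwartz_function_integrable[OF g(1)] schwartz_function_integrable[OF schwartz_function_FT[OF g(1)]]
    by (intro allI impI, elim conjE, intro FT_inversion_0) auto
  from someI[of "\<lambda>C. \<forall>u :: real ^ 'n \<Rightarrow> complex. continuous_on UNIV u \<and> bounded (range u) \<and>
     integrable lborel u \<and> integrable lborel (FT u) \<longrightarrow> (\<integral>y. FT u y \<partial>lborel) = C * u 0", OF this] assms
  show ?thesis unfolding FT_constant_def by blast
qed

text \<open>The formula at 0 is applied to the translate of \<open>u\<close> by \<open>x\<close>,
  whose transform is \<open>FT u\<close> times a phase.\<close>

lemma FT_inversion:
  fixes u :: "real ^ 'n \<Rightarrow> complex"
  assumes u: "schwartz_function u"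
  shows "(\<integral>y. FT u y * \<psi> (- (x \<bullet> y)) \<partial>lborel) = FT_constant TYPE('n) * u x"
proof -
  note [measurable] = schwartz_function_measurable[OF u]
  define v where "v = (\<lambda>z. u (z + x))"
  have FTv: "FT v y = FT u y * \<psi> (- (x \<bullet> y))" for y
  proof -
    have "FT v y = (\<integral>z. u (z + x) * \<psi> (y \<bullet> (z + x - x)) \<partial>lborel)" by (simp add: v_def fourier_scalar_def)
    also have "\<dots> = (\<integral>z. u z * \<psi> (y \<bullet> (z - x)) \<partial>lborel)"
      by (rule lborel_integral_shift[where f = "\<lambda>z. u z * \<psi> (y \<bullet> (z - x))"]) measurable
    also have "\<dots> = (\<integral>z. \<psi> (- (x \<bullet> y)) * (u z * \<psi> (y \<bullet> z)) \<partial>lborel)"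
    proof (rule arg_cong[where f = "integral\<^sup>L lborel"], rule ext)
      fix z
      have "\<psi> (y \<bullet> (z - x)) = \<psi> (- (x \<bullet> y)) * \<psi> (y \<bullet> z)"
        by (simp add: plus[symmetric] inner_diff_right inner_commute)
      then show "u z * \<psi> (y \<bullet> (z - x)) = \<psi> (- (x \<bullet> y)) * (u z * \<psi> (y \<bullet> z))" by (simp add: mult_ac)
    qed
    finally show ?thesis by (simp add: fourier_scalar_def mult.commute)
  qed
  then have FTv': "FT v = (\<lambda>y. FT u y * \<psi> (- (x \<bullet> y)))" by blast
  have "integrable lborel v"
  proof -
    have "integrable (distr lborel borel ((+) x)) u"
      using schwartz_function_integrable[OF u] by (simp add: lborel_distr_plus)
    then show ?thesis unfolding v_def by (subst (asm) integrable_distr_eq) (auto simp: add.commute)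
  qed
  moreover have "integrable lborel (FT v)"
  proof -
    have "integrable lborel (\<lambda>y. FT u y * \<psi> ((- x) \<bullet> y))"
      by (intro FT_integrable schwartz_function_integrable schwartz_function_FT u)
    then show ?thesis by (simp add: FTv')
  qed
  moreover have "continuous_on UNIV v"
    unfolding v_def by (rule continuous_on_compose2[OF schwartz_function_continuous[OF u]]) (auto intro!: continuous_intros)
  moreover have "bounded (range v)"
    by (rule bounded_subset[OF schwartz_function_bounded[OF u]]) (auto simp: v_def)
  ultimately have "(\<integral>y. FT v y \<partial>lborel) = FT_constant TYPE('n) * v 0" by (intro FT_constant)
  then show ?thesis unfolding FTv' by (simp add: v_def)
qed

lemma FT_FT_dilate:
  fixes u :: "real ^ 'n \<Rightarrow> complex"
  assumes u: "schwartz_function u"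
  shows "FT (fourier_scalar (dilate \<psi> (- 1)) u) x = FT_constant TYPE('n) * u x"
proof -
  note [measurable] = schwartz_function_measurable[OF schwartz_function_FT[OF u]]
  have "FT (fourier_scalar (dilate \<psi> (- 1)) u) x = (\<integral>y. FT u ((- 1) *\<^sub>R y) * \<psi> (- (x \<bullet> ((- 1) *\<^sub>R y))) \<partial>lborel)"
    unfolding fourier_scalar_dilate[abs_def] by (subst (1) fourier_scalar_def) simp
  also have "\<dots> = (\<integral>y. FT u y * \<psi> (- (x \<bullet> y)) \<partial>lborel)"
    by (subst lborel_integral_scale[where f = "\<lambda>y. FT u y * \<psi> (- (x \<bullet> y))"]) auto
  finally show ?thesis by (simp add: FT_inversion[OF u])
qed

text \<open>The transform of the conjugate of \<open>FT u\<close> is the conjugate of an inversion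
  integral, which is why the constant enters conjugated; that it is real is a consequence of this
  formula.\<close>

lemma FT_plancherel_cnj:
  fixes u :: "real ^ 'n \<Rightarrow> complex"
  assumes u: "schwartz_function u"
  shows "complex_of_real (\<integral>y. (cmod (FT u y))\<^sup>2 \<partial>lborel) = cnj (FT_constant TYPE('n)) * of_real (\<integral>x. (cmod (u x))\<^sup>2 \<partial>lborel)"
proof -
  note int = schwartz_function_integrable[OF u] schwartz_function_integrable[OF schwartz_function_FT[OF u]]
  have "complex_of_real (\<integral>y. (cmod (FT u y))\<^sup>2 \<partial>lborel) = (\<integral>y. FT u y * cnj (FT u y) \<partial>lborel)"
    by (subst integral_complex_of_real[symmetric]) (simp only: complex_norm_square)
  also have "\<dots> = (\<integral>x. u x * FT (\<lambda>y. cnj (FT u y)) x \<partial>lborel)"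
    using int by (intro FT_integral_swap) auto
  also have "FT (\<lambda>y. cnj (FT u y)) x = cnj (FT_constant TYPE('n)) * cnj (u x)" for x
  proof -
    have "FT (\<lambda>y. cnj (FT u y)) x = (\<integral>y. cnj (FT u y * \<psi> (- (x \<bullet> y))) \<partial>lborel)"
      unfolding fourier_scalar_def[of \<psi> "\<lambda>y. cnj (FT u y)"] by (simp add: uminus)
    also have "\<dots> = cnj (\<integral>y. FT u y * \<psi> (- (x \<bullet> y)) \<partial>lborel)"
    proof (rule integral_bounded_linear[OF bounded_linear_cnj])
      show "integrable lborel (\<lambda>y. FT u y * \<psi> (- (x \<bullet> y)))"
        using FT_integrable[OF int(2), of "- x"] by simp
    qed
    finally show ?thesis by (simp add: FT_inversion[OF u])
  qed
  then have "(\<integral>x. u x * FT (\<lambda>y. cnj (FT u y)) x \<partial>lborel) = (\<integral>x. cnj (FT_constant TYPE('n)) * of_real ((cmod (u x))\<^sup>2) \<partial>lborel)"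
    by (simp add: complex_norm_square mult_ac del: of_real_power)
  also have "\<dots> = cnj (FT_constant TYPE('n)) * of_real (\<integral>x. (cmod (u x))\<^sup>2 \<partial>lborel)"
    by (simp only: integral_mult_right_zero integral_complex_of_real)
  finally show ?thesis .
qed

lemma schwartz_function_square_integrable:
  fixes u :: "real ^ 'n \<Rightarrow> complex"
  assumes u: "schwartz_function u" shows "integrable lborel (\<lambda>x. (cmod (u x))\<^sup>2)"
proof -
  obtain B where B: "\<And>x. cmod (u x) \<le> B" using schwartz_function_bounded[OF u] by (auto simp: bounded_iff)
  have B0: "B \<ge> 0" using B[of 0] norm_ge_zero order_trans by blast
  show ?thesis
  proof (rule Bochner_Integration.integrable_bound)
    show "integrable lborel (\<lambda>x. B * cmod (u x))" using schwartz_function_integrable[OF u] by simp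
    show "AE x in lborel. norm ((cmod (u x))\<^sup>2) \<le> norm (B * cmod (u x))"
      using B B0 by (auto simp: power2_eq_square intro!: mult_right_mono)
  qed (use schwartz_function_measurable[OF u] in measurable)
qed

text \<open>Plancherel for one test function \<open>g\<close> exhibits the constant as a quotient of
  two positive numbers; \<open>FT g\<close> does not vanish at 0, where it is the integral of
  \<open>g\<close>.\<close>

lemma FT_constant_positive:
  obtains A where "A > 0" "FT_constant TYPE('n::finite) = complex_of_real A"
proof -
  obtain g :: "real ^ 'n \<Rightarrow> real" where g: "schwartz_function (\<lambda>x. complex_of_real (g x))" "g 0 = 1" "\<And>x. g x \<ge> 0"
    by (rule schwartz_test_function_exists) blast
  let ?u = "\<lambda>x. complex_of_real (g x)"
  note cont = schwartz_function_continuous[OF g(1)] schwartz_function_continuous[OF schwartz_function_FT[OF g(1)]]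
  have contg: "continuous_on UNIV g"
    using continuous_on_Re[OF cont(1)] by simp
  have 1: "(\<integral>x. (cmod (?u x))\<^sup>2 \<partial>lborel) > 0"
    using g by (intro lborel_integral_pos[where a = 0] schwartz_function_square_integrable continuous_intros cont) auto
  have "FT ?u 0 = (\<integral>x. complex_of_real (g x) \<partial>lborel)" by (simp add: fourier_scalar_def)
  also have "\<dots> = complex_of_real (\<integral>x. g x \<partial>lborel)" by (rule integral_complex_of_real)
  also have "(\<integral>x. g x \<partial>lborel) > 0"
  proof (rule lborel_integral_pos[OF contg, where a = 0])
    show "integrable lborel g"
      using integrable_Re[OF schwartz_function_integrable[OF g(1)]] by simp
  qed (use g in auto)
  then have "complex_of_real (\<integral>x. g x \<partial>lborel) \<noteq> 0" by simp
  finally have "FT ?u 0 \<noteq> 0" .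
  then have 2: "(\<integral>y. (cmod (FT ?u y))\<^sup>2 \<partial>lborel) > 0"
    by (intro lborel_integral_pos[where a = 0] schwartz_function_square_integrable schwartz_function_FT g continuous_intros cont) auto
  define A where "A = (\<integral>y. (cmod (FT ?u y))\<^sup>2 \<partial>lborel) / (\<integral>x. (cmod (?u x))\<^sup>2 \<partial>lborel)"
  have "cnj (FT_constant TYPE('n)) = of_real A"
    using FT_plancherel_cnj[OF g(1)] 1 by (simp add: A_def field_simps)
  then have "FT_constant TYPE('n) = of_real A" by (metis complex_cnj_cnj complex_cnj_complex_of_real)
  moreover have "A > 0" using 1 2 by (simp add: A_def)
  ultimately show ?thesis using that by blast
qed

lemma fourier_constant_eq: "complex_of_real (fourier_constant TYPE('n::finite) \<psi>) = FT_constant TYPE('n)"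
proof -
  obtain A where A: "A > 0" "FT_constant TYPE('n) = complex_of_real A"
    by (rule FT_constant_positive)
  have plancherel: "(\<integral>\<^sup>+y. ennreal ((cmod (FT u y))\<^sup>2) \<partial>lborel) = ennreal A * (\<integral>\<^sup>+x. ennreal ((cmod (u x))\<^sup>2) \<partial>lborel)"
    if u: "schwartz_function u" for u :: "real ^ 'n \<Rightarrow> complex"
  proof -
    have "complex_of_real (\<integral>y. (cmod (FT u y))\<^sup>2 \<partial>lborel) = of_real (A * (\<integral>x. (cmod (u x))\<^sup>2 \<partial>lborel))"
      using FT_plancherel_cnj[OF u] by (simp add: A)
    then have "(\<integral>y. (cmod (FT u y))\<^sup>2 \<partial>lborel) = A * (\<integral>x. (cmod (u x))\<^sup>2 \<partial>lborel)"
      by (simp only: of_real_eq_iff)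
    then show ?thesis
      using A(1) schwartz_function_square_integrable[OF u] schwartz_function_square_integrable[OF schwartz_function_FT[OF u]]
      by (simp add: nn_integral_eq_integral ennreal_mult)
  qed
  have "fourier_constant TYPE('n) \<psi> = A"
    unfolding fourier_constant_def
  proof (rule the_equality)
    \<comment> \<open>Plancherel for \<open>lborel\<close> carries the factor \<open>A\<close>, so
      the dual measure is \<open>lborel\<close> divided by \<open>A\<close>.\<close>
    let ?\<mu> = "scale_measure (ennreal (1 / A)) (lborel :: (real ^ 'n) measure)"
    have inv: "ennreal (1 / A) * ennreal A = 1" "ennreal A * ennreal (1 / A) = 1"
      using A by (auto simp: ennreal_mult[symmetric])
    have "haar_measure ?\<mu>"
      unfolding haar_measure_def
    proof (intro conjI allI impI)
      fix a :: "real ^ 'n"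
      show "distr ?\<mu> borel ((+) a) = ?\<mu>"
      proof (rule measure_eqI)
        fix S assume "S \<in> sets (distr ?\<mu> borel ((+) a))"
        then have [measurable]: "S \<in> sets borel" by simp
        have "emeasure (distr ?\<mu> borel ((+) a)) S = ennreal (1 / A) * emeasure (distr lborel borel ((+) a)) S"
          by (simp add: emeasure_distr emeasure_scale_measure space_scale_measure)
        then show "emeasure (distr ?\<mu> borel ((+) a)) S = emeasure ?\<mu> S"
          by (simp add: lborel_distr_plus emeasure_scale_measure)
      qed simp
    next
      fix K :: "(real ^ 'n) set" assume "compact K"
      then have "emeasure lborel K < \<infinity>"
        using emeasure_compact_finite by blast
      then show "emeasure ?\<mu> K < \<infinity>" by (simp add: emeasure_scale_measure ennreal_mult_less_top)
    next
      show "emeasure ?\<mu> UNIV \<noteq> 0" using A by (simp add: emeasure_scale_measure ennreal_mult_top)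
    qed simp
    moreover have "(\<integral>\<^sup>+y. ennreal ((cmod (FT u y))\<^sup>2) \<partial>?\<mu>) = (\<integral>\<^sup>+x. ennreal ((cmod (u x))\<^sup>2) \<partial>lborel)"
      if u: "schwartz_function u" for u :: "real ^ 'n \<Rightarrow> complex"
    proof -
      note [measurable] = schwartz_function_measurable[OF schwartz_function_FT[OF u]]
      show ?thesis
        by (simp add: nn_integral_scale_measure plancherel[OF u] mult.assoc[symmetric] inv)
    qed
    moreover have "lborel = scale_measure (ennreal A) ?\<mu>"
      by (simp add: scale_scale_measure inv)
    ultimately show "A > 0 \<and> (\<exists>\<mu> :: (real ^ 'n) measure. dual_haar_measure \<psi> \<mu> \<and> lborel = scale_measure (ennreal A) \<mu>)"
      using A unfolding dual_haar_measure_def by blast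
  next
    \<comment> \<open>Uniqueness: the Plancherel identity of a single \<open>g\<close> with nonzero
      \<open>L\<^sup>2\<close> norm already fixes the scaling factor.\<close>
    fix A' assume "A' > 0 \<and> (\<exists>\<mu> :: (real ^ 'n) measure. dual_haar_measure \<psi> \<mu> \<and> lborel = scale_measure (ennreal A') \<mu>)"
    then obtain \<mu> :: "(real ^ 'n) measure" where A': "A' > 0" "dual_haar_measure \<psi> \<mu>" "lborel = scale_measure (ennreal A') \<mu>"
      by blast
    obtain g :: "real ^ 'n \<Rightarrow> real" where g: "schwartz_function (\<lambda>x. complex_of_real (g x))" "g 0 = 1" "\<And>x. g x \<ge> 0"
      by (rule schwartz_test_function_exists) blast
    let ?u = "\<lambda>x. complex_of_real (g x)"
    define I where "I = (\<integral>x. (cmod (?u x))\<^sup>2 \<partial>lborel)"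
    have I: "I > 0" unfolding I_def
      using g by (intro lborel_integral_pos[where a = 0] schwartz_function_square_integrable continuous_intros schwartz_function_continuous) auto
    have eI: "(\<integral>\<^sup>+x. ennreal ((cmod (?u x))\<^sup>2) \<partial>lborel) = ennreal I"
      unfolding I_def by (intro nn_integral_eq_integral schwartz_function_square_integrable g) auto
    have sets: "sets \<mu> = sets borel" using A'(2) by (simp add: dual_haar_measure_def haar_measure_def)
    have "(\<lambda>y. ennreal ((cmod (FT ?u y))\<^sup>2)) \<in> borel_measurable \<mu>"
      using schwartz_function_measurable[OF schwartz_function_FT[OF g(1)]]
      unfolding measurable_cong_sets[OF sets refl] by measurable
    then have "(\<integral>\<^sup>+y. ennreal ((cmod (FT ?u y))\<^sup>2) \<partial>lborel) = ennreal A' * (\<integral>\<^sup>+y. ennreal ((cmod (FT ?u y))\<^sup>2) \<partial>\<mu>)"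
      by (subst A'(3)) (simp add: nn_integral_scale_measure)
    also have "\<dots> = ennreal A' * ennreal I"
      using A'(2) g(1) eI unfolding dual_haar_measure_def by metis
    finally have "ennreal A * ennreal I = ennreal A' * ennreal I" unfolding plancherel[OF g(1)] eI .
    then show "A' = A" using A(1) A'(1) I by (simp add: ennreal_mult[symmetric])
  qed
  then show ?thesis by (simp add: A)
qed

end


section \<open>Fourier transform of half-densities\<close>

lemma half_density_mat_1 [simp]: "half_density u x (mat 1) = u x"
  by (simp add: half_density_def)

lemma fourier_half_density: "fourier \<psi> (half_density u) = half_density (fourier_scalar \<psi> u)"
  by (simp add: fourier_def)

lemma fourier_schwartz:
  assumes "nontrivial_additive_character \<psi>" "\<xi> \<in> schwartz_half_densities"
  shows "fourier \<psi> \<xi> \<in> schwartz_half_densities"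
  using assms by (auto simp: schwartz_half_densities_def fourier_half_density additive_character_def
      intro!: imageI additive_character.schwartz_function_FT)

text \<open>The inverse character comes first and \<open>\<psi>\<close> second, in the order in
  which the two functional equations produce the transforms.\<close>

lemma fourier_inversion:
  fixes \<xi> :: "'n::finite dens"
  assumes \<psi>: "nontrivial_additive_character \<psi>" and \<xi>: "\<xi> \<in> schwartz_half_densities"
  shows "fourier \<psi> (fourier (dilate \<psi> (- 1)) \<xi>) = (\<lambda>x M. of_real (fourier_constant TYPE('n) \<psi>) * \<xi> x M)"
proof -
  interpret additive_character \<psi> by (simp add: additive_character_def \<psi>)
  obtain u where u: "\<xi> = half_density u" "schwartz_function u" using \<xi> by (auto simp: schwartz_half_densities_def)
  have "fourier_scalar \<psi> (fourier_scalar (dilate \<psi> (- 1)) u) = (\<lambda>x. FT_constant TYPE('n) * u x)"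
    using FT_FT_dilate[OF u(2)] by blast
  then show ?thesis
    unfolding u(1) fourier_half_density by (simp add: half_density_def fourier_constant_eq mult.assoc)
qed

section \<open>Spaces of intertwining maps\<close>

lemma
  fixes u w :: "'e::euclidean_space \<Rightarrow> complex"
  assumes U: "open U" and u: "smooth_function U u" and w: "smooth_function U w"
  shows smooth_function_lincomb: "smooth_function U (\<lambda>x. c * u x + w x)"
    and partial_derivs_lincomb: "set es \<subseteq> Basis \<Longrightarrow> x \<in> U \<Longrightarrow>
      partial_derivs es (\<lambda>x. c * u x + w x) x = c * partial_derivs es u x + partial_derivs es w x"
proof -
  let ?D = "\<lambda>es x. c * partial_derivs es u x + partial_derivs es w x"
  have 1: "?D [] = (\<lambda>x. c * u x + w x)" by simp
  have 2: "isCont (?D es) x" if "set es \<subseteq> Basis" "x \<in> U" for es x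
    using smooth_function_partial_derivs(1)[OF u U that] smooth_function_partial_derivs(1)[OF w U that]
    by (intro continuous_intros)
  have 3: "((\<lambda>t. ?D es (x + t *\<^sub>R b)) has_vector_derivative ?D (b # es) x) (at 0)"
    if "set es \<subseteq> Basis" "x \<in> U" "b \<in> Basis" for es x b
    using smooth_function_partial_derivs(2)[OF u U that] smooth_function_partial_derivs(2)[OF w U that]
    by (intro has_vector_derivative_add has_vector_derivative_mult_right)
  show "smooth_function U (\<lambda>x. c * u x + w x)"
    by (rule partial_derivs_family(1)[of U ?D, OF U 1 2 3])
  show "set es \<subseteq> Basis \<Longrightarrow> x \<in> U \<Longrightarrow> partial_derivs es (\<lambda>x. c * u x + w x) x = ?D es x"
    by (rule partial_derivs_family(2)[of U ?D, OF U 1 2 3])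
qed

lemma
  fixes u :: "'e::euclidean_space \<Rightarrow> complex"
  assumes U: "open U" and u: "smooth_function U u" and inv: "\<And>x. x \<in> U \<Longrightarrow> a *\<^sub>R x \<in> U"
  shows smooth_function_scale: "smooth_function U (\<lambda>x. c * u (a *\<^sub>R x))"
    and partial_derivs_scale: "set es \<subseteq> Basis \<Longrightarrow> x \<in> U \<Longrightarrow>
      partial_derivs es (\<lambda>x. c * u (a *\<^sub>R x)) x = c * of_real a ^ length es * partial_derivs es u (a *\<^sub>R x)"
proof -
  let ?D = "\<lambda>es x. c * of_real a ^ length es * partial_derivs es u (a *\<^sub>R x)"
  have 1: "?D [] = (\<lambda>x. c * u (a *\<^sub>R x))" by simp
  have 2: "isCont (?D es) x" if "set es \<subseteq> Basis" "x \<in> U" for es x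
  proof -
    have "isCont (partial_derivs es u) (a *\<^sub>R x)"
      using smooth_function_partial_derivs(1)[OF u U that(1) inv[OF that(2)]] .
    then have "isCont (\<lambda>x. partial_derivs es u (a *\<^sub>R x)) x"
      by (rule isCont_o2[where f = "\<lambda>x. a *\<^sub>R x" and g = "partial_derivs es u", rotated]) simp
    then show ?thesis by (intro continuous_intros)
  qed
  have 3: "((\<lambda>t. ?D es (x + t *\<^sub>R b)) has_vector_derivative ?D (b # es) x) (at 0)"
    if "set es \<subseteq> Basis" "x \<in> U" "b \<in> Basis" for es x b
  proof -
    have "((\<lambda>t. partial_derivs es u (a *\<^sub>R x + t *\<^sub>R b)) has_vector_derivative partial_derivs (b # es) u (a *\<^sub>R x)) (at (a * 0))"
      using smooth_function_partial_derivs(2)[OF u U that(1) inv[OF that(2)] that(3)] by simp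
    then have "(((\<lambda>t. partial_derivs es u (a *\<^sub>R x + t *\<^sub>R b)) \<circ> (\<lambda>t. a * t)) has_vector_derivative
        a *\<^sub>R partial_derivs (b # es) u (a *\<^sub>R x)) (at 0)"
      by (intro vector_diff_chain_at) (auto intro!: derivative_eq_intros)
    then have "((\<lambda>t. partial_derivs es u (a *\<^sub>R (x + t *\<^sub>R b))) has_vector_derivative
        of_real a * partial_derivs (b # es) u (a *\<^sub>R x)) (at 0)"
      by (simp add: o_def scaleR_right_distrib scaleR_conv_of_real[where 'a = complex])
    from has_vector_derivative_mult_right[OF this, of "c * of_real a ^ length es"]
    show ?thesis by (simp add: mult_ac)
  qed
  show "smooth_function U (\<lambda>x. c * u (a *\<^sub>R x))"
    by (rule partial_derivs_family(1)[of U ?D, OF U 1 2 3])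
  show "set es \<subseteq> Basis \<Longrightarrow> x \<in> U \<Longrightarrow> partial_derivs es (\<lambda>x. c * u (a *\<^sub>R x)) x = ?D es x"
    by (rule partial_derivs_family(2)[of U ?D, OF U 1 2 3])
qed

text \<open>Nonnegativity follows from subadditivity and homogeneity: \<open>0 = p k (v - v)\<close>
  is at most \<open>2 * p k v\<close>.\<close>

lemma frechet_space_seminorm_nonneg:
  assumes "frechet_space sc p" shows "p k v \<ge> 0"
proof -
  have vs: "vector_space sc" and tri: "\<And>u v. p k (u + v) \<le> p k u + p k v" and hom: "\<And>c v. p k (sc c v) = cmod c * p k v"
    using assms unfolding frechet_space_def by auto
  interpret vector_space sc by (rule vs)
  have "p k 0 = 0" using hom[of 0 0] by simp
  moreover have "p k (- v) = p k v" using hom[of "-1" v] by simp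
  ultimately show ?thesis using tri[of v "- v"] by simp
qed

text \<open>The single operation \<open>c * \<eta> + \<zeta>\<close> is the one in which linearity
  of zeta integrals and of gamma factors is stated.\<close>

definition eta_subspace :: "('v, 'n) eta set \<Rightarrow> bool" where
  "eta_subspace N \<longleftrightarrow> (\<lambda>v x M. 0) \<in> N \<and> (\<forall>c. \<forall>\<eta>\<in>N. \<forall>\<zeta>\<in>N. (\<lambda>v x M. c * \<eta> v x M + \<zeta> v x M) \<in> N)"

lemma pull_back_linear:
  assumes "linear T" shows "pull_back T \<phi> = (\<lambda>x M. \<phi> (T x) (\<chi> i. T (M $ i)))"
proof -
  have "frechet_derivative T (at x) = T" for x
    using linear_imp_has_derivative[OF assms] frechet_derivative_at by metis
  then show ?thesis by (simp add: pull_back_def)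
qed

lemma linear_vector_matrix_mult: "linear (\<lambda>x :: real ^ 'n. x v* A)"
  by (rule linearI) (auto simp: vector_matrix_left_distrib scaleR_vector_matrix_assoc)

lemma hom_space_bound:
  fixes \<rho> :: "complex ^ 'm::finite ^ 'm \<Rightarrow> complex ^ 'n::finite ^ 'n"
  assumes "\<eta> \<in> hom_space G \<rho> Xp sc p \<pi>" "compact K" "K \<subseteq> real_points Xp" "set es \<subseteq> Basis"
  shows "\<exists>l C. \<forall>v. \<forall>x\<in>K. cmod (partial_derivs es (\<lambda>y. \<eta> v y (mat 1)) x) \<le> C * (\<Sum>j\<le>l. p j v)"
proof -
  from assms(1) have "\<forall>K es. compact K \<and> K \<subseteq> real_points Xp \<and> set es \<subseteq> Basis \<longrightarrow>
        (\<exists>l C. \<forall>v. \<forall>x\<in>K. cmod (partial_derivs es (\<lambda>y. \<eta> v y (mat 1)) x) \<le> C * (\<Sum>j\<le>l. p j v))"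
    unfolding hom_space_def by (elim CollectE conjE)
  from this[rule_format, of K es] assms(2-4) show ?thesis by simp
qed

lemma hom_space_subspace:
  fixes \<rho> :: "complex ^ 'm::finite ^ 'm \<Rightarrow> complex ^ 'n::finite ^ 'n"
  assumes U: "open (real_points Xp)" and p: "frechet_space sc p"
  shows "eta_subspace (hom_space G \<rho> Xp sc p \<pi>)"
  unfolding eta_subspace_def
proof (intro conjI allI ballI)
  let ?U = "real_points Xp"
  have zero: "smooth_function ?U (\<lambda>_. 0)" "set es \<subseteq> Basis \<Longrightarrow> x \<in> ?U \<Longrightarrow> partial_derivs es (\<lambda>_. 0) x = 0" for es x
    by (rule partial_derivs_family(1)[of ?U "\<lambda>_ _. 0"], use U in auto)
      (rule partial_derivs_family(2)[of ?U "\<lambda>_ _. 0"], use U in auto)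
  show "(\<lambda>v x M. 0) \<in> hom_space G \<rho> Xp sc p \<pi>"
    using zero
    by (auto simp: hom_space_def smooth_half_densities_def density_on_def pull_back_def subset_iff intro!: exI[of _ 0])
next
  fix c \<eta> \<zeta> assume \<eta>: "\<eta> \<in> hom_space G \<rho> Xp sc p \<pi>" and \<zeta>: "\<zeta> \<in> hom_space G \<rho> Xp sc p \<pi>"
  let ?U = "real_points Xp"
  have smooth: "smooth_function ?U (\<lambda>x. \<eta> v x M)" "smooth_function ?U (\<lambda>x. \<zeta> v x M)" for v M
    using \<eta> \<zeta> by (auto simp: hom_space_def smooth_half_densities_def)
  show "(\<lambda>v x M. c * \<eta> v x M + \<zeta> v x M) \<in> hom_space G \<rho> Xp sc p \<pi>"
    unfolding hom_space_def
  proof (intro CollectI conjI allI ballI impI)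
    fix v show "(\<lambda>x M. c * \<eta> v x M + \<zeta> v x M) \<in> smooth_half_densities ?U"
      using \<eta> \<zeta> smooth_function_lincomb[OF U smooth]
      by (auto simp: hom_space_def smooth_half_densities_def density_on_def algebra_simps)
  next
    fix d u v
    have "\<eta> (sc d u + v) = (\<lambda>x M. d * \<eta> u x M + \<eta> v x M)" "\<zeta> (sc d u + v) = (\<lambda>x M. d * \<zeta> u x M + \<zeta> v x M)"
      using \<eta> \<zeta> by (auto simp: hom_space_def)
    then show "(\<lambda>x M. c * \<eta> (sc d u + v) x M + \<zeta> (sc d u + v) x M) =
        (\<lambda>x M. d * (c * \<eta> u x M + \<zeta> u x M) + (c * \<eta> v x M + \<zeta> v x M))"
      by (simp add: algebra_simps)
  next
    fix K es assume K: "compact K \<and> K \<subseteq> ?U \<and> set es \<subseteq> (Basis :: (real ^ 'n) set)"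
    obtain l1 C1 where 1: "\<And>v x. x \<in> K \<Longrightarrow> cmod (partial_derivs es (\<lambda>y. \<eta> v y (mat 1)) x) \<le> C1 * (\<Sum>j\<le>l1. p j v)"
      using hom_space_bound[OF \<eta>, of K es] K by metis
    obtain l2 C2 where 2: "\<And>v x. x \<in> K \<Longrightarrow> cmod (partial_derivs es (\<lambda>y. \<zeta> v y (mat 1)) x) \<le> C2 * (\<Sum>j\<le>l2. p j v)"
      using hom_space_bound[OF \<zeta>, of K es] K by metis
    \<comment> \<open>The constants \<open>C1\<close> and \<open>C2\<close> may be negative, hence
      the absolute values; the longer sum is larger because seminorms are nonnegative.\<close>
    have mono: "C * (\<Sum>j\<le>l. p j v) \<le> \<bar>C\<bar> * (\<Sum>j\<le>max l1 l2. p j v)" if "l \<le> max l1 l2" for C l v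
      using that frechet_space_seminorm_nonneg[OF p]
      by (intro mult_mono sum_mono2 sum_nonneg) auto
    have "cmod (partial_derivs es (\<lambda>y. c * \<eta> v y (mat 1) + \<zeta> v y (mat 1)) x)
        \<le> (cmod c * \<bar>C1\<bar> + \<bar>C2\<bar>) * (\<Sum>j\<le>max l1 l2. p j v)" if "x \<in> K" for v x
    proof -
      have "x \<in> ?U" using K that by blast
      then have "partial_derivs es (\<lambda>y. c * \<eta> v y (mat 1) + \<zeta> v y (mat 1)) x
          = c * partial_derivs es (\<lambda>y. \<eta> v y (mat 1)) x + partial_derivs es (\<lambda>y. \<zeta> v y (mat 1)) x"
        using K by (intro partial_derivs_lincomb[OF U smooth]) auto
      also have "cmod \<dots> \<le> cmod c * cmod (partial_derivs es (\<lambda>y. \<eta> v y (mat 1)) x) + cmod (partial_derivs es (\<lambda>y. \<zeta> v y (mat 1)) x)"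
        by (metis norm_mult norm_triangle_ineq)
      also have "\<dots> \<le> cmod c * (\<bar>C1\<bar> * (\<Sum>j\<le>max l1 l2. p j v)) + \<bar>C2\<bar> * (\<Sum>j\<le>max l1 l2. p j v)"
        using order_trans[OF 1[OF that] mono[of l1 C1]] order_trans[OF 2[OF that] mono[of l2 C2]]
        by (intro add_mono mult_left_mono) auto
      finally show ?thesis by (simp add: algebra_simps)
    qed
    then show "\<exists>l C. \<forall>v. \<forall>x\<in>K. cmod (partial_derivs es (\<lambda>y. c * \<eta> v y (mat 1) + \<zeta> v y (mat 1)) x) \<le> C * (\<Sum>j\<le>l. p j v)"
      by blast
  next
    fix g v assume "g \<in> real_group G"
    then have "\<eta> (\<pi> g v) = pull_back (\<lambda>x. x v* real_mat (\<rho> (complex_mat g))) (\<eta> v)"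
      "\<zeta> (\<pi> g v) = pull_back (\<lambda>x. x v* real_mat (\<rho> (complex_mat g))) (\<zeta> v)"
      using \<eta> \<zeta> by (auto simp: hom_space_def)
    then show "(\<lambda>x M. c * \<eta> (\<pi> g v) x M + \<zeta> (\<pi> g v) x M) =
        pull_back (\<lambda>x. x v* real_mat (\<rho> (complex_mat g))) (\<lambda>x M. c * \<eta> v x M + \<zeta> v x M)"
      by (simp add: pull_back_def)
  qed
qed

lemma eta_subspace_sum:
  assumes N: "eta_subspace N" and b: "\<And>i. i \<in> I \<Longrightarrow> b i \<in> N"
  shows "(\<lambda>v x M. \<Sum>i\<in>I. c i * b i v x M) \<in> N"
  using b
proof (induction I rule: infinite_finite_induct)
  case (insert i I)
  then have "(\<lambda>v x M. c i * b i v x M + (\<Sum>i\<in>I. c i * b i v x M)) \<in> N"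
    using N by (auto simp: eta_subspace_def)
  then show ?case using insert by simp
qed (use N in \<open>auto simp: eta_subspace_def\<close>)

lemma linear_functional_sum:
  fixes T :: "('v, 'n) eta \<Rightarrow> complex"
  assumes N: "eta_subspace N" and b: "\<And>i. i \<in> I \<Longrightarrow> b i \<in> N"
    and T: "\<And>c \<eta> \<zeta>. \<eta> \<in> N \<Longrightarrow> \<zeta> \<in> N \<Longrightarrow> T (\<lambda>v x M. c * \<eta> v x M + \<zeta> v x M) = c * T \<eta> + T \<zeta>"
  shows "T (\<lambda>v x M. \<Sum>i\<in>I. c i * b i v x M) = (\<Sum>i\<in>I. c i * T (b i))"
proof -
  \<comment> \<open>Linearity with coefficient 1 at the zero map gives
    \<open>T 0 = T 0 + T 0\<close>.\<close>
  have 0: "T (\<lambda>v x M. 0) = 0"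
    using N T[of "\<lambda>v x M. 0" "\<lambda>v x M. 0" 1] by (auto simp: eta_subspace_def)
  show ?thesis
    using b
  proof (induction I rule: infinite_finite_induct)
    case (insert i I)
    have "T (\<lambda>v x M. c i * b i v x M + (\<Sum>i\<in>I. c i * b i v x M)) = c i * T (b i) + T (\<lambda>v x M. \<Sum>i\<in>I. c i * b i v x M)"
      using insert.prems by (intro T eta_subspace_sum[OF N]) auto
    then show ?case using insert by simp
  qed (use 0 in auto)
qed

lemma linear_map_sum:
  fixes T :: "('v, 'n) eta \<Rightarrow> ('v, 'n) eta"
  assumes N: "eta_subspace N" and b: "\<And>i. i \<in> I \<Longrightarrow> b i \<in> N"
    and T: "\<And>c \<eta> \<zeta>. \<eta> \<in> N \<Longrightarrow> \<zeta> \<in> N \<Longrightarrow> T (\<lambda>v x M. c * \<eta> v x M + \<zeta> v x M) = (\<lambda>v x M. c * T \<eta> v x M + T \<zeta> v x M)"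
  shows "T (\<lambda>v x M. \<Sum>i\<in>I. c i * b i v x M) = (\<lambda>v x M. \<Sum>i\<in>I. c i * T (b i) v x M)"
proof (intro ext)
  fix v x M
  show "T (\<lambda>v x M. \<Sum>i\<in>I. c i * b i v x M) v x M = (\<Sum>i\<in>I. c i * T (b i) v x M)"
    using linear_functional_sum[of N I b "\<lambda>\<eta>. T \<eta> v x M", OF N b] T by simp
qed

text \<open>Frames are scaled by \<open>inverse a\<close>, a matrix of determinant
  \<open>inverse a ^ CARD('n)\<close>; a half-density takes the square root of its absolute
  value.\<close>

lemma dilation_half_density:
  fixes \<phi> :: "'n::finite dens"
  assumes \<phi>: "density_on (1 / 2) U \<phi>"
  shows "dilation a \<phi> y M = of_real ((inverse \<bar>a\<bar> ^ CARD('n)) powr (1 / 2)) * \<phi> (inverse a *\<^sub>R y) M"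
proof -
  have "linear (\<lambda>y :: real ^ 'n. inverse a *\<^sub>R y)" by (rule linearI) (auto simp: algebra_simps)
  then have "dilation a \<phi> y M = \<phi> (inverse a *\<^sub>R y) (\<chi> i. inverse a *\<^sub>R M $ i)"
    by (simp add: dilation_def pull_back_linear)
  also have "(\<chi> i. inverse a *\<^sub>R M $ i) = mat (inverse a) ** M"
    by (simp add: vec_eq_iff matrix_matrix_mult_def mat_def if_distrib[of "\<lambda>x. x * _"] sum.delta cong: if_cong)
  also have "\<phi> (inverse a *\<^sub>R y) \<dots> = of_real (\<bar>det (mat (inverse a) :: real ^ 'n ^ 'n)\<bar> powr (1 / 2)) * \<phi> (inverse a *\<^sub>R y) M"
    using \<phi> unfolding density_on_def by blast
  also have "det (mat (inverse a) :: real ^ 'n ^ 'n) = inverse a ^ CARD('n)"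
    by (subst det_diagonal) (auto simp: mat_def)
  finally show ?thesis by (simp add: power_abs)
qed

text \<open>Scalar maps commute with the linear action and preserve the orbit, so equivariance
  survives; the continuity estimate is that of \<open>\<eta>\<close> on the rescaled compact set,
  with one factor \<open>inverse a\<close> per derivative.\<close>

lemma dilation_hom_space:
  fixes \<eta> :: "('v::ab_group_add, 'n::finite) eta"
  assumes \<eta>: "\<eta> \<in> hom_space G \<rho> Xp sc p \<pi>" and U: "open (real_points Xp)" and a: "a \<noteq> 0"
    and inv: "\<And>b x. b \<noteq> 0 \<Longrightarrow> x \<in> real_points Xp \<Longrightarrow> b *\<^sub>R x \<in> real_points Xp" and p: "frechet_space sc p"
  shows "dilation a \<circ> \<eta> \<in> hom_space G \<rho> Xp sc p \<pi>"
proof -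
  let ?U = "real_points Xp"
  define k where "k = complex_of_real ((inverse \<bar>a\<bar> ^ CARD('n)) powr (1 / 2))"
  have dens: "density_on (1 / 2) ?U (\<eta> v)" and smooth: "smooth_function ?U (\<lambda>x. \<eta> v x M)" for v M
    using \<eta> by (auto simp: hom_space_def smooth_half_densities_def)
  have eq: "dilation a (\<eta> v) = (\<lambda>y M. k * \<eta> v (inverse a *\<^sub>R y) M)" for v
    unfolding k_def using dilation_half_density[OF dens] by blast
  have inv_a: "inverse a *\<^sub>R x \<in> ?U" if "x \<in> ?U" for x using inv[OF _ that] a by simp
  have out: "\<eta> v (inverse a *\<^sub>R x) M = 0" if "x \<notin> ?U" for v x M
  proof -
    have "inverse a *\<^sub>R x \<notin> ?U" using inv[OF a, of "inverse a *\<^sub>R x"] a that by auto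
    then show ?thesis using dens by (simp add: density_on_def)
  qed
  show ?thesis
    unfolding hom_space_def o_def
  proof (intro CollectI conjI allI ballI impI)
    fix v show "dilation a (\<eta> v) \<in> smooth_half_densities ?U"
      using dens[of v] smooth_function_scale[OF U smooth inv_a] out
      unfolding eq by (auto simp: smooth_half_densities_def density_on_def)
  next
    fix d u v
    have "\<eta> (sc d u + v) = (\<lambda>x M. d * \<eta> u x M + \<eta> v x M)" using \<eta> by (auto simp: hom_space_def)
    then show "dilation a (\<eta> (sc d u + v)) = (\<lambda>x M. d * dilation a (\<eta> u) x M + dilation a (\<eta> v) x M)"
      unfolding dilation_def pull_back_def by simp
  next
    fix K es assume K: "compact K \<and> K \<subseteq> ?U \<and> set es \<subseteq> (Basis :: (real ^ 'n) set)"
    define K' where "K' = (\<lambda>x. inverse a *\<^sub>R x) ` K"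
    have "compact K'" unfolding K'_def using K by (intro compact_continuous_image continuous_intros) auto
    moreover have "K' \<subseteq> ?U" using K inv_a by (auto simp: K'_def)
    ultimately obtain l C where C: "\<And>v x. x \<in> K' \<Longrightarrow> cmod (partial_derivs es (\<lambda>y. \<eta> v y (mat 1)) x) \<le> C * (\<Sum>j\<le>l. p j v)"
      using hom_space_bound[OF \<eta>, of K' es] K by metis
    let ?C = "cmod (k * of_real (inverse a) ^ length es)"
    have "cmod (partial_derivs es (\<lambda>y. dilation a (\<eta> v) y (mat 1)) x) \<le> (?C * C) * (\<Sum>j\<le>l. p j v)" if "x \<in> K" for v x
    proof -
      have "x \<in> ?U" using K that by blast
      then have "partial_derivs es (\<lambda>y. dilation a (\<eta> v) y (mat 1)) x
          = k * of_real (inverse a) ^ length es * partial_derivs es (\<lambda>y. \<eta> v y (mat 1)) (inverse a *\<^sub>R x)"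
        unfolding eq using K by (intro partial_derivs_scale[OF U smooth inv_a]) auto
      then have "cmod (partial_derivs es (\<lambda>y. dilation a (\<eta> v) y (mat 1)) x)
          = ?C * cmod (partial_derivs es (\<lambda>y. \<eta> v y (mat 1)) (inverse a *\<^sub>R x))"
        by (simp only: norm_mult)
      also have "\<dots> \<le> ?C * (C * (\<Sum>j\<le>l. p j v))" using that by (intro mult_left_mono C) (auto simp: K'_def)
      finally show ?thesis by (simp only: mult.assoc)
    qed
    then show "\<exists>l C. \<forall>v. \<forall>x\<in>K. cmod (partial_derivs es (\<lambda>y. dilation a (\<eta> v) y (mat 1)) x) \<le> C * (\<Sum>j\<le>l. p j v)"
      by blast
  next
    fix g v assume "g \<in> real_group G"
    then have g: "\<eta> (\<pi> g v) = pull_back (\<lambda>x. x v* real_mat (\<rho> (complex_mat g))) (\<eta> v)"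
      using \<eta> by (auto simp: hom_space_def)
    have "linear (\<lambda>y :: real ^ 'n. inverse a *\<^sub>R y)" by (rule linearI) (auto simp: algebra_simps)
    then show "dilation a (\<eta> (\<pi> g v)) = pull_back (\<lambda>x. x v* real_mat (\<rho> (complex_mat g))) (dilation a (\<eta> v))"
      unfolding g dilation_def by (simp add: pull_back_linear linear_vector_matrix_mult scaleR_vector_matrix_assoc)
  qed
qed


section \<open>Zeta integrals\<close>

definition abs_power :: "('r::finite \<Rightarrow> ('n::finite, real) mpoly) \<Rightarrow> complex ^ 'r \<Rightarrow> real ^ 'n \<Rightarrow> complex" where
  "abs_power f s x = (\<Prod>i\<in>UNIV. of_real (cmod (mpoly_eval (complexify (f i)) (vec_nth (complex_vec x)))) powr (s $ i))"

lemma zeta_integrand_abs_power: "zeta_integrand f s \<eta> v \<xi> x M = \<eta> v x M * abs_power f s x * \<xi> x M"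
  by (simp add: zeta_integrand_def abs_power_def)

text \<open>Away from the zero loci the power is the exponential of a linear form in
  \<open>s\<close>, so it depends on \<open>s\<close> holomorphically everywhere.\<close>

lemma abs_power_exp:
  assumes "\<And>i. mpoly_eval (complexify (f i)) (vec_nth (complex_vec x)) \<noteq> 0"
  shows "abs_power f s x = exp (\<Sum>i\<in>UNIV. s $ i * of_real (ln (cmod (mpoly_eval (complexify (f i)) (vec_nth (complex_vec x))))))"
  using assms by (simp add: abs_power_def powr_def exp_sum Ln_of_real)

lemma continuous_on_ln_cmod_mpoly:
  assumes "\<And>x. x \<in> S \<Longrightarrow> mpoly_eval (complexify q) (vec_nth (complex_vec x)) \<noteq> 0"
  shows "continuous_on S (\<lambda>x :: real ^ 'n. ln (cmod (mpoly_eval (complexify q) (vec_nth (complex_vec x)))))"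
  using assms by (intro continuous_intros) (auto simp: complex_vec_def intro!: continuous_intros)

lemma continuous_on_abs_power:
  assumes "\<And>i x. x \<in> S \<Longrightarrow> mpoly_eval (complexify (f i)) (vec_nth (complex_vec x)) \<noteq> 0"
  shows "continuous_on S (abs_power f s)"
proof (rule continuous_on_eq)
  show "continuous_on S (\<lambda>x. exp (\<Sum>i\<in>UNIV. s $ i * of_real (ln (cmod (mpoly_eval (complexify (f i)) (vec_nth (complex_vec x)))))))"
    using assms by (intro continuous_intros continuous_on_ln_cmod_mpoly)
  fix x assume "x \<in> S"
  with assms have "\<And>i. mpoly_eval (complexify (f i)) (vec_nth (complex_vec x)) \<noteq> 0" by blast
  from abs_power_exp[OF this, where s = s]
  show "exp (\<Sum>i\<in>UNIV. s $ i * of_real (ln (cmod (mpoly_eval (complexify (f i)) (vec_nth (complex_vec x)))))) = abs_power f s x" by simp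
qed

lemma abs_power_nonzero:
  assumes "\<And>i. mpoly_eval (complexify (f i)) (vec_nth (complex_vec x)) \<noteq> 0"
  shows "abs_power f s x \<noteq> 0"
  using assms by (simp add: abs_power_exp)

text \<open>Differentiation under the integral over a compact box; complex linearity of the
  derivative of the integrand passes to the integral.\<close>

lemma holomorphic_vec_integral_exp:
  fixes w :: "'e::euclidean_space \<Rightarrow> complex" and l :: "'r::finite \<Rightarrow> 'e \<Rightarrow> real"
  assumes w: "continuous_on (cbox a b) w" and l: "\<And>i. continuous_on (cbox a b) (l i)"
  shows "holomorphic_vec UNIV (\<lambda>s :: complex ^ 'r. integral (cbox a b) (\<lambda>x. w x * exp (\<Sum>i\<in>UNIV. s $ i * of_real (l i x))))"
  unfolding holomorphic_vec_def
proof
  fix s0 :: "complex ^ 'r"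
  define E where "E = (\<lambda>(s :: complex ^ 'r) x. w x * exp (\<Sum>i\<in>UNIV. s $ i * of_real (l i x)))"
  define p where "p = (\<lambda>i. Blinfun (\<lambda>s :: complex ^ 'r. s $ i))"
  have p: "blinfun_apply (p i) s = s $ i" for i s
    unfolding p_def by (simp add: bounded_linear_vec_nth bounded_linear_Blinfun_apply)
  \<comment> \<open>The derivative in \<open>s\<close> is assembled from bounded linear maps, since
    the Leibniz rule asks for a continuous family of these.\<close>
  define E' where "E' = (\<lambda>s x. \<Sum>i\<in>UNIV. blinfun_mult_right (E s x * of_real (l i x)) o\<^sub>L p i)"
  have E': "blinfun_apply (E' s x) h = (\<Sum>i\<in>UNIV. E s x * of_real (l i x) * h $ i)" for s x h
    by (simp add: E'_def blinfun.sum_left p)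
  have contE: "continuous_on (UNIV \<times> cbox a b) (\<lambda>(s, x). E s x)"
  proof -
    have "continuous_on (UNIV \<times> cbox a b) (\<lambda>z :: (complex ^ 'r) \<times> 'e. h (snd z))" if "continuous_on (cbox a b) h" for h :: "'e \<Rightarrow> 'c::topological_space"
      by (rule continuous_on_compose2[OF that]) (auto intro!: continuous_intros)
    from this[OF w] this[OF l] show ?thesis
      unfolding E_def case_prod_unfold by (intro continuous_intros)
  qed
  have contE': "continuous_on (UNIV \<times> cbox a b) (\<lambda>(s, x). E' s x)"
  proof -
    have "continuous_on (UNIV \<times> cbox a b) (\<lambda>z :: (complex ^ 'r) \<times> 'e. l i (snd z))" for i
      by (rule continuous_on_compose2[OF l]) (auto intro!: continuous_intros)
    moreover have "continuous_on (UNIV \<times> cbox a b) (\<lambda>z. E (fst z) (snd z))"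
      using contE by (simp add: case_prod_unfold)
    ultimately show ?thesis
      unfolding E'_def case_prod_unfold
      by (intro continuous_intros bounded_bilinear.continuous_on[OF bounded_bilinear_blinfun_compose]
          bounded_linear.continuous_on[OF bounded_linear_blinfun_mult_right])
  qed
  have der: "((\<lambda>s. E s x) has_derivative blinfun_apply (E' s x)) (at s)" for s x
  proof -
    have "((\<lambda>s :: complex ^ 'r. \<Sum>i\<in>UNIV. s $ i * of_real (l i x)) has_derivative (\<lambda>h. \<Sum>i\<in>UNIV. h $ i * of_real (l i x))) (at s)"
      by (intro has_derivative_sum has_derivative_mult_left bounded_linear_imp_has_derivative bounded_linear_vec_nth)
    from has_derivative_compose[OF this, of exp]
    have "((\<lambda>s :: complex ^ 'r. exp (\<Sum>i\<in>UNIV. s $ i * of_real (l i x))) has_derivative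
        (\<lambda>h. exp (\<Sum>i\<in>UNIV. s $ i * of_real (l i x)) * (\<Sum>i\<in>UNIV. h $ i * of_real (l i x)))) (at s)"
      using DERIV_exp has_field_derivative_def by blast
    from has_derivative_mult_right[OF this, of "w x"]
    moreover have "blinfun_apply (E' s x) = (\<lambda>h. w x * (exp (\<Sum>i\<in>UNIV. s $ i * of_real (l i x)) * (\<Sum>i\<in>UNIV. h $ i * of_real (l i x))))"
      by (simp add: fun_eq_iff E' E_def sum_distrib_left sum_distrib_right mult_ac)
    ultimately show ?thesis unfolding E_def by simp
  qed
  have pair: "continuous_on (cbox a b) (\<lambda>x. (s, x))" "(\<lambda>x. (s, x)) ` cbox a b \<subseteq> UNIV \<times> cbox a b" for s :: "complex ^ 'r"
    by (intro continuous_intros) auto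
  have contE1: "continuous_on (cbox a b) (E s)" for s
    using continuous_on_compose2[OF contE pair] by simp
  have contE1': "continuous_on (cbox a b) (E' s)" for s
    using continuous_on_compose2[OF contE' pair] by simp
  have leib: "((\<lambda>s. integral (cbox a b) (E s)) has_derivative blinfun_apply (integral (cbox a b) (E' s0))) (at s0 within UNIV)"
  proof (rule leibniz_rule)
    show "((\<lambda>s. E s x) has_derivative blinfun_apply (E' s x)) (at s within UNIV)" for s x using der by simp
    show "E s integrable_on cbox a b" for s using contE1 by (rule integrable_continuous)
    show "continuous_on (UNIV \<times> cbox a b) (\<lambda>(s, x). E' s x)" by (rule contE')
  qed auto
  have "blinfun_apply (integral (cbox a b) (E' s0)) (c *s h) = c * blinfun_apply (integral (cbox a b) (E' s0)) h" for c h
  proof -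
    have ev: "blinfun_apply (integral (cbox a b) (E' s0)) h = integral (cbox a b) (\<lambda>x. blinfun_apply (E' s0 x) h)" for h
      by (rule blinfun_apply_integral[OF integrable_continuous[OF contE1']])
    have "blinfun_apply (E' s0 x) (c *s h) = c * blinfun_apply (E' s0 x) h" for x
      by (simp add: E' sum_distrib_left mult_ac)
    then show ?thesis by (simp add: ev)
  qed
  with leib show "\<exists>D. ((\<lambda>s. integral (cbox a b) (\<lambda>x. w x * exp (\<Sum>i\<in>UNIV. s $ i * of_real (l i x)))) has_derivative D) (at s0) \<and>
      (\<forall>c w. D (c *s w) = c * D w)"
    unfolding E_def by auto
qed

text \<open>Passes from the Lebesgue integral, used for densities, to the gauge integral over a box,
  used in the Leibniz rule.\<close>

lemma set_lebesgue_integral_cbox: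
  fixes q :: "'e::euclidean_space \<Rightarrow> complex"
  assumes "continuous_on (cbox a b) q" "cbox a b \<subseteq> U" "\<And>x. x \<in> U \<Longrightarrow> x \<notin> cbox a b \<Longrightarrow> q x = 0"
  shows "set_lebesgue_integral lborel U q = integral (cbox a b) q"
proof -
  have "set_lebesgue_integral lborel U q = set_lebesgue_integral lborel (cbox a b) q"
    unfolding set_lebesgue_integral_def using assms(2,3)
    by (intro Bochner_Integration.integral_cong) (auto simp: indicator_def)
  also have "\<dots> = integral (cbox a b) q"
    by (intro set_borel_integral_eq_integral(2)) (simp add: set_integrable_def borel_integrable_compact assms(1))
  finally show ?thesis .
qed

section \<open>Zeta integrals against bump functions\<close>

lemma hom_spaceD:
  assumes "\<eta> \<in> hom_space G \<rho> Xp sc p \<pi>"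
  shows "density_on (1 / 2) (real_points Xp) (\<eta> v)" "smooth_function (real_points Xp) (\<lambda>x. \<eta> v x M)"
  using assms by (auto simp: hom_space_def smooth_half_densities_def)

lemma density_on_mat_1:
  assumes "density_on \<alpha> U \<phi>" shows "\<phi> x M = of_real (\<bar>det M\<bar> powr \<alpha>) * \<phi> x (mat 1)"
proof -
  have "\<phi> x (M ** mat 1) = of_real (\<bar>det M\<bar> powr \<alpha>) * \<phi> x (mat 1)"
    using assms unfolding density_on_def by blast
  then show ?thesis by simp
qed

text \<open>The bump lives on a compact box inside the orbit, where no \<open>f i\<close> vanishes;
  so the integral makes sense for every \<open>s\<close> and is entire. It agrees with
  \<open>Z\<close> far to the right, hence generically.\<close>

lemma zeta_bump_continuation:
  fixes Xp :: "(complex ^ 'n::finite) set" and f :: "'r::finite \<Rightarrow> ('n, real) mpoly" and \<phi> :: "real ^ 'n \<Rightarrow> real"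
  assumes zeta: "zeta_continuation L f Xp N Z" and \<eta>: "\<eta> \<in> N"
    and U: "open (real_points Xp)" and smooth: "smooth_function (real_points Xp) (\<lambda>x. \<eta> v x (mat 1))"
    and nz: "\<And>x i. x \<in> real_points Xp \<Longrightarrow> mpoly_eval (complexify (f i)) (vec_nth (complex_vec x)) \<noteq> 0"
    and \<phi>: "schwartz_function (\<lambda>x. complex_of_real (\<phi> x))"
    and box: "cbox a b \<subseteq> real_points Xp" "\<And>x. x \<notin> cbox a b \<Longrightarrow> \<phi> x = 0"
  shows "holomorphic_vec UNIV (\<lambda>s. integral (cbox a b) (\<lambda>x. \<eta> v x (mat 1) * abs_power f s x * of_real (\<phi> x)))"
    and "generically (\<lambda>s. Z (L s) \<eta> v (half_density (\<lambda>x. of_real (\<phi> x))) =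
      integral (cbox a b) (\<lambda>x. \<eta> v x (mat 1) * abs_power f s x * of_real (\<phi> x)))"
proof -
  let ?I = "\<lambda>s. integral (cbox a b) (\<lambda>x. \<eta> v x (mat 1) * abs_power f s x * of_real (\<phi> x))"
  let ?U = "real_points Xp"
  let ?\<xi> = "half_density (\<lambda>x. complex_of_real (\<phi> x))"
  have \<xi>: "?\<xi> \<in> schwartz_half_densities" using \<phi> by (auto simp: schwartz_half_densities_def)
  have cont\<eta>: "continuous_on (cbox a b) (\<lambda>x. \<eta> v x (mat 1))"
    using smooth_function_partial_derivs(1)[OF smooth U, of "[]"] box(1)
    by (intro continuous_at_imp_continuous_on) auto
  have cont\<phi>: "continuous_on (cbox a b) (\<lambda>x. complex_of_real (\<phi> x))"
    using schwartz_function_continuous[OF \<phi>] continuous_on_subset by blast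
  have contF: "continuous_on (cbox a b) (abs_power f s)" for s
    using nz box(1) by (intro continuous_on_abs_power) auto
  have I: "?I s = integral (cbox a b) (\<lambda>x. \<eta> v x (mat 1) * of_real (\<phi> x) *
      exp (\<Sum>i\<in>UNIV. s $ i * of_real (ln (cmod (mpoly_eval (complexify (f i)) (vec_nth (complex_vec x)))))))" for s
  proof (rule integral_cong)
    fix x assume "x \<in> cbox a b"
    then have "abs_power f s x = exp (\<Sum>i\<in>UNIV. s $ i * of_real (ln (cmod (mpoly_eval (complexify (f i)) (vec_nth (complex_vec x))))))"
      using nz box(1) by (intro abs_power_exp) auto
    then show "\<eta> v x (mat 1) * abs_power f s x * of_real (\<phi> x) = \<eta> v x (mat 1) * of_real (\<phi> x) *
        exp (\<Sum>i\<in>UNIV. s $ i * of_real (ln (cmod (mpoly_eval (complexify (f i)) (vec_nth (complex_vec x))))))"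
      by (simp only: mult_ac)
  qed
  show hol: "holomorphic_vec UNIV ?I"
    unfolding I using nz box(1)
    by (intro holomorphic_vec_integral_exp continuous_on_mult cont\<eta> cont\<phi> continuous_on_ln_cmod_mpoly) auto
  have mero: "meromorphic_vec (\<lambda>s. Z (L s) \<eta> v ?\<xi>)"
    using zeta \<xi> \<eta> unfolding zeta_continuation_def by blast
  obtain \<kappa> where \<kappa>: "\<And>s. (\<forall>i. Re (s $ i) > \<kappa>) \<Longrightarrow> Z (L s) \<eta> v ?\<xi> = density_integral ?U (zeta_integrand f s \<eta> v ?\<xi>)"
    using zeta \<xi> \<eta> unfolding zeta_continuation_def by meson
  have "density_integral ?U (zeta_integrand f s \<eta> v ?\<xi>) = ?I s" for s
    unfolding density_integral_def zeta_integrand_abs_power half_density_mat_1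
    using box by (intro set_lebesgue_integral_cbox continuous_on_mult cont\<eta> cont\<phi> contF) auto
  with \<kappa> have eq: "Z (L s) \<eta> v ?\<xi> = ?I s" if "s \<in> {s. \<forall>i. Re (s $ i) > \<kappa>}" for s :: "complex ^ 'r"
    using that by simp
  show "generically (\<lambda>s. Z (L s) \<eta> v ?\<xi> = ?I s)"
    by (rule meromorphic_vec_eq[OF mero meromorphic_vec_holomorphic[OF hol] open_right_halfspaces right_halfspaces_nonempty eq])
qed

lemma cube_in_open:
  fixes x :: "real ^ 'n"
  assumes "open S" "x \<in> S"
  obtains d where "d > 0" "cbox (x - (\<chi> i. d)) (x + (\<chi> i. d)) \<subseteq> S"
proof -
  obtain e where e: "e > 0" "cball x e \<subseteq> S" using assms open_contains_cball by blast
  \<comment> \<open>A vector with entries of size at most \<open>d\<close> has 1-norm at most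
    \<open>CARD('n) * d = e\<close>.\<close>
  define d where "d = e / real CARD('n)"
  have d: "d > 0" using e by (simp add: d_def)
  have "cbox (x - (\<chi> i. d)) (x + (\<chi> i. d)) \<subseteq> cball x e"
  proof
    fix y assume "y \<in> cbox (x - (\<chi> i. d)) (x + (\<chi> i. d))"
    then have "x $ i - d \<le> y $ i \<and> y $ i \<le> x $ i + d" for i by (simp add: mem_box_cart)
    then have *: "\<bar>(y - x) $ i\<bar> \<le> d" for i by (simp add: abs_le_iff) (metis add.commute diff_le_eq)
    have "norm (y - x) \<le> (\<Sum>i\<in>UNIV. \<bar>(y - x) $ i\<bar>)" by (rule norm_le_l1_cart)
    also have "\<dots> \<le> (\<Sum>i\<in>(UNIV :: 'n set). d)" by (intro sum_mono *)
    also have "\<dots> = e" by (simp add: d_def)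
    finally show "y \<in> cball x e" by (simp add: dist_norm norm_minus_commute)
  qed
  with e d show ?thesis using that by blast
qed

text \<open>
  The combination vanishes at every point where its coefficients are continuous: against bump functions
  the zeta integrals are entire, so an identity that holds generically holds there.
\<close>

lemma zeta_separates:
  fixes \<rho> :: "complex ^ 'm::finite ^ 'm \<Rightarrow> complex ^ 'n::finite ^ 'n" and f :: "'r::finite \<Rightarrow> ('n, real) mpoly"
  assumes N: "N = hom_space G \<rho> Xp sc p \<pi>" and zeta: "zeta_continuation L f Xp N Z"
    and U: "open (real_points Xp)" and p: "frechet_space sc p"
    and nz: "\<And>x i. x \<in> real_points Xp \<Longrightarrow> mpoly_eval (complexify (f i)) (vec_nth (complex_vec x)) \<noteq> 0"
    and I: "finite I" and b: "\<And>i. i \<in> I \<Longrightarrow> b i \<in> N" and c: "\<And>i. i \<in> I \<Longrightarrow> meromorphic_vec (c i)"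
    and zero: "\<And>v \<xi>. \<xi> \<in> schwartz_half_densities \<Longrightarrow>
      generically (\<lambda>s. Z (L s) (\<lambda>v x M. \<Sum>i\<in>I. c i s * b i v x M) v \<xi> = 0)"
  shows "generically (\<lambda>s. (\<lambda>v x M. \<Sum>i\<in>I. c i s * b i v x M) = (\<lambda>v x M. 0))"
proof -
  let ?U = "real_points Xp"
  have sub: "eta_subspace N" unfolding N by (rule hom_space_subspace[OF U p])
  define D where "D = (\<lambda>s v x M. \<Sum>i\<in>I. c i s * b i v x M)"
  have reg: "generically (\<lambda>s. \<forall>i\<in>I. \<exists>e>0. continuous_on (ball s e) (c i))"
    by (intro generically_ball I meromorphic_vec_regular c)
  \<comment> \<open>The exceptional set is that of the coefficients only; it is the same for all
    \<open>v\<close>, \<open>x\<close> and \<open>M\<close>.\<close>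
  have "D s v x M = 0" if s: "\<forall>i\<in>I. \<exists>e>0. continuous_on (ball s e) (c i)" for s v x M
  proof -
    have DN: "D s \<in> hom_space G \<rho> Xp sc p \<pi>"
      unfolding D_def N[symmetric] by (rule eta_subspace_sum[OF sub b])
    have "D s v x (mat 1) = 0"
    proof (rule ccontr)
      assume ne: "D s v x (mat 1) \<noteq> 0"
      then have x: "x \<in> ?U" using hom_spaceD(1)[OF DN, of v] by (auto simp: density_on_def)
      define W where "W = (\<lambda>y. D s v y (mat 1) * abs_power f s y)"
      have contW: "continuous_on ?U W"
        unfolding W_def using smooth_function_partial_derivs(1)[OF hom_spaceD(2)[OF DN] U, of "[]"] nz
        by (intro continuous_on_mult continuous_on_abs_power continuous_at_imp_continuous_on) auto
      \<comment> \<open>Rotation by \<open>cnj (W x)\<close> makes the real part positive at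
        \<open>x\<close>, hence on a small cube, so that a nonnegative bump there cannot integrate
        to zero.\<close>
      define k where "k = (\<lambda>y. Re (cnj (W x) * W y))"
      have contk: "continuous_on ?U k" unfolding k_def by (intro continuous_intros contW)
      have "W x \<noteq> 0" using ne abs_power_nonzero[of f x s] nz[OF x] by (auto simp: W_def)
      moreover have "k x = (cmod (W x))\<^sup>2"
        using complex_norm_square[of "W x"] by (simp only: k_def mult.commute[of "cnj (W x)"]) (metis Re_complex_of_real)
      ultimately have kx: "k x > 0" by simp
      have "open (?U \<inter> k -` {0<..})" by (rule continuous_open_preimage[OF contk U]) simp
      moreover have "x \<in> ?U \<inter> k -` {0<..}" using x kx by simp
      ultimately obtain d where d: "d > 0" "cbox (x - (\<chi> i. d)) (x + (\<chi> i. d)) \<subseteq> ?U \<inter> k -` {0<..}"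
        by (rule cube_in_open)
      define lo where "lo = x - (\<chi> i. d)"
      define hi where "hi = x + (\<chi> i. d)"
      have box: "cbox lo hi \<subseteq> ?U" and kpos: "\<And>y. y \<in> cbox lo hi \<Longrightarrow> k y > 0"
        using d by (auto simp: lo_def hi_def)
      obtain \<phi> :: "real ^ 'n \<Rightarrow> real" where \<phi>: "schwartz_function (\<lambda>x. complex_of_real (\<phi> x))"
        "\<And>y. \<phi> y \<ge> 0" "\<And>y. \<phi> y \<noteq> 0 \<longleftrightarrow> (\<forall>i. \<bar>y $ i - x $ i\<bar> < d)"
        using schwartz_bump_exists[OF d(1), of x] by metis
      have out: "\<phi> y = 0" if "y \<notin> cbox lo hi" for y
      proof (rule ccontr)
        assume "\<phi> y \<noteq> 0"
        then have "\<bar>y $ i - x $ i\<bar> < d" for i using \<phi>(3) by blast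
        then have "lo $ i \<le> y $ i \<and> y $ i \<le> hi $ i" for i
          unfolding lo_def hi_def by (simp add: abs_less_iff) (metis add.commute diff_le_eq less_imp_le less_diff_eq diff_less_eq)
        then show False using that by (simp add: mem_box_cart)
      qed
      let ?\<xi> = "half_density (\<lambda>x. complex_of_real (\<phi> x))"
      have \<xi>: "?\<xi> \<in> schwartz_half_densities" using \<phi>(1) by (auto simp: schwartz_half_densities_def)
      define J where "J = (\<lambda>i t. integral (cbox lo hi) (\<lambda>x. b i v x (mat 1) * abs_power f t x * of_real (\<phi> x)))"
      have smooth_b: "smooth_function ?U (\<lambda>x. b i v x M)" if "i \<in> I" for i M
        using b[OF that] hom_spaceD(2) unfolding N by blast
      note bump = zeta_bump_continuation[OF zeta b U smooth_b nz \<phi>(1) box out]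
      have holJ: "holomorphic_vec UNIV (J i)" if "i \<in> I" for i
        unfolding J_def by (rule bump(1)[OF that that])
      have genJ: "generically (\<lambda>t. \<forall>i\<in>I. Z (L t) (b i) v ?\<xi> = J i t)"
        unfolding J_def by (intro generically_ball I bump(2))
      have lin: "Z (L t) (\<lambda>v x M. c * \<eta> v x M + \<zeta> v x M) v ?\<xi> = c * Z (L t) \<eta> v ?\<xi> + Z (L t) \<zeta> v ?\<xi>"
        if "\<eta> \<in> N" "\<zeta> \<in> N" for t c \<eta> \<zeta>
        using zeta \<xi> that unfolding zeta_continuation_def by blast
      have "Z (L t) (D t) v ?\<xi> = (\<Sum>i\<in>I. c i t * Z (L t) (b i) v ?\<xi>)" for t
        unfolding D_def by (rule linear_functional_sum[OF sub b lin])
      then have "generically (\<lambda>t. (\<Sum>i\<in>I. c i t * Z (L t) (b i) v ?\<xi>) = 0)"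
        using zero[OF \<xi>, of v] by (simp add: D_def)
      from generically_conj[OF this genJ]
      have gen: "generically (\<lambda>t. (\<Sum>i\<in>I. c i t * J i t) = 0)"
      proof (rule generically_mono)
        fix t assume "(\<Sum>i\<in>I. c i t * Z (L t) (b i) v ?\<xi>) = 0 \<and> (\<forall>i\<in>I. Z (L t) (b i) v ?\<xi> = J i t)"
        note t = this
        have "(\<Sum>i\<in>I. c i t * J i t) = (\<Sum>i\<in>I. c i t * Z (L t) (b i) v ?\<xi>)"
          using t by (intro sum.cong) auto
        also have "\<dots> = 0" using t by blast
        finally show "(\<Sum>i\<in>I. c i t * J i t) = 0" .
      qed
      \<comment> \<open>Near \<open>s\<close> the coefficients are continuous and the
        \<open>J i\<close> are entire, so a nonzero value would persist on an open set, where the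
        generic identity excludes it.\<close>
      have "(\<Sum>i\<in>I. c i s * J i s) = 0"
      proof (rule ccontr)
        assume ne: "(\<Sum>i\<in>I. c i s * J i s) \<noteq> 0"
        obtain e where e: "\<And>i. i \<in> I \<Longrightarrow> e i > 0" "\<And>i. i \<in> I \<Longrightarrow> continuous_on (ball s (e i)) (c i)"
          using s by metis
        define V where "V = (\<Inter>i\<in>I. ball s (e i))"
        have V: "open V" "s \<in> V" using e(1) I by (auto simp: V_def)
        have "continuous_on V (c i)" if "i \<in> I" for i
          using e(2)[OF that] that by (auto simp: V_def intro: continuous_on_subset)
        moreover have "continuous_on V (J i)" if "i \<in> I" for i
          using holomorphic_vec_continuous_on[OF holJ[OF that]] continuous_on_subset by blast
        ultimately have "continuous_on V (\<lambda>t. \<Sum>i\<in>I. c i t * J i t)" by (intro continuous_intros)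
        then have "open (V \<inter> (\<lambda>t. \<Sum>i\<in>I. c i t * J i t) -` (- {0}))"
          by (rule continuous_open_preimage) (use V in auto)
        moreover have "s \<in> V \<inter> (\<lambda>t. \<Sum>i\<in>I. c i t * J i t) -` (- {0})" using V ne by simp
        ultimately obtain t where "t \<in> V \<inter> (\<lambda>t. \<Sum>i\<in>I. c i t * J i t) -` (- {0})" "(\<Sum>i\<in>I. c i t * J i t) = 0"
          using generically_dense[OF gen] by blast
        then show False by simp
      qed
      moreover have "(\<Sum>i\<in>I. c i s * J i s) = integral (cbox lo hi) (\<lambda>y. W y * of_real (\<phi> y))"
      proof -
        have cont\<phi>: "continuous_on (cbox lo hi) (\<lambda>x. complex_of_real (\<phi> x))"
          using schwartz_function_continuous[OF \<phi>(1)] continuous_on_subset by blast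
        have "continuous_on (cbox lo hi) (\<lambda>x. b i v x (mat 1) * abs_power f s x * of_real (\<phi> x))" if "i \<in> I" for i
          using smooth_function_partial_derivs(1)[OF smooth_b[OF that] U, of "[]"] nz box
          by (intro continuous_on_mult cont\<phi> continuous_on_abs_power continuous_at_imp_continuous_on) auto
        then have int: "(\<lambda>x. c i s * (b i v x (mat 1) * abs_power f s x * of_real (\<phi> x))) integrable_on cbox lo hi" if "i \<in> I" for i
          using that by (intro integrable_continuous continuous_on_mult_left)
        have "(\<Sum>i\<in>I. c i s * J i s) = (\<Sum>i\<in>I. integral (cbox lo hi) (\<lambda>x. c i s * (b i v x (mat 1) * abs_power f s x * of_real (\<phi> x))))"
          by (simp add: J_def)
        also have "\<dots> = integral (cbox lo hi) (\<lambda>x. \<Sum>i\<in>I. c i s * (b i v x (mat 1) * abs_power f s x * of_real (\<phi> x)))"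
          by (rule integral_sum[symmetric, OF I int])
        also have "\<dots> = integral (cbox lo hi) (\<lambda>y. W y * of_real (\<phi> y))"
          by (simp add: W_def D_def sum_distrib_right sum_distrib_left mult_ac)
        finally show ?thesis .
      qed
      ultimately have 0: "integral (cbox lo hi) (\<lambda>y. W y * of_real (\<phi> y)) = 0" by simp
      have cont\<phi>: "continuous_on (cbox lo hi) \<phi>"
        using continuous_on_Re[OF schwartz_function_continuous[OF \<phi>(1)]] continuous_on_subset by auto
      have contW': "continuous_on (cbox lo hi) W" using contW box continuous_on_subset by blast
      have "((\<lambda>y. W y * of_real (\<phi> y)) has_integral 0) (cbox lo hi)"
        using 0 integrable_integral[OF integrable_continuous[of lo hi "\<lambda>y. W y * of_real (\<phi> y)"]] contW' cont\<phi>
        by (simp add: continuous_on_mult continuous_on_of_real)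
      from has_integral_mult_right[OF this, of "cnj (W x)"]
      have "((\<lambda>y. cnj (W x) * (W y * of_real (\<phi> y))) has_integral 0) (cbox lo hi)" by simp
      from has_integral_linear[OF this bounded_linear_Re]
      have "((\<lambda>y. k y * \<phi> y) has_integral 0) (cbox lo hi)"
        by (simp add: o_def k_def mult.assoc[symmetric] del: times_complex.sel flip: Re_complex_of_real) (simp add: k_def algebra_simps)
      moreover have "continuous_on (cbox lo hi) (\<lambda>y. k y * \<phi> y)"
        using contk box cont\<phi> by (intro continuous_on_mult) (auto intro: continuous_on_subset)
      moreover have "x \<in> box lo hi" using d(1) by (simp add: lo_def hi_def mem_box_cart)
      ultimately have "k x * \<phi> x = 0"
        using kpos \<phi>(2) box_subset_cbox[of lo hi] by (intro has_integral_0_cbox_imp_0[of lo hi "\<lambda>y. k y * \<phi> y"]) (auto simp: less_imp_le)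
      moreover have "\<phi> x \<noteq> 0" using \<phi>(3)[of x] d(1) by simp
      ultimately show False using kx by simp
    qed
    \<comment> \<open>A half-density is determined by its values on the standard frame.\<close>
    then show ?thesis using density_on_mat_1[OF hom_spaceD(1)[OF DN], of v x M] by simp
  qed
  then have "generically (\<lambda>s. D s = (\<lambda>v x M. 0))"
    by (intro generically_mono[OF reg]) (simp add: fun_eq_iff)
  then show ?thesis by (simp add: D_def)
qed

section \<open>The functional equation under dilations\<close>

text \<open>Homogeneity of each factor; the exponents \<open>s $ i\<close> times the degrees add
  up.\<close>

lemma abs_power_scale:
  fixes f :: "'r::finite \<Rightarrow> ('n::finite, real) mpoly"
  assumes a: "a \<noteq> 0" and nz: "\<And>i. mpoly_eval (complexify (f i)) (vec_nth (complex_vec x)) \<noteq> 0"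
    and hom: "\<And>i. mpoly_eval (complexify (f i)) (vec_nth (of_real a *s complex_vec x)) =
      of_real a ^ total_degree (f i) * mpoly_eval (complexify (f i)) (vec_nth (complex_vec x))"
  shows "abs_power f s (a *\<^sub>R x) = of_real \<bar>a\<bar> powr (\<Sum>i\<in>UNIV. s $ i * of_nat (total_degree (f i))) * abs_power f s x"
proof -
  define F where "F = (\<lambda>i. mpoly_eval (complexify (f i)) (vec_nth (complex_vec x)))"
  have vec: "complex_vec (a *\<^sub>R x) = of_real a *s complex_vec x" by (simp add: complex_vec_def vec_eq_iff)
  have eval: "cmod (mpoly_eval (complexify (f i)) (vec_nth (complex_vec (a *\<^sub>R x)))) = \<bar>a\<bar> ^ total_degree (f i) * cmod (F i)" for i
    unfolding vec hom F_def by (simp add: norm_mult norm_power)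
  have F: "F i \<noteq> 0" for i using nz by (simp add: F_def)
  have ln: "ln (\<bar>a\<bar> ^ total_degree (f i) * cmod (F i)) = real (total_degree (f i)) * ln \<bar>a\<bar> + ln (cmod (F i))" for i
    using a F[of i] by (simp add: ln_mult ln_realpow)
  have "abs_power f s (a *\<^sub>R x) = exp (\<Sum>i\<in>UNIV. s $ i * of_real (ln (\<bar>a\<bar> ^ total_degree (f i) * cmod (F i))))"
  proof -
    have "cmod (mpoly_eval (complexify (f i)) (vec_nth (complex_vec (a *\<^sub>R x)))) \<noteq> 0" for i
      unfolding eval using a F by simp
    then have "mpoly_eval (complexify (f i)) (vec_nth (complex_vec (a *\<^sub>R x))) \<noteq> 0" for i
      by (simp only: norm_eq_zero) simp
    from abs_power_exp[OF this] show ?thesis unfolding eval .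
  qed
  also have "\<dots> = exp ((\<Sum>i\<in>UNIV. s $ i * of_nat (total_degree (f i))) * of_real (ln \<bar>a\<bar>)) * exp (\<Sum>i\<in>UNIV. s $ i * of_real (ln (cmod (F i))))"
  proof -
    have "(\<Sum>i\<in>UNIV. s $ i * complex_of_real (real (total_degree (f i)) * ln \<bar>a\<bar> + ln (cmod (F i))))
      = (\<Sum>i\<in>UNIV. s $ i * of_nat (total_degree (f i))) * of_real (ln \<bar>a\<bar>) + (\<Sum>i\<in>UNIV. s $ i * of_real (ln (cmod (F i))))"
      by (simp add: sum_distrib_right sum_distrib_left sum.distrib distrib_left mult_ac)
    then show ?thesis unfolding ln by (simp only: exp_add)
  qed
  also have "exp ((\<Sum>i\<in>UNIV. s $ i * of_nat (total_degree (f i))) * of_real (ln \<bar>a\<bar>)) = of_real \<bar>a\<bar> powr (\<Sum>i\<in>UNIV. s $ i * of_nat (total_degree (f i)))"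
    using a by (simp add: powr_def Ln_of_real)
  also have "exp (\<Sum>i\<in>UNIV. s $ i * of_real (ln (cmod (F i)))) = abs_power f s x"
    using nz by (simp add: abs_power_exp F_def)
  finally show ?thesis .
qed

text \<open>In the substitution of \<open>a *\<^sub>R y\<close> for \<open>y\<close> the Jacobian
  contributes the exponent \<open>- n\<close>, division by the half-density factor contributes
  \<open>n / 2\<close>, and homogeneity contributes \<open>- d\<close>; together
  \<open>- d - n / 2\<close>.\<close>

lemma zeta_integral_dilation:
  fixes f :: "'r::finite \<Rightarrow> ('n::finite, real) mpoly" and \<eta> :: "('v, 'n) eta" and w :: "real ^ 'n \<Rightarrow> complex"
  assumes a: "a \<noteq> 0" and dens: "density_on (1 / 2) U (\<eta> v)"
    and inv: "\<And>b x. b \<noteq> 0 \<Longrightarrow> x \<in> U \<Longrightarrow> b *\<^sub>R x \<in> U"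
    and nz: "\<And>i x. x \<in> U \<Longrightarrow> mpoly_eval (complexify (f i)) (vec_nth (complex_vec x)) \<noteq> 0"
    and hom: "\<And>i x. x \<in> U \<Longrightarrow> mpoly_eval (complexify (f i)) (vec_nth (of_real a *s complex_vec x)) =
      of_real a ^ total_degree (f i) * mpoly_eval (complexify (f i)) (vec_nth (complex_vec x))"
    and int: "density_integrable U (zeta_integrand f s (dilation a \<circ> \<eta>) v (half_density w))"
  shows "density_integral U (zeta_integrand f s \<eta> v (half_density (\<lambda>y. w (a *\<^sub>R y)))) =
    of_real \<bar>a\<bar> powr (- (\<Sum>i\<in>UNIV. s $ i * of_nat (total_degree (f i))) - of_nat CARD('n) / 2) *
    density_integral U (zeta_integrand f s (dilation a \<circ> \<eta>) v (half_density w))"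
proof -
  define n where "n = CARD('n)"
  define d where "d = (\<Sum>i\<in>UNIV. s $ i * of_nat (total_degree (f i)))"
  define H where "H = (\<lambda>y. indicator U y *\<^sub>R (\<eta> v y (mat 1) * abs_power f s y * w (a *\<^sub>R y)))"
  define K where "K = (\<lambda>y. indicator U y *\<^sub>R ((dilation a \<circ> \<eta>) v y (mat 1) * abs_power f s y * w y))"
  define c where "c = complex_of_real ((inverse \<bar>a\<bar> ^ n) powr (1 / 2)) * of_real \<bar>a\<bar> powr d"
  have HK: "K (a *\<^sub>R y) = c * H y" for y
  proof (cases "y \<in> U")
    case True
    have "(dilation a \<circ> \<eta>) v (a *\<^sub>R y) (mat 1) = of_real ((inverse \<bar>a\<bar> ^ n) powr (1 / 2)) * \<eta> v y (mat 1)"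
      using a by (simp add: dilation_half_density[OF dens] n_def)
    moreover have "abs_power f s (a *\<^sub>R y) = of_real \<bar>a\<bar> powr d * abs_power f s y"
      unfolding d_def using True by (intro abs_power_scale a nz hom)
    ultimately show ?thesis using True inv[OF a True] by (simp add: K_def H_def c_def mult_ac)
  next
    case False
    then have "a *\<^sub>R y \<notin> U" using inv[of "inverse a" "a *\<^sub>R y"] a by auto
    with False show ?thesis by (simp add: K_def H_def)
  qed
  have "integrable lborel K"
    using int unfolding density_integrable_def set_integrable_def zeta_integrand_abs_power half_density_mat_1 K_def .
  then have [measurable]: "K \<in> borel_measurable borel" using borel_measurable_integrable[of lborel K] by simp
  have "c * (\<integral>y. H y \<partial>lborel) = (\<integral>y. K (a *\<^sub>R y) \<partial>lborel)" by (simp add: HK)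
  also have "\<dots> = inverse (\<bar>a\<bar> ^ n) *\<^sub>R (\<integral>y. K y \<partial>lborel)"
    unfolding n_def using a by (subst lborel_integral_scale) auto
  finally have main: "c * (\<integral>y. H y \<partial>lborel) = inverse (\<bar>a\<bar> ^ n) *\<^sub>R (\<integral>y. K y \<partial>lborel)" .
  \<comment> \<open>All powers become exponentials of multiples of \<open>ln \<bar>a\<bar>\<close>,
    which turns the bookkeeping of exponents into addition.\<close>
  define l where "l = complex_of_real (ln \<bar>a\<bar>)"
  have pw: "of_real \<bar>a\<bar> powr z = exp (z * l)" for z :: complex
    using a by (simp add: powr_def Ln_of_real l_def)
  have c: "c = exp (d * l - of_nat n / 2 * l)"
  proof -
    have "(inverse \<bar>a\<bar> ^ n) powr (1 / 2) = exp (- (real n / 2 * ln \<bar>a\<bar>))"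
      using a by (simp add: powr_def ln_realpow ln_inverse)
    then have "complex_of_real ((inverse \<bar>a\<bar> ^ n) powr (1 / 2)) = exp (- (of_nat n / 2 * l))"
      by (simp add: l_def flip: exp_of_real)
    then show ?thesis unfolding c_def pw by (simp add: exp_add[symmetric] algebra_simps)
  qed
  have an: "complex_of_real (inverse (\<bar>a\<bar> ^ n)) = exp (- (of_nat n * l))"
  proof -
    have "inverse (\<bar>a\<bar> ^ n) = exp (- (real n * ln \<bar>a\<bar>))"
      using a by (simp add: exp_minus exp_of_nat_mult)
    then show ?thesis by (simp add: l_def flip: exp_of_real)
  qed
  have "(\<integral>y. H y \<partial>lborel) = exp (- (d * l - of_nat n / 2 * l)) * (c * (\<integral>y. H y \<partial>lborel))"
    unfolding c mult.assoc[symmetric] exp_add[symmetric] by simp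
  also have "\<dots> = exp (- (d * l - of_nat n / 2 * l)) * exp (- (of_nat n * l)) * (\<integral>y. K y \<partial>lborel)"
    unfolding main scaleR_conv_of_real an by (simp only: mult.assoc)
  also have "exp (- (d * l - of_nat n / 2 * l)) * exp (- (of_nat n * l)) = exp ((- d - of_nat n / 2) * l)"
    unfolding exp_add[symmetric] by (rule arg_cong[where f = exp]) (simp add: field_simps)
  finally show ?thesis
    unfolding density_integral_def set_lebesgue_integral_def zeta_integrand_abs_power half_density_mat_1
    unfolding H_def K_def pw d_def n_def .
qed

text \<open>The exponent is affine in \<open>s\<close>, so the power is entire. \<open>T\<close> is
  the identity in the dual chart and the chart change in the other one.\<close>

lemma meromorphic_vec_powr_linear:
  fixes d :: "complex ^ 'r \<Rightarrow> complex" and T :: "complex ^ 'r \<Rightarrow> complex ^ 'k"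
  assumes "\<And>s. d s = (\<Sum>i\<in>UNIV. T s $ i * k i)" and T: "complex_linear T" and a: "a \<noteq> 0"
  shows "meromorphic_vec (\<lambda>s. of_real \<bar>a\<bar> powr (- d s - z))"
proof (rule meromorphic_vec_holomorphic)
  define l where "l = complex_of_real (ln \<bar>a\<bar>)"
  have eq: "of_real \<bar>a\<bar> powr (- d s - z) = exp ((- d s - z) * l)" for s
    using a by (simp add: powr_def Ln_of_real l_def)
  show "holomorphic_vec UNIV (\<lambda>s. of_real \<bar>a\<bar> powr (- d s - z))"
    unfolding eq holomorphic_vec_def
  proof
    fix s
    have "linear T" using T by (simp add: complex_linear_def)
    then have "(T has_derivative T) (at s)" by (rule linear_imp_has_derivative)
    then have "((\<lambda>s. T s $ i) has_derivative (\<lambda>h. T h $ i)) (at s)" for i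
      by (rule bounded_linear.has_derivative[OF bounded_linear_vec_nth])
    then have "(d has_derivative (\<lambda>h. \<Sum>i\<in>UNIV. T h $ i * k i)) (at s)"
      unfolding assms(1)[abs_def] by (intro has_derivative_sum has_derivative_mult_left)
    then have "(d has_derivative d) (at s)" by (simp add: assms(1)[abs_def])
    then have "((\<lambda>s. (- d s - z) * l) has_derivative (\<lambda>h. - d h * l)) (at s)"
      by (auto intro!: derivative_eq_intros)
    from has_derivative_compose[OF this, of exp]
    have "((\<lambda>s. exp ((- d s - z) * l)) has_derivative (\<lambda>h. exp ((- d s - z) * l) * (- d h * l))) (at s)"
      using DERIV_exp has_field_derivative_def by blast
    moreover have "d (c *s h) = c * d h" for c h
      using T by (simp add: assms(1) complex_linear_def sum_distrib_left mult.assoc)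
    ultimately show "\<exists>D. ((\<lambda>s. exp ((- d s - z) * l)) has_derivative D) (at s) \<and> (\<forall>c w. D (c *s w) = c * D w)"
      by (intro exI[of _ "\<lambda>h. exp ((- d s - z) * l) * (- d h * l)"]) (simp add: mult_ac)
  qed
qed

text \<open>The change of variables is available where both sides are convergent integrals; the
  identity theorem carries it to the whole parameter space.\<close>

lemma zeta_continuation_dilation:
  fixes \<rho> :: "complex ^ 'm::finite ^ 'm \<Rightarrow> complex ^ 'n::finite ^ 'n" and f :: "'r::finite \<Rightarrow> ('n, real) mpoly"
  assumes N: "N = hom_space G \<rho> Xp sc p \<pi>" and zeta: "zeta_continuation L f Xp N Z"
    and a: "a \<noteq> 0" and \<eta>: "\<eta> \<in> N" and \<eta>a: "dilation a \<circ> \<eta> \<in> N"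
    and inv: "\<And>b x. b \<noteq> 0 \<Longrightarrow> x \<in> real_points Xp \<Longrightarrow> b *\<^sub>R x \<in> real_points Xp"
    and nz: "\<And>i x. x \<in> real_points Xp \<Longrightarrow> mpoly_eval (complexify (f i)) (vec_nth (complex_vec x)) \<noteq> 0"
    and hom: "\<And>i x. x \<in> real_points Xp \<Longrightarrow> mpoly_eval (complexify (f i)) (vec_nth (of_real a *s complex_vec x)) =
      of_real a ^ total_degree (f i) * mpoly_eval (complexify (f i)) (vec_nth (complex_vec x))"
    and w: "half_density w \<in> schwartz_half_densities" "half_density (\<lambda>y. w (a *\<^sub>R y)) \<in> schwartz_half_densities"
  shows "generically (\<lambda>s. Z (L s) \<eta> v (half_density (\<lambda>y. w (a *\<^sub>R y))) =
    of_real \<bar>a\<bar> powr (- (\<Sum>i\<in>UNIV. s $ i * of_nat (total_degree (f i))) - of_nat CARD('n) / 2) *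
    Z (L s) (dilation a \<circ> \<eta>) v (half_density w))"
proof -
  let ?U = "real_points Xp"
  have dens: "density_on (1 / 2) ?U (\<eta> v)" using \<eta> hom_spaceD(1) unfolding N by blast
  have m1: "meromorphic_vec (\<lambda>s. Z (L s) \<eta> v (half_density (\<lambda>y. w (a *\<^sub>R y))))"
    using zeta w \<eta> unfolding zeta_continuation_def by blast
  have m2: "meromorphic_vec (\<lambda>s. Z (L s) (dilation a \<circ> \<eta>) v (half_density w))"
    using zeta w \<eta>a unfolding zeta_continuation_def by blast
  have "complex_linear (\<lambda>s :: complex ^ 'r. s)" by (simp add: complex_linear_def linear_id[unfolded id_def])
  then have m3: "meromorphic_vec (\<lambda>s :: complex ^ 'r. of_real \<bar>a\<bar> powr (- (\<Sum>i\<in>UNIV. s $ i * of_nat (total_degree (f i))) - of_nat CARD('n) / 2))"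
    using a by (intro meromorphic_vec_powr_linear[where T = "\<lambda>s. s"]) auto
  obtain \<kappa> where \<kappa>: "\<And>s. (\<forall>i. Re (s $ i) > \<kappa>) \<Longrightarrow> Z (L s) \<eta> v (half_density (\<lambda>y. w (a *\<^sub>R y))) =
      density_integral ?U (zeta_integrand f s \<eta> v (half_density (\<lambda>y. w (a *\<^sub>R y))))"
    using zeta w \<eta> unfolding zeta_continuation_def by meson
  obtain \<kappa>' where \<kappa>': "\<And>s. (\<forall>i. Re (s $ i) > \<kappa>') \<Longrightarrow>
      density_integrable ?U (zeta_integrand f s (dilation a \<circ> \<eta>) v (half_density w)) \<and>
      Z (L s) (dilation a \<circ> \<eta>) v (half_density w) =
      density_integral ?U (zeta_integrand f s (dilation a \<circ> \<eta>) v (half_density w))"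
    using zeta w \<eta>a unfolding zeta_continuation_def by meson
  show ?thesis
  proof (rule meromorphic_vec_eq[OF m1 meromorphic_vec_mult[OF m3 m2] open_right_halfspaces right_halfspaces_nonempty])
    fix s :: "complex ^ 'r" assume "s \<in> {s. \<forall>i. Re (s $ i) > max \<kappa> \<kappa>'}"
    then have s: "\<forall>i. Re (s $ i) > \<kappa>" "\<forall>i. Re (s $ i) > \<kappa>'" by auto
    show "Z (L s) \<eta> v (half_density (\<lambda>y. w (a *\<^sub>R y))) =
        of_real \<bar>a\<bar> powr (- (\<Sum>i\<in>UNIV. s $ i * of_nat (total_degree (f i))) - of_nat CARD('n) / 2) *
        Z (L s) (dilation a \<circ> \<eta>) v (half_density w)"
      using \<kappa>[OF s(1)] \<kappa>'[OF s(2)]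
        zeta_integral_dilation[where U = ?U and f = f and s = s and w = w and v = v and \<eta> = \<eta>, OF a dens inv nz hom] by simp
  qed
qed

section \<open>Gamma factors\<close>

lemma zeta_continuation_linear:
  assumes "zeta_continuation L f Xp N Z" "\<xi> \<in> schwartz_half_densities" "\<eta> \<in> N" "\<zeta> \<in> N"
  shows "Z (L s) (\<lambda>v x M. c * \<eta> v x M + \<zeta> v x M) v \<xi> = c * Z (L s) \<eta> v \<xi> + Z (L s) \<zeta> v \<xi>"
  using assms unfolding zeta_continuation_def by blast

lemma zeta_continuation_sum:
  assumes "zeta_continuation L f Xp N Z" "\<xi> \<in> schwartz_half_densities" "eta_subspace N" "\<And>i. i \<in> I \<Longrightarrow> b i \<in> N"
  shows "Z (L s) (\<lambda>v x M. \<Sum>i\<in>I. c i * b i v x M) v \<xi> = (\<Sum>i\<in>I. c i * Z (L s) (b i) v \<xi>)"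
  by (rule linear_functional_sum[OF assms(3,4) zeta_continuation_linear[OF assms(1,2)]])

text \<open>\<open>zeta_continuation\<close> postulates linearity in \<open>\<eta>\<close>;
  homogeneity in \<open>\<xi>\<close> comes from the integral and is continued.\<close>

lemma zeta_continuation_scale:
  fixes f :: "'r::finite \<Rightarrow> ('n::finite, real) mpoly"
  assumes zeta: "zeta_continuation L f Xp N Z" and \<eta>: "\<eta> \<in> N"
    and \<xi>: "\<xi> \<in> schwartz_half_densities" "(\<lambda>x M. c * \<xi> x M) \<in> schwartz_half_densities"
  shows "generically (\<lambda>s. Z (L s) \<eta> v (\<lambda>x M. c * \<xi> x M) = c * Z (L s) \<eta> v \<xi>)"
proof -
  let ?U = "real_points Xp" and ?c\<xi> = "\<lambda>x M. c * \<xi> x M"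
  have m1: "meromorphic_vec (\<lambda>s. Z (L s) \<eta> v ?c\<xi>)" and m2: "meromorphic_vec (\<lambda>s. Z (L s) \<eta> v \<xi>)"
    using zeta \<xi> \<eta> unfolding zeta_continuation_def by blast+
  obtain \<kappa> where \<kappa>: "\<And>s. (\<forall>i. Re (s $ i) > \<kappa>) \<Longrightarrow> Z (L s) \<eta> v ?c\<xi> = density_integral ?U (zeta_integrand f s \<eta> v ?c\<xi>)"
    using zeta \<xi>(2) \<eta> unfolding zeta_continuation_def by meson
  obtain \<kappa>' where \<kappa>': "\<And>s. (\<forall>i. Re (s $ i) > \<kappa>') \<Longrightarrow> Z (L s) \<eta> v \<xi> = density_integral ?U (zeta_integrand f s \<eta> v \<xi>)"
    using zeta \<xi>(1) \<eta> unfolding zeta_continuation_def by meson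
  have scale: "density_integral ?U (zeta_integrand f s \<eta> v ?c\<xi>) = c * density_integral ?U (zeta_integrand f s \<eta> v \<xi>)" for s
  proof -
    have "zeta_integrand f s \<eta> v ?c\<xi> x (mat 1) = c * zeta_integrand f s \<eta> v \<xi> x (mat 1)" for x
      by (simp add: zeta_integrand_abs_power)
    then show ?thesis by (simp add: density_integral_def)
  qed
  show ?thesis
  proof (rule meromorphic_vec_eq[OF m1 meromorphic_vec_mult[OF meromorphic_vec_const m2] open_right_halfspaces right_halfspaces_nonempty])
    fix s :: "complex ^ 'r" assume "s \<in> {s. \<forall>i. Re (s $ i) > max \<kappa> \<kappa>'}"
    then have "\<forall>i. Re (s $ i) > \<kappa>" "\<forall>i. Re (s $ i) > \<kappa>'" by auto
    then show "Z (L s) \<eta> v ?c\<xi> = c * Z (L s) \<eta> v \<xi>" using \<kappa> \<kappa>' scale by simp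
  qed
qed

lemma schwartz_half_densities_scale:
  assumes "\<xi> \<in> schwartz_half_densities" shows "(\<lambda>x M. c * \<xi> x M) \<in> schwartz_half_densities"
proof -
  obtain u where u: "schwartz_function u" "\<xi> = half_density u" using assms by (auto simp: schwartz_half_densities_def)
  have "(\<lambda>x M. c * \<xi> x M) = half_density (\<lambda>x. c * u x)" by (simp add: u half_density_def mult.assoc)
  then show ?thesis using schwartz_function_scale[OF u(1)] by (simp add: schwartz_half_densities_def)
qed

text \<open>The difference is one combination over the disjoint sum \<open>I <+> J\<close>, with the
  second family of coefficients negated.\<close>

lemma zeta_separates_eq:
  fixes \<rho> :: "complex ^ 'm::finite ^ 'm \<Rightarrow> complex ^ 'n::finite ^ 'n" and f :: "'r::finite \<Rightarrow> ('n, real) mpoly"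
  assumes N: "N = hom_space G \<rho> Xp sc p \<pi>" and zeta: "zeta_continuation L f Xp N Z"
    and U: "open (real_points Xp)" and p: "frechet_space sc p"
    and nz: "\<And>x i. x \<in> real_points Xp \<Longrightarrow> mpoly_eval (complexify (f i)) (vec_nth (complex_vec x)) \<noteq> 0"
    and I: "finite I" and b: "\<And>i. i \<in> I \<Longrightarrow> b i \<in> N" and c: "\<And>i. i \<in> I \<Longrightarrow> meromorphic_vec (c i)"
    and J: "finite J" and d: "\<And>j. j \<in> J \<Longrightarrow> d j \<in> N" and e: "\<And>j. j \<in> J \<Longrightarrow> meromorphic_vec (e j)"
    and eq: "\<And>v \<xi>. \<xi> \<in> schwartz_half_densities \<Longrightarrow>
      generically (\<lambda>s. Z (L s) (\<lambda>v x M. \<Sum>i\<in>I. c i s * b i v x M) v \<xi> = Z (L s) (\<lambda>v x M. \<Sum>j\<in>J. e j s * d j v x M) v \<xi>)"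
  shows "generically (\<lambda>s. (\<lambda>v x M. \<Sum>i\<in>I. c i s * b i v x M) = (\<lambda>v x M. \<Sum>j\<in>J. e j s * d j v x M))"
proof -
  have sub: "eta_subspace N" unfolding N by (rule hom_space_subspace[OF U p])
  define B where "B = case_sum b d"
  define C where "C = case_sum c (\<lambda>j s. - e j s)"
  have neg: "meromorphic_vec (\<lambda>s. - e j s)" if "j \<in> J" for j
    using meromorphic_vec_mult[OF meromorphic_vec_const e[OF that], of "- 1"] by simp
  have B: "B k \<in> N" and C: "meromorphic_vec (C k)" if "k \<in> I <+> J" for k
    using that b d c neg by (auto simp: B_def C_def)
  have split: "(\<Sum>k\<in>I <+> J. C k s * B k v x M) = (\<Sum>i\<in>I. c i s * b i v x M) - (\<Sum>j\<in>J. e j s * d j v x M)" for s v x M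
    using I J by (simp add: sum.Plus B_def C_def sum_negf)
  have "generically (\<lambda>s. (\<lambda>v x M. \<Sum>k\<in>I <+> J. C k s * B k v x M) = (\<lambda>v x M. 0))"
  proof (rule zeta_separates[OF N zeta U p nz _ B C])
    fix v and \<xi> :: "'n dens" assume \<xi>: "\<xi> \<in> schwartz_half_densities"
    have "Z (L s) (\<lambda>v x M. \<Sum>k\<in>I <+> J. C k s * B k v x M) v \<xi> =
        Z (L s) (\<lambda>v x M. \<Sum>i\<in>I. c i s * b i v x M) v \<xi> - Z (L s) (\<lambda>v x M. \<Sum>j\<in>J. e j s * d j v x M) v \<xi>" for s
      using zeta_continuation_sum[OF zeta \<xi> sub, of "I <+> J" B s "\<lambda>k. C k s" v, OF B]
        zeta_continuation_sum[OF zeta \<xi> sub, of I b s "\<lambda>k. c k s" v, OF b]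
        zeta_continuation_sum[OF zeta \<xi> sub, of J d s "\<lambda>k. e k s" v, OF d] I J
      by (simp add: sum.Plus B_def C_def sum_negf)
    then show "generically (\<lambda>s. Z (L s) (\<lambda>v x M. \<Sum>k\<in>I <+> J. C k s * B k v x M) v \<xi> = 0)"
      using eq[OF \<xi>, of v] by simp
  qed (use I J in auto)
  then show ?thesis
    by (rule generically_mono) (simp add: split fun_eq_iff)
qed

lemma meromorphic_familyD:
  assumes "meromorphic_family L N N' \<Gamma>" "\<eta> \<in> N"
  shows "\<exists>B c. finite B \<and> B \<subseteq> N' \<and> (\<forall>b\<in>B. meromorphic_vec (c b)) \<and>
    (\<forall>s. \<Gamma> (L s) \<eta> = (\<lambda>v x M. \<Sum>b\<in>B. c b s * b v x M))"
  using assms unfolding meromorphic_family_def by blast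

theorem proposition3p14:
  fixes G :: "(complex ^ 'm ^ 'm) set"
    and \<rho> :: "complex ^ 'm ^ 'm \<Rightarrow> complex ^ 'n ^ 'n"
    and Xp Xp' :: "(complex ^ 'n) set"
    and f f' :: "'r::finite \<Rightarrow> ('n, real) mpoly"
    and \<omega> \<omega>' :: "'r \<Rightarrow> 'm charac"
    and L L' :: "complex ^ 'r \<Rightarrow> 'm tensor"
    and sc :: "complex \<Rightarrow> 'v::ab_group_add \<Rightarrow> 'v"
    and p :: "nat \<Rightarrow> 'v \<Rightarrow> real"
    and \<pi> :: "real ^ 'm ^ 'm \<Rightarrow> 'v \<Rightarrow> 'v"
    and N N' :: "('v, 'n) eta set"
    and Z Z' :: "'m tensor \<Rightarrow> ('v, 'n) eta \<Rightarrow> 'v \<Rightarrow> 'n dens \<Rightarrow> complex"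
    and \<gamma> \<gamma>' :: "(real \<Rightarrow> complex) \<Rightarrow> 'm tensor \<Rightarrow> ('v, 'n) eta \<Rightarrow> ('v, 'n) eta"
    and \<psi> :: "real \<Rightarrow> complex"
  assumes hyps: "standing_hypotheses G \<rho> Xp"
    and dual_orbit: "open_dense_orbit G (contragredient \<rho>) Xp'"
    and invariants: "basic_relative_invariants Xp f"
    and dual_invariants: "basic_relative_invariants Xp' f'"
    and eigen: "\<And>i. relative_invariant G \<rho> (f i) 1 (\<omega> i)"
    and dual_eigen: "\<And>i. relative_invariant G (contragredient \<rho>) (f' i) 1 (\<omega>' i)"
    and lattice: "Z_basis G (eigencharacters G \<rho>) \<omega>"
    and dual_lattice: "Z_basis G (eigencharacters G (contragredient \<rho>)) \<omega>'"
    and same_lattice: "eigencharacters G (contragredient \<rho>) = eigencharacters G \<rho>"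
    and L: "L = tensor_sum G (eigencharacters G \<rho>) \<omega>"
    and L': "L' = tensor_sum G (eigencharacters G \<rho>) \<omega>'"
    and SAF: "SAF_representation (real_group G) sc p \<pi>"
    and central: "has_central_character (real_group G) sc \<pi>"
    and N: "N = hom_space G \<rho> Xp sc p \<pi>"
    and N': "N' = hom_space G (contragredient \<rho>) Xp' sc p \<pi>"
    and zeta: "zeta_continuation L f Xp N Z"
    and dual_zeta: "zeta_continuation L' f' Xp' N' Z'"
    and gamma: "\<And>\<phi>. nontrivial_additive_character \<phi> \<Longrightarrow> gamma_factor L N N' Z Z' \<phi> (\<gamma> \<phi>)"
    and dual_gamma: "\<And>\<phi>. nontrivial_additive_character \<phi> \<Longrightarrow> gamma_factor L' N' N Z' Z \<phi> (\<gamma>' \<phi>)"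
    and psi: "nontrivial_additive_character \<psi>"
  shows "(\<forall>\<eta>\<in>N'. generically (\<lambda>s. \<gamma>' (dilate \<psi> (- 1)) (L s) (\<gamma> \<psi> (L s) \<eta>) =
            (\<lambda>v x M. of_real (fourier_constant TYPE('n) \<psi>) * \<eta> v x M)))
       \<and> (\<forall>a. a \<noteq> 0 \<longrightarrow> (\<forall>\<eta>\<in>N'. generically (\<lambda>s. \<gamma> (dilate \<psi> a) (L s) \<eta> =
            (\<lambda>v x M. of_real \<bar>a\<bar> powr (- degree_form L' f' (L s) - of_nat CARD('n) / 2) *
               \<gamma> \<psi> (L s) (dilation a \<circ> \<eta>) v x M))))"
proof -

  \<comment> \<open>Consequences of the hypotheses for both spaces\<close>
  have "subgroup G GL" "\<rho> \<in> hom (subgrp G) GL" and orbit: "open_dense_orbit G \<rho> Xp"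
    using hyps unfolding standing_hypotheses_def connected_reductive_group_R_def algebraic_subgroup_R_def algebraic_hom_R_def
    by auto
  then interpret act: linear_action G \<rho> by (intro linear_action.intro)
  interpret dual: linear_action G "contragredient \<rho>" by (rule act.linear_action_contragredient)
  have p: "frechet_space sc p" using SAF by (simp add: SAF_representation_def)
  have U: "open (real_points Xp)" and U': "open (real_points Xp')"
    using orbit dual_orbit open_real_points unfolding open_dense_orbit_def by auto
  note nz = basic_relative_invariants_nonzero_real[OF invariants]
  note nz' = basic_relative_invariants_nonzero_real[OF dual_invariants]
  have sub: "eta_subspace N" unfolding N by (rule hom_space_subspace[OF U p])
  have sub': "eta_subspace N'" unfolding N' by (rule hom_space_subspace[OF U' p])
  have inv': "b *\<^sub>R x \<in> real_points Xp'" if "b \<noteq> 0" "x \<in> real_points Xp'" for b x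
  proof -
    have "complex_vec (b *\<^sub>R x) = of_real b *s complex_vec x" by (simp add: complex_vec_def vec_eq_iff)
    then show ?thesis
      using dual.open_orbit_scale[OF dual_orbit that(1)] that(2) by (simp add: real_points_def)
  qed
  \<comment> \<open>Homogeneity comes from equivariance under \<open>G\<close> together with the
    density of the dual orbit.\<close>
  have hom': "mpoly_eval (complexify (f' i)) (vec_nth (of_real a *s complex_vec x)) =
      of_real a ^ total_degree (f' i) * mpoly_eval (complexify (f' i)) (vec_nth (complex_vec x))"
    if "x \<in> real_points Xp'" for i a x
    using that by (intro dual.relative_invariant_homogeneous[OF dual_orbit dual_eigen]
        basic_relative_invariants_nonzero[OF dual_invariants]) (auto simp: real_points_def)
  have chars: "character_basis G (eigencharacters G \<rho>) \<omega>" "character_basis G (eigencharacters G \<rho>) \<omega>'"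
    using eigen dual_eigen lattice dual_lattice same_lattice
    by (auto simp: character_basis_def relative_invariant_def algebraic_character_R_def)
  \<comment> \<open>\<open>\<gamma>\<close> is given in the chart \<open>L\<close> and
    \<open>\<gamma>'\<close> in \<open>L'\<close>; \<open>T\<close> and \<open>T'\<close> carry
    generic statements between them.\<close>
  obtain T T' where T: "complex_linear T" "complex_linear T'" "\<And>s. T (T' s) = s" "\<And>s. T' (T s) = s"
    and LT: "\<And>s. L' s = L (T s)" and LT': "\<And>s. L s = L' (T' s)"
    using tensor_sum_change_of_basis_bij[OF chars] unfolding L L' by metis
  have surj: "surj T" "surj T'" using T(3,4) by (metis surjI)+
  have degree: "degree_form L' f' (L s) = (\<Sum>i\<in>UNIV. T' s $ i * of_nat (total_degree (f' i)))" for s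
    unfolding LT' unfolding L' by (rule degree_form_tensor_sum[OF chars(2)])
  have gamma_family: "meromorphic_family L N' N (\<gamma> \<phi>)"
    and gamma_eq: "\<And>\<eta> v \<xi>. \<eta> \<in> N' \<Longrightarrow> \<xi> \<in> schwartz_half_densities \<Longrightarrow>
      generically (\<lambda>s. Z' (L s) \<eta> v (fourier \<phi> \<xi>) = Z (L s) (\<gamma> \<phi> (L s) \<eta>) v \<xi>)"
    if "nontrivial_additive_character \<phi>" for \<phi>
    using gamma[OF that] unfolding gamma_factor_def by auto
  have dual_gamma_family: "meromorphic_family L' N N' (\<gamma>' \<phi>)"
    and dual_gamma_eq: "\<And>\<eta> v \<xi>. \<eta> \<in> N \<Longrightarrow> \<xi> \<in> schwartz_half_densities \<Longrightarrow>
      generically (\<lambda>s. Z (L' s) \<eta> v (fourier \<phi> \<xi>) = Z' (L' s) (\<gamma>' \<phi> (L' s) \<eta>) v \<xi>)"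
    if "nontrivial_additive_character \<phi>" for \<phi>
    using dual_gamma[OF that] unfolding gamma_factor_def by auto
  have psi_dilate: "nontrivial_additive_character (dilate \<psi> a)" if "a \<noteq> 0" for a
    using additive_character_dilateI[OF psi that] by (simp add: additive_character_def)
  show ?thesis
  proof (intro conjI ballI allI impI)

    \<comment> \<open>Composition of the two gamma factors\<close>
    fix \<eta> assume \<eta>: "\<eta> \<in> N'"
    define A where "A = complex_of_real (fourier_constant TYPE('n) \<psi>)"
    define \<psi>m where "\<psi>m = dilate \<psi> (- 1)"
    have \<psi>m: "nontrivial_additive_character \<psi>m" unfolding \<psi>m_def by (rule psi_dilate) simp
    \<comment> \<open>\<open>\<gamma> \<psi> (L s) \<eta>\<close> varies with \<open>s\<close>,
      while the dual functional equation is for fixed vectors; it will be applied to each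
      \<open>b\<close> in the finite set \<open>B\<close>.\<close>
    from meromorphic_familyD[OF gamma_family[OF psi] \<eta>] obtain B c where B: "finite B" "B \<subseteq> N" "\<forall>b\<in>B. meromorphic_vec (c b)"
      and Bc': "\<forall>s. \<gamma> \<psi> (L s) \<eta> = (\<lambda>v x M. \<Sum>b\<in>B. c b s * b v x M)"
      by (elim exE conjE)
    note B = B(1,2) B(3)[rule_format] and Bc = Bc'[rule_format]
    have "\<exists>C e. finite C \<and> C \<subseteq> N' \<and> (\<forall>b'\<in>C. meromorphic_vec (e b')) \<and>
        (\<forall>s. \<gamma>' \<psi>m (L' s) b = (\<lambda>v x M. \<Sum>b'\<in>C. e b' s * b' v x M))" if "b \<in> B" for b
      using dual_gamma_family[OF \<psi>m] B(2) that unfolding meromorphic_family_def by blast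
    then have "\<forall>b. \<exists>C e. b \<in> B \<longrightarrow> finite C \<and> C \<subseteq> N' \<and> (\<forall>b'\<in>C. meromorphic_vec (e b')) \<and>
        (\<forall>s. \<gamma>' \<psi>m (L' s) b = (\<lambda>v x M. \<Sum>b'\<in>C. e b' s * b' v x M))"
      by simp
    then obtain C e where CC: "\<forall>b. b \<in> B \<longrightarrow> finite (C b) \<and> C b \<subseteq> N' \<and> (\<forall>b'\<in>C b. meromorphic_vec (e b b')) \<and>
        (\<forall>s. \<gamma>' \<psi>m (L' s) b = (\<lambda>v x M. \<Sum>b'\<in>C b. e b b' s * b' v x M))"
      unfolding choice_iff by (elim exE)
    have C: "\<And>b. b \<in> B \<Longrightarrow> finite (C b)" "\<And>b. b \<in> B \<Longrightarrow> C b \<subseteq> N'"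
      "\<And>b b'. b \<in> B \<Longrightarrow> b' \<in> C b \<Longrightarrow> meromorphic_vec (e b b')"
      and Ce: "\<And>b s. b \<in> B \<Longrightarrow> \<gamma>' \<psi>m (L' s) b = (\<lambda>v x M. \<Sum>b'\<in>C b. e b b' s * b' v x M)"
      using CC by simp_all
    have lin: "\<gamma>' \<psi>m (L' s) (\<lambda>v x M. \<Sum>b\<in>B. k b * b v x M) = (\<lambda>v x M. \<Sum>b\<in>B. k b * \<gamma>' \<psi>m (L' s) b v x M)" for s k
    proof (rule linear_map_sum[OF sub])
      show "b \<in> B \<Longrightarrow> b \<in> N" for b using B(2) by blast
      show "\<gamma>' \<psi>m (L' s) (\<lambda>v x M. d * \<zeta> v x M + \<theta> v x M) = (\<lambda>v x M. d * \<gamma>' \<psi>m (L' s) \<zeta> v x M + \<gamma>' \<psi>m (L' s) \<theta> v x M)"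
        if "\<zeta> \<in> N" "\<theta> \<in> N" for d \<zeta> \<theta>
        using dual_gamma_family[OF \<psi>m] that unfolding meromorphic_family_def by blast
    qed
    define I where "I = Sigma B C"
    \<comment> \<open>The coefficients \<open>c\<close> belong to the chart \<open>L\<close> and are
      composed with \<open>T\<close>; the coefficients \<open>e\<close> already live in
      \<open>L'\<close>.\<close>
    define coef where "coef = (\<lambda>(b, b') s. c b (T s) * e b b' s)"
    have composite: "\<gamma>' \<psi>m (L' s) (\<gamma> \<psi> (L' s) \<eta>) = (\<lambda>v x M. \<Sum>i\<in>I. coef i s * snd i v x M)" for s
      unfolding LT[of s, THEN arg_cong[where f = "\<lambda>l. \<gamma> \<psi> l \<eta>"]] Bc lin
    proof (intro ext)
      fix v x M
      have "(\<Sum>b\<in>B. c b (T s) * \<gamma>' \<psi>m (L' s) b v x M) = (\<Sum>b\<in>B. \<Sum>b'\<in>C b. c b (T s) * e b b' s * b' v x M)"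
        by (intro sum.cong) (simp_all add: Ce sum_distrib_left mult.assoc)
      also have "\<dots> = (\<Sum>i\<in>I. coef i s * snd i v x M)"
        unfolding I_def using B(1) C(1) by (subst sum.Sigma) (auto simp: coef_def split: prod.splits intro!: sum.cong)
      finally show "(\<Sum>b\<in>B. c b (T s) * \<gamma>' \<psi>m (L' s) b v x M) = (\<Sum>i\<in>I. coef i s * snd i v x M)" .
    qed
    \<comment> \<open>The one-element index set presents the multiple of \<open>\<eta>\<close> as a
      combination with a constant coefficient.\<close>
    have "generically (\<lambda>s. (\<lambda>v x M. \<Sum>i\<in>I. coef i s * snd i v x M) = (\<lambda>v x M. \<Sum>j\<in>{()}. A * \<eta> v x M))"
    proof (rule zeta_separates_eq[OF N' dual_zeta U' p nz'])
      show "finite I" using B C by (auto simp: I_def)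
      show "snd i \<in> N'" if "i \<in> I" for i using that C(2)[of "fst i"] by (auto simp: I_def)
      show "meromorphic_vec (coef i)" if "i \<in> I" for i
      proof -
        obtain b b' where i: "i = (b, b')" "b \<in> B" "b' \<in> C b" using \<open>i \<in> I\<close> by (auto simp: I_def)
        show ?thesis unfolding i(1) coef_def prod.case
          by (intro meromorphic_vec_mult meromorphic_vec_compose_linear[OF B(3) T(1) surj(1)] C(3) i)
      qed
      fix v and \<xi> :: "'n dens" assume \<xi>: "\<xi> \<in> schwartz_half_densities"
      \<comment> \<open>The equation for \<open>\<psi>\<close> is applied to this transform, so that
        its left side contains a double transform of \<open>\<xi>\<close>.\<close>
      let ?\<xi>m = "fourier \<psi>m \<xi>"
      have \<xi>m: "?\<xi>m \<in> schwartz_half_densities" by (rule fourier_schwartz[OF \<psi>m \<xi>])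
      have inversion: "fourier \<psi> ?\<xi>m = (\<lambda>x M. A * \<xi> x M)"
        unfolding \<psi>m_def A_def by (rule fourier_inversion[OF psi \<xi>])
      have "generically (\<lambda>s. Z' (L (T s)) \<eta> v (fourier \<psi> ?\<xi>m) = Z (L (T s)) (\<gamma> \<psi> (L (T s)) \<eta>) v ?\<xi>m)"
        by (rule generically_compose_linear[OF gamma_eq[OF psi \<eta> \<xi>m] T(1) surj(1)])
      then have g1: "generically (\<lambda>s. Z' (L' s) \<eta> v (\<lambda>x M. A * \<xi> x M) = Z (L' s) (\<gamma> \<psi> (L' s) \<eta>) v ?\<xi>m)"
        unfolding LT inversion .
      \<comment> \<open>\<open>B\<close> is finite, hence a single thin set; at each
        \<open>s\<close> outside it linearity gives the equation for the varying vector.\<close>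
      have g2: "generically (\<lambda>s. \<forall>b\<in>B. Z (L' s) b v ?\<xi>m = Z' (L' s) (\<gamma>' \<psi>m (L' s) b) v \<xi>)"
        using B(2) by (intro generically_ball B(1) dual_gamma_eq \<psi>m \<xi>) auto
      have g3: "generically (\<lambda>s. Z' (L' s) \<eta> v (\<lambda>x M. A * \<xi> x M) = A * Z' (L' s) \<eta> v \<xi>)"
        by (rule zeta_continuation_scale[OF dual_zeta \<eta> \<xi> schwartz_half_densities_scale[OF \<xi>]])
      show "generically (\<lambda>s. Z' (L' s) (\<lambda>v x M. \<Sum>i\<in>I. coef i s * snd i v x M) v \<xi> =
          Z' (L' s) (\<lambda>v x M. \<Sum>j\<in>{()}. A * \<eta> v x M) v \<xi>)"
      proof (rule generically_mono[OF generically_conj[OF generically_conj[OF g1 g2] g3]], elim conjE)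
        fix s
        assume 1: "Z' (L' s) \<eta> v (\<lambda>x M. A * \<xi> x M) = Z (L' s) (\<gamma> \<psi> (L' s) \<eta>) v ?\<xi>m"
          and 2: "\<forall>b\<in>B. Z (L' s) b v ?\<xi>m = Z' (L' s) (\<gamma>' \<psi>m (L' s) b) v \<xi>"
          and 3: "Z' (L' s) \<eta> v (\<lambda>x M. A * \<xi> x M) = A * Z' (L' s) \<eta> v \<xi>"
        have BN': "\<gamma>' \<psi>m (L' s) b \<in> N'" if "b \<in> B" for b
          using dual_gamma_family[OF \<psi>m] that B(2) unfolding meromorphic_family_def by blast
        have BN: "b \<in> N" if "b \<in> B" for b using that B(2) by blast
        have "Z' (L' s) (\<lambda>v x M. \<Sum>i\<in>I. coef i s * snd i v x M) v \<xi>
            = Z' (L' s) (\<lambda>v x M. \<Sum>b\<in>B. c b (T s) * \<gamma>' \<psi>m (L' s) b v x M) v \<xi>"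
          unfolding composite[symmetric] unfolding LT[of s, THEN arg_cong[where f = "\<lambda>l. \<gamma> \<psi> l \<eta>"]] Bc lin ..
        also have "\<dots> = (\<Sum>b\<in>B. c b (T s) * Z' (L' s) (\<gamma>' \<psi>m (L' s) b) v \<xi>)"
          by (rule zeta_continuation_sum[OF dual_zeta \<xi> sub' BN'])
        also have "\<dots> = (\<Sum>b\<in>B. c b (T s) * Z (L (T s)) b v ?\<xi>m)"
          using 2 by (intro sum.cong) (auto simp: LT)
        also have "\<dots> = Z (L (T s)) (\<lambda>v x M. \<Sum>b\<in>B. c b (T s) * b v x M) v ?\<xi>m"
          by (rule zeta_continuation_sum[OF zeta \<xi>m sub BN, symmetric])
        also have "\<dots> = Z (L' s) (\<gamma> \<psi> (L' s) \<eta>) v ?\<xi>m" by (simp only: LT Bc)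
        also have "\<dots> = A * Z' (L' s) \<eta> v \<xi>" using 1 3 by simp
        also have "\<dots> = Z' (L' s) (\<lambda>v x M. \<Sum>j\<in>{()}. A * \<eta> v x M) v \<xi>"
          using zeta_continuation_sum[OF dual_zeta \<xi> sub', of "{()}" "\<lambda>_. \<eta>" s "\<lambda>_. A" v] \<eta> by simp
        finally show "Z' (L' s) (\<lambda>v x M. \<Sum>i\<in>I. coef i s * snd i v x M) v \<xi> =
          Z' (L' s) (\<lambda>v x M. \<Sum>j\<in>{()}. A * \<eta> v x M) v \<xi>" .
      qed
    qed (use \<eta> in \<open>auto intro: meromorphic_vec_const\<close>)
    then have "generically (\<lambda>s. \<gamma>' \<psi>m (L' s) (\<gamma> \<psi> (L' s) \<eta>) = (\<lambda>v x M. A * \<eta> v x M))"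
      by (simp add: composite)
    from generically_compose_linear[OF this T(2) surj(2)]
    show "generically (\<lambda>s. \<gamma>' (dilate \<psi> (- 1)) (L s) (\<gamma> \<psi> (L s) \<eta>) =
        (\<lambda>v x M. of_real (fourier_constant TYPE('n) \<psi>) * \<eta> v x M))"
      unfolding LT'[symmetric] \<psi>m_def A_def .
  next

    \<comment> \<open>Dependence on the additive character\<close>
    fix a :: real and \<eta> assume a: "a \<noteq> 0" and \<eta>: "\<eta> \<in> N'"
    define \<eta>a where "\<eta>a = dilation a \<circ> \<eta>"
    have \<eta>a: "\<eta>a \<in> N'"
      using \<eta> unfolding N' \<eta>a_def by (rule dilation_hom_space[OF _ U' a inv' p])
    define w where "w = (\<lambda>s. complex_of_real \<bar>a\<bar> powr (- degree_form L' f' (L s) - of_nat CARD('n) / 2))"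
    have w: "meromorphic_vec w"
      unfolding w_def using degree by (rule meromorphic_vec_powr_linear[OF _ T(2) a])
    from meromorphic_familyD[OF gamma_family[OF psi_dilate[OF a]] \<eta>] obtain B c where B: "finite B" "B \<subseteq> N" "\<forall>b\<in>B. meromorphic_vec (c b)"
      and Bc': "\<forall>s. \<gamma> (dilate \<psi> a) (L s) \<eta> = (\<lambda>v x M. \<Sum>b\<in>B. c b s * b v x M)"
      by (elim exE conjE)
    note B = B(1,2) B(3)[rule_format] and Bc = Bc'[rule_format]
    from meromorphic_familyD[OF gamma_family[OF psi] \<eta>a] obtain C e where C: "finite C" "C \<subseteq> N" "\<forall>b\<in>C. meromorphic_vec (e b)"
      and Ce': "\<forall>s. \<gamma> \<psi> (L s) \<eta>a = (\<lambda>v x M. \<Sum>b\<in>C. e b s * b v x M)"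
      by (elim exE conjE)
    note C = C(1,2) C(3)[rule_format] and Ce = Ce'[rule_format]
    have "generically (\<lambda>s. (\<lambda>v x M. \<Sum>b\<in>B. c b s * b v x M) = (\<lambda>v x M. \<Sum>b\<in>C. (w s * e b s) * b v x M))"
    proof (rule zeta_separates_eq[OF N zeta U p nz B(1) _ B(3) C(1)])
      show "b \<in> B \<Longrightarrow> b \<in> N" "b \<in> C \<Longrightarrow> b \<in> N" for b using B(2) C(2) by blast+
      show "meromorphic_vec (\<lambda>s. w s * e b s)" if "b \<in> C" for b by (intro meromorphic_vec_mult w C(3) that)
      fix v and \<xi> :: "'n dens" assume \<xi>: "\<xi> \<in> schwartz_half_densities"
      then obtain u where u: "\<xi> = half_density u" by (auto simp: schwartz_half_densities_def)
      \<comment> \<open>Only the coefficient function is dilated here, without the half-density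
        factor of \<open>dilation\<close>; that factor appears when the dilation is moved to
        \<open>\<eta>\<close>.\<close>
      have F1: "fourier \<psi> \<xi> = half_density (fourier_scalar \<psi> u)"
        and Fa: "fourier (dilate \<psi> a) \<xi> = half_density (\<lambda>y. fourier_scalar \<psi> u (a *\<^sub>R y))"
        by (simp_all add: u fourier_half_density fourier_scalar_dilate[abs_def])
      have g1: "generically (\<lambda>s. Z' (L s) \<eta> v (fourier (dilate \<psi> a) \<xi>) = Z (L s) (\<gamma> (dilate \<psi> a) (L s) \<eta>) v \<xi>)"
        by (rule gamma_eq[OF psi_dilate[OF a] \<eta> \<xi>])
      have g2: "generically (\<lambda>s. Z' (L s) \<eta>a v (fourier \<psi> \<xi>) = Z (L s) (\<gamma> \<psi> (L s) \<eta>a) v \<xi>)"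
        by (rule gamma_eq[OF psi \<eta>a \<xi>])
      \<comment> \<open>Stated in \<open>L'\<close>, where the coordinates of \<open>s\<close> are
        the exponents of the \<open>f' i\<close>, and then pulled back to \<open>L\<close> along
        \<open>T'\<close>.\<close>
      have "generically (\<lambda>s. Z' (L' s) \<eta> v (fourier (dilate \<psi> a) \<xi>) =
          of_real \<bar>a\<bar> powr (- (\<Sum>i\<in>UNIV. s $ i * of_nat (total_degree (f' i))) - of_nat CARD('n) / 2) *
          Z' (L' s) \<eta>a v (fourier \<psi> \<xi>))"
        unfolding F1 Fa \<eta>a_def
        using \<eta>a fourier_schwartz[OF psi \<xi>] fourier_schwartz[OF psi_dilate[OF a] \<xi>] unfolding F1 Fa \<eta>a_def
        by (intro zeta_continuation_dilation[OF N' dual_zeta a \<eta> _ inv' nz' hom'])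
      from generically_compose_linear[OF this T(2) surj(2)]
      have g3: "generically (\<lambda>s. Z' (L s) \<eta> v (fourier (dilate \<psi> a) \<xi>) = w s * Z' (L s) \<eta>a v (fourier \<psi> \<xi>))"
        unfolding LT'[symmetric] w_def degree .
      show "generically (\<lambda>s. Z (L s) (\<lambda>v x M. \<Sum>b\<in>B. c b s * b v x M) v \<xi> =
          Z (L s) (\<lambda>v x M. \<Sum>b\<in>C. (w s * e b s) * b v x M) v \<xi>)"
      proof (rule generically_mono[OF generically_conj[OF generically_conj[OF g1 g2] g3]], elim conjE)
        fix s
        assume 1: "Z' (L s) \<eta> v (fourier (dilate \<psi> a) \<xi>) = Z (L s) (\<gamma> (dilate \<psi> a) (L s) \<eta>) v \<xi>"
          and 2: "Z' (L s) \<eta>a v (fourier \<psi> \<xi>) = Z (L s) (\<gamma> \<psi> (L s) \<eta>a) v \<xi>"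
          and 3: "Z' (L s) \<eta> v (fourier (dilate \<psi> a) \<xi>) = w s * Z' (L s) \<eta>a v (fourier \<psi> \<xi>)"
        have CN: "b \<in> N" if "b \<in> C" for b using that C(2) by blast
        have "Z (L s) (\<lambda>v x M. \<Sum>b\<in>C. (w s * e b s) * b v x M) v \<xi> = (\<Sum>b\<in>C. (w s * e b s) * Z (L s) b v \<xi>)"
          by (rule zeta_continuation_sum[OF zeta \<xi> sub CN])
        also have "\<dots> = w s * (\<Sum>b\<in>C. e b s * Z (L s) b v \<xi>)" by (simp add: sum_distrib_left mult.assoc)
        also have "(\<Sum>b\<in>C. e b s * Z (L s) b v \<xi>) = Z (L s) (\<gamma> \<psi> (L s) \<eta>a) v \<xi>"
          unfolding Ce by (rule zeta_continuation_sum[OF zeta \<xi> sub CN, symmetric])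
        also have "w s * \<dots> = Z (L s) (\<lambda>v x M. \<Sum>b\<in>B. c b s * b v x M) v \<xi>"
          using 1 2 3 unfolding Bc by simp
        finally show "Z (L s) (\<lambda>v x M. \<Sum>b\<in>B. c b s * b v x M) v \<xi> =
          Z (L s) (\<lambda>v x M. \<Sum>b\<in>C. (w s * e b s) * b v x M) v \<xi>" by simp
      qed
    qed
    then show "generically (\<lambda>s. \<gamma> (dilate \<psi> a) (L s) \<eta> =
        (\<lambda>v x M. of_real \<bar>a\<bar> powr (- degree_form L' f' (L s) - of_nat CARD('n) / 2) *
          \<gamma> \<psi> (L s) (dilation a \<circ> \<eta>) v x M))"
      unfolding Bc \<eta>a_def[symmetric] Ce by (simp add: w_def sum_distrib_left mult.assoc)
  qed
qed

end
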